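(* Let $G$ be a finite connected graph and $r \geq 4$ an integer. Then $G$ is $r$-locally interval if and only if $G$ is $r$-acyclic circular-arc.
   Context: A graph $G$ is an interval graph if there is a path $P$ and a mapping $v \mapsto P_v$ from vertices $v$ of $G$ to subpaths $P_v$ of $P$ such that $uv$ is an edge of $G$ if and only if $P_u$ and $P_v$ share at least one vertex. For a vertex $v$ of $G$ and integer $r \geq 0$, the ball $B_G(v, r/2)$ is the subgraph of $G$ whose vertex set consists of the vertices at distance at most $\lfloor r/2 \rfloor$ from $v$ and whose edge set consists of the edges $xy$ of $G$ with $d(v,x) + d(v,y) < r$. A graph $G$ is $r$-locally interval if every ball $B_G(v, r/2)$ is an interval graph. A graph $G$ is circular-arc if there is a cycle $C$ and a mapping $v \mapsto C_v$ from vertices of $G$ to subpaths $C_v$ of $C$ such that $uv$ is an edge of $G$ if and only if $C_u$ and $C_v$ share at least one vertex (a circular-arc representation). Such a representation is $r$-acyclic if for every set $X \subseteq V(G)$ with $|X| \leq r$, the subgraph $\bigcup_{x \in X} C_x$ of $C$ is acyclic; $G$ is $r$-acyclic circular-arc if it has an $r$-acyclic circular-arc representation. *)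

theory Defs
  imports "Graph_Theory.Graph_Theory"
begin

text \<open>
  Simple graphs are symmetric, loopless digraphs without parallel arcs (\<^locale>\<open>pair_graph\<close>,
  which includes finiteness): an undirected edge \<open>xy\<close> is the pair of arcs \<open>(x,y)\<close> and \<open>(y,x)\<close>.
\<close>

definition path_graph :: "'a pair_pre_digraph \<Rightarrow> bool" where
  "path_graph P \<longleftrightarrow> (\<exists>xs. xs \<noteq> [] \<and> distinct xs \<and>
     P = \<lparr>pverts = set xs, parcs = (set (vwalk_arcs xs))\<^sup>s\<rparr>)"

definition cycle_graph :: "'a pair_pre_digraph \<Rightarrow> bool" where
  "cycle_graph C \<longleftrightarrow> (\<exists>xs. 3 \<le> length xs \<and> distinct xs \<and>
     C = \<lparr>pverts = set xs, parcs = (set (vwalk_arcs (xs @ [hd xs])))\<^sup>s\<rparr>)"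

text \<open>
  The library's \<^const>\<open>forest\<close> is not used here: it counts \<open>(x,y), (y,x)\<close> as a directed
  cycle, so no symmetric digraph with an edge is a forest.
\<close>

definition acyclic_graph :: "'a pair_pre_digraph \<Rightarrow> bool" where
  "acyclic_graph H \<longleftrightarrow> \<not> (\<exists>C. cycle_graph C \<and> subgraph C H)"

definition subpath :: "'a pair_pre_digraph \<Rightarrow> 'a pair_pre_digraph \<Rightarrow> bool" where
  "subpath Q H \<longleftrightarrow> path_graph Q \<and> subgraph Q H"

text \<open>
  The equivalence is only required of distinct vertices, as a simple graph has no loops.
\<close>

definition subpath_representation ::
  "'a pair_pre_digraph \<Rightarrow> 'b pair_pre_digraph \<Rightarrow> ('a \<Rightarrow> 'b pair_pre_digraph) \<Rightarrow> bool" where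
  "subpath_representation G H f \<longleftrightarrow>
     (\<forall>v \<in> pverts G. subpath (f v) H) \<and>
     (\<forall>u \<in> pverts G. \<forall>v \<in> pverts G. u \<noteq> v \<longrightarrow>
        ((u, v) \<in> parcs G \<longleftrightarrow> pverts (f u) \<inter> pverts (f v) \<noteq> {}))"

text \<open>
  The host path or cycle is finite, so taking its vertices in \<^typ>\<open>nat\<close> is no restriction.
\<close>

definition interval_graph :: "'a pair_pre_digraph \<Rightarrow> bool" where
  "interval_graph G \<longleftrightarrow>
     (\<exists>(P :: nat pair_pre_digraph) f. path_graph P \<and> subpath_representation G P f)"

definition circular_arc_representation ::
  "'a pair_pre_digraph \<Rightarrow> 'b pair_pre_digraph \<Rightarrow> ('a \<Rightarrow> 'b pair_pre_digraph) \<Rightarrow> bool" where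
  "circular_arc_representation G C f \<longleftrightarrow> cycle_graph C \<and> subpath_representation G C f"

definition union_graph :: "('a \<Rightarrow> 'b pair_pre_digraph) \<Rightarrow> 'a set \<Rightarrow> 'b pair_pre_digraph" where
  "union_graph f X = \<lparr>pverts = (\<Union>x\<in>X. pverts (f x)), parcs = (\<Union>x\<in>X. parcs (f x))\<rparr>"

definition r_acyclic_representation ::
  "nat \<Rightarrow> 'a pair_pre_digraph \<Rightarrow> ('a \<Rightarrow> 'b pair_pre_digraph) \<Rightarrow> bool" where
  "r_acyclic_representation r G f \<longleftrightarrow>
     (\<forall>X. X \<subseteq> pverts G \<and> card X \<le> r \<longrightarrow> acyclic_graph (union_graph f X))"

definition r_acyclic_circular_arc :: "nat \<Rightarrow> 'a pair_pre_digraph \<Rightarrow> bool" where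
  "r_acyclic_circular_arc r G \<longleftrightarrow>
     (\<exists>(C :: nat pair_pre_digraph) f.
        circular_arc_representation G C f \<and> r_acyclic_representation r G f)"

definition graph_dist :: "'a pair_pre_digraph \<Rightarrow> 'a \<Rightarrow> 'a \<Rightarrow> ereal" where
  "graph_dist G u v = wf_digraph.\<mu> G (\<lambda>_. 1) u v"

text \<open>\<open>half_ball G v r\<close> is the ball $B_G(v, r/2)$ of radius \<open>r/2\<close>, not \<open>r\<close>.\<close>

definition half_ball :: "'a pair_pre_digraph \<Rightarrow> 'a \<Rightarrow> nat \<Rightarrow> 'a pair_pre_digraph" where
  "half_ball G v r =
     \<lparr>pverts = {x \<in> pverts G. graph_dist G v x \<le> ereal (real (r div 2))},
      parcs = {(x, y) \<in> parcs G. graph_dist G v x + graph_dist G v y < ereal (real r)}\<rparr>"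

definition r_locally_interval :: "nat \<Rightarrow> 'a pair_pre_digraph \<Rightarrow> bool" where
  "r_locally_interval r G \<longleftrightarrow> (\<forall>v \<in> pverts G. interval_graph (half_ball G v r))"

end

theory Submission
  imports Defs
begin

text \<open>
  Interval and circular-arc representations are encoded by integer endpoints. If an
  \<open>r\<close>-acyclic circular model is unrolled to the line, a closed walk of length at most \<open>r\<close> lifts
  to a closed walk, since otherwise its arcs would cover the circle. So the ball around \<open>v\<close>
  lifts, and the lifts are an interval model of it, except that (for even \<open>r\<close>) vertices at
  distance exactly \<open>r/2\<close> must be made disjoint, by shrinking each to its end facing \<open>v\<close>.

  Conversely, choose a spine: a shortest induced cycle of length at least 4 if there is one, and
  otherwise a minimal connected dominating set, which induces a path. Small obstructions in balls
  of radius 2 show that the spine dominates \<open>G\<close> and that every vertex sees a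
  consecutive block of it. Order the vertices by the first spine vertex \<open>c\<^sub>j\<close> they see, and those
  with the same \<open>j\<close> by their left endpoint in an interval model of the ball around \<open>c\<^sub>j\<close>; the arc of
  \<open>x\<close> runs from \<open>x\<close> to its last neighbour after it. A cover of the circle by few arcs yields a
  short closed walk winding around the spine, and a shortest such walk is an induced cycle, which
  is longer than \<open>r\<close>.
\<close>

section \<open>Interval models and obstructions in small balls\<close>

text \<open>The condition \<open>d(v,x) + d(v,y) < r\<close> says that the edge \<open>xy\<close>
  joins two walks from \<open>v\<close> into a closed walk of length at most \<open>r\<close>. So an
  induced cycle of length at most \<open>r\<close> lies with all its edges in one ball and, in the
  other direction, lifts of ball edges are consistent. For \<open>r = 4\<close> a ball omits the
  edges between vertices at distance 2 from its centre, which is why local arguments rest on the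
  weaker notion \<open>local_rep\<close>.

  The obstacle in building a circular model is that interval models of neighbouring balls need not
  agree. They are never glued: the model around \<open>c j\<close> only orders the vertices whose
  block starts at \<open>j\<close>. These orders fit together because, once each model is oriented
  along the spine, vertices already seen from the previous spine vertex start no later than the new
  ones. Right ends are not taken from any model, so adjacent vertices meet by construction, and the
  work lies in showing that a vertex starting inside an arc is adjacent to the owner of the arc.

  Without long induced cycles some edge of the circle stays uncovered, so winding walks only matter
  in the other case.\<close>

definition interval_model :: "'a set \<Rightarrow> 'a rel \<Rightarrow> ('a \<Rightarrow> int) \<Rightarrow> ('a \<Rightarrow> int) \<Rightarrow> bool" where
  "interval_model W F l u \<longleftrightarrow> (\<forall>x\<in>W. l x \<le> u x) \<and>
     (\<forall>x\<in>W. \<forall>y\<in>W. x \<noteq> y \<longrightarrow> ((x, y) \<in> F \<longleftrightarrow> l x \<le> u y \<and> l y \<le> u x))"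

text \<open>The interval with the smallest right end is met at that point by both of its neighbours
  on the cycle, so these two meet each other; from length 4 on they are not adjacent.\<close>

lemma no_interval_cycle:
  fixes l u :: "nat \<Rightarrow> int"
  assumes m: "4 \<le> m"
    and lu: "\<And>i. i < m \<Longrightarrow> l i \<le> u i"
    and adj: "\<And>i j. i < j \<Longrightarrow> j < m \<Longrightarrow>
      (l i \<le> u j \<and> l j \<le> u i) \<longleftrightarrow> (j = Suc i \<or> (i = 0 \<and> Suc j = m))"
  shows False
proof -
  have "\<exists>i. i < m \<and> (\<forall>j<m. u i \<le> u j)"
  proof -
    have "finite (u ` {..<m})" "u ` {..<m} \<noteq> {}" using m by (auto simp: lessThan_empty_iff)
    then obtain i where "i < m" "u i = Min (u ` {..<m})"
      by (metis (no_types, lifting) Min_in imageE lessThan_iff)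
    then show ?thesis by (intro exI[of _ i]) auto
  qed
  then obtain i where i: "i < m" and min: "\<And>j. j < m \<Longrightarrow> u i \<le> u j" by blast
  define p where "p = (if i = 0 then m - 1 else i - 1)"
  define q where "q = (if Suc i = m then 0 else Suc i)"
  have pq: "p < m" "q < m" "p \<noteq> q" "p \<noteq> i" "q \<noteq> i"
    using m i by (auto simp: p_def q_def)
  have lp: "l p \<le> u i"
    using adj[of i p] adj[of p i] pq i m by (cases "i < p") (auto simp: p_def)
  have lq: "l q \<le> u i"
    using adj[of i q] adj[of q i] pq i m by (cases "i < q") (auto simp: q_def)
  have "l p \<le> u q" "l q \<le> u p" using lp lq min[OF pq(1)] min[OF pq(2)] by linarith+
  then have "\<not> (p < q \<and> \<not> (q = Suc p \<or> p = 0 \<and> Suc q = m))"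
    "\<not> (q < p \<and> \<not> (p = Suc q \<or> q = 0 \<and> Suc p = m))"
    using adj[of p q] adj[of q p] pq by auto
  then show False using m i pq by (auto simp: p_def q_def split: if_splits)
qed

locale simple_graph =
  fixes V :: "'a set" and E :: "'a rel"
  assumes finite_V: "finite V"
    and E_in_V: "(x, y) \<in> E \<Longrightarrow> x \<in> V \<and> y \<in> V"
    and sym_E: "(x, y) \<in> E \<Longrightarrow> (y, x) \<in> E"
    and irrefl_E: "(x, x) \<notin> E"
begin

definition nbh :: "'a \<Rightarrow> 'a set" where
  "nbh v = {x. x = v \<or> (v, x) \<in> E}"

lemma mem_nbh: "x \<in> nbh v \<longleftrightarrow> x = v \<or> (v, x) \<in> E"
  by (simp add: nbh_def)

lemma nbh_self: "x \<in> nbh x"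
  by (simp add: mem_nbh)

lemma nbh_sym: "x \<in> nbh v \<longleftrightarrow> v \<in> nbh x"
  using sym_E by (auto simp: mem_nbh)

lemma E_commute: "(x, y) \<in> E \<longleftrightarrow> (y, x) \<in> E"
  using sym_E by blast

lemma nbh_V: "v \<in> V \<Longrightarrow> x \<in> nbh v \<Longrightarrow> x \<in> V"
  using E_in_V by (auto simp: mem_nbh)

text \<open>Walks replace distances: an upper bound on a distance, or on a sum of two distances,
  holds as soon as some walks satisfy it, so relation powers suffice.\<close>

definition ball_verts :: "'a \<Rightarrow> nat \<Rightarrow> 'a set" where
  "ball_verts v r = {x \<in> V. \<exists>k\<le>r div 2. (v, x) \<in> E ^^ k}"

definition ball_arcs :: "'a \<Rightarrow> nat \<Rightarrow> 'a rel" where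
  "ball_arcs v r = {(x, y) \<in> E. \<exists>k m. k + m < r \<and> (v, x) \<in> E ^^ k \<and> (v, y) \<in> E ^^ m}"

text \<open>Triangles are excluded, so that chordality means having no induced cycle in this
  sense.\<close>

definition induced_cycle :: "nat \<Rightarrow> (nat \<Rightarrow> 'a) \<Rightarrow> bool" where
  "induced_cycle m f \<longleftrightarrow> 4 \<le> m \<and> (\<forall>i<m. f i \<in> V) \<and>
     (\<forall>i j. i < j \<longrightarrow> j < m \<longrightarrow> f i \<noteq> f j \<and>
        ((f i, f j) \<in> E \<longleftrightarrow> j = Suc i \<or> (i = 0 \<and> Suc j = m)))"

lemma ball_arcsI:
  "(x, y) \<in> E \<Longrightarrow> (v, x) \<in> E ^^ k \<Longrightarrow> (v, y) \<in> E ^^ m \<Longrightarrow> k + m < r \<Longrightarrow> (x, y) \<in> ball_arcs v r"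
  unfolding ball_arcs_def by blast

lemma induced_cycleD:
  assumes "induced_cycle m f"
  shows "4 \<le> m" and "\<And>i. i < m \<Longrightarrow> f i \<in> V"
    and "\<And>i j. i < j \<Longrightarrow> j < m \<Longrightarrow> f i \<noteq> f j"
    and "\<And>i j. i < j \<Longrightarrow> j < m \<Longrightarrow> (f i, f j) \<in> E \<longleftrightarrow> j = Suc i \<or> (i = 0 \<and> Suc j = m)"
  using assms unfolding induced_cycle_def by blast+

lemma induced_cycle_model:
  assumes c: "induced_cycle m f"
    and lu: "\<And>i. i < m \<Longrightarrow> l (f i) \<le> (u (f i) :: int)"
    and adj: "\<And>i j. i < m \<Longrightarrow> j < m \<Longrightarrow> f i \<noteq> f j \<Longrightarrow>
      (f i, f j) \<in> E \<longleftrightarrow> l (f i) \<le> u (f j) \<and> l (f j) \<le> u (f i)"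
  shows False
proof (rule no_interval_cycle[of m "l \<circ> f" "u \<circ> f"])
  show "4 \<le> m" using c by (simp add: induced_cycle_def)
  show "(l \<circ> f) i \<le> (u \<circ> f) i" if "i < m" for i using lu that by simp
  show "((l \<circ> f) i \<le> (u \<circ> f) j \<and> (l \<circ> f) j \<le> (u \<circ> f) i) = (j = Suc i \<or> i = 0 \<and> Suc j = m)"
    if "i < j" "j < m" for i j
    using adj[of i j] c that unfolding induced_cycle_def by auto
qed

end

text \<open>Connectivity is put in terms of cuts because it only serves to find edges leaving a
  vertex set.\<close>

locale connected_simple_graph = simple_graph +
  assumes V_nonempty: "V \<noteq> {}"
    and cut_edge: "S \<subseteq> V \<Longrightarrow> S \<noteq> {} \<Longrightarrow> S \<noteq> V \<Longrightarrow> \<exists>x\<in>S. \<exists>y\<in>V - S. (x, y) \<in> E"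

locale locally_interval_graph = connected_simple_graph +
  fixes r :: nat
  assumes r4: "4 \<le> r"
    and ball_interval: "v \<in> V \<Longrightarrow> \<exists>l u. interval_model (ball_verts v r) (ball_arcs v r) l u"
begin

text \<open>This is what every \<open>r >= 4\<close> provides on the second neighbourhood of
  \<open>v\<close>. Intervals of adjacent vertices must meet only if one of the two lies in
  \<open>nbh v\<close>: for \<open>r = 4\<close> an edge between two vertices at distance 2 is
  missing from the ball.\<close>

definition local_rep :: "'a \<Rightarrow> ('a \<Rightarrow> int) \<Rightarrow> ('a \<Rightarrow> int) \<Rightarrow> bool" where
  "local_rep v l u \<longleftrightarrow>
     (\<forall>w\<in>nbh v. \<forall>x\<in>nbh w. l x \<le> u x) \<and>
     (\<forall>x\<in>nbh v. \<forall>y. (x, y) \<in> E \<longrightarrow> l x \<le> u y \<and> l y \<le> u x) \<and>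
     (\<forall>w\<in>nbh v. \<forall>x\<in>nbh w. \<forall>w'\<in>nbh v. \<forall>y\<in>nbh w'.
        x \<noteq> y \<longrightarrow> (x, y) \<notin> E \<longrightarrow> u x < l y \<or> u y < l x)"

lemma local_repD:
  assumes "local_rep v l u"
  shows "\<And>x w. w \<in> nbh v \<Longrightarrow> x \<in> nbh w \<Longrightarrow> l x \<le> u x"
    and "\<And>x y. x \<in> nbh v \<Longrightarrow> (x, y) \<in> E \<Longrightarrow> l x \<le> u y \<and> l y \<le> u x"
    and "\<And>x y w w'. w \<in> nbh v \<Longrightarrow> x \<in> nbh w \<Longrightarrow> w' \<in> nbh v \<Longrightarrow> y \<in> nbh w' \<Longrightarrow>
       x \<noteq> y \<Longrightarrow> (x, y) \<notin> E \<Longrightarrow> u x < l y \<or> u y < l x"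
  using assms unfolding local_rep_def by blast+

lemma local_rep_exists:
  assumes v: "v \<in> V"
  shows "\<exists>l u. local_rep v l u"
proof -
  obtain l u where m: "interval_model (ball_verts v r) (ball_arcs v r) l u"
    using ball_interval[OF v] by blast
  have one: "\<exists>k\<le>1. (v, x) \<in> E ^^ k" if "x \<in> nbh v" for x
    using that unfolding mem_nbh by (metis le_refl relpow_0_I relpow_1 zero_le)
  have two: "\<exists>k\<le>2. (v, x) \<in> E ^^ k" if w: "w \<in> nbh v" "x \<in> nbh w" for x w
  proof -
    obtain k where k: "k \<le> 1" "(v, w) \<in> E ^^ k" using one[OF w(1)] by blast
    show ?thesis
    proof (cases "x = w")
      case True then show ?thesis using k by (intro exI[of _ k]) auto
    next
      case False
      then have "(w, x) \<in> E" using w by (auto simp: mem_nbh)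
      then have "(v, x) \<in> E ^^ Suc k" using k by auto
      then show ?thesis using k by (intro exI[of _ "Suc k"]) auto
    qed
  qed
  have inb: "x \<in> ball_verts v r" if w: "w \<in> nbh v" "x \<in> nbh w" for x w
  proof -
    obtain k where "k \<le> 2" "(v, x) \<in> E ^^ k" using two[OF w] by blast
    moreover have "2 \<le> r div 2" using r4 by simp
    ultimately show ?thesis using nbh_V[OF nbh_V[OF v w(1)] w(2)]
      unfolding ball_verts_def by (auto intro: exI[of _ k])
  qed
  have "local_rep v l u"
    unfolding local_rep_def
  proof (intro conjI ballI allI impI)
    show "l x \<le> u x" if "w \<in> nbh v" "x \<in> nbh w" for x w
      using m inb[OF that] by (auto simp: interval_model_def)
    have ov: "l x \<le> u y \<and> l y \<le> u x" if xy: "x \<in> nbh v" "(x, y) \<in> E" for x y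
    proof -
      have y: "y \<in> nbh x" using xy by (simp add: mem_nbh)
      obtain k where k: "k \<le> 1" "(v, x) \<in> E ^^ k" using one[OF xy(1)] by blast
      obtain k' where k': "k' \<le> 2" "(v, y) \<in> E ^^ k'" using two[OF xy(1) y] by blast
      \<comment> \<open>The walks have lengths at most 1 and 2, and
        \<open>1 + 2 < r\<close>.\<close>
      have "(x, y) \<in> ball_arcs v r"
        using ball_arcsI[OF xy(2) k(2) k'(2), of r] k(1) k'(1) r4 by linarith
      moreover have "x \<in> ball_verts v r" using inb[OF xy(1), of x] by (simp add: mem_nbh)
      moreover have "y \<in> ball_verts v r" using inb[OF xy(1) y] .
      moreover have "x \<noteq> y" using xy irrefl_E by auto
      ultimately show ?thesis using m by (auto simp: interval_model_def)
    qed
    show "l x \<le> u y" "l y \<le> u x" if "x \<in> nbh v" "(x, y) \<in> E" for x y using ov[OF that] by auto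
    show "u x < l y \<or> u y < l x"
      if h: "w \<in> nbh v" "x \<in> nbh w" "w' \<in> nbh v" "y \<in> nbh w'" "x \<noteq> y" "(x, y) \<notin> E" for x y w w'
    proof -
      have "(x, y) \<notin> ball_arcs v r" using h by (auto simp: ball_arcs_def)
      then have "\<not> (l x \<le> u y \<and> l y \<le> u x)"
        using m inb[OF h(1,2)] inb[OF h(3,4)] h(5) unfolding interval_model_def by blast
      then show ?thesis by linarith
    qed
  qed
  then show ?thesis by blast
qed

text \<open>A cycle with \<open>m <= r\<close> vertices fits into the ball around
  \<open>f 0\<close>: the shorter way round takes at most \<open>m div 2\<close> steps, and the ends
  of the edge from \<open>f i\<close> to \<open>f (Suc i)\<close> are reached in opposite directions
  by walks of total length \<open>m - 1\<close>. So an interval graph would contain an induced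
  cycle.\<close>

lemma induced_cycle_long:
  assumes c: "induced_cycle m f"
  shows "r < m"
proof (rule ccontr)
  assume "\<not> r < m"
  then have mr: "m \<le> r" by simp
  have m4: "4 \<le> m" using c by (simp add: induced_cycle_def)
  have fV: "f i \<in> V" if "i < m" for i using c that by (simp add: induced_cycle_def)
  obtain l u where lu: "interval_model (ball_verts (f 0) r) (ball_arcs (f 0) r) l u"
    using ball_interval[of "f 0"] fV[of 0] m4 by auto
  have step: "(f i, f (Suc i)) \<in> E" if "Suc i < m" for i
    using induced_cycleD(4)[OF c, of i "Suc i"] that by simp
  have wrap: "(f 0, f (m - 1)) \<in> E"
    using induced_cycleD(4)[OF c, of 0 "m - 1"] m4 by simp
  have up: "(f 0, f i) \<in> E ^^ i" if "i < m" for i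
    using that by (induction i) (auto intro: step)
  have down: "(f 0, f (m - Suc i)) \<in> E ^^ Suc i" if "i < m" for i
    using that
  proof (induction i)
    case 0 then show ?case using wrap by simp
  next
    case (Suc i)
    have "(f (m - Suc (Suc i)), f (Suc (m - Suc (Suc i)))) \<in> E" using Suc.prems by (intro step) auto
    then have "(f (m - Suc i), f (m - Suc (Suc i))) \<in> E"
      using Suc.prems sym_E by (simp add: Suc_diff_Suc)
    then show ?case using Suc by auto
  qed
  have inb: "f i \<in> ball_verts (f 0) r" if i: "i < m" for i
  proof (cases "i \<le> m div 2")
    case True
    then have "i \<le> r div 2" using mr div_le_mono[of m r 2] by linarith
    then show ?thesis using up[OF i] fV[OF i] by (auto simp: ball_verts_def)
  next
    case False
    have "(f 0, f i) \<in> E ^^ (m - i)" using down[of "m - i - 1"] i by (auto simp: Suc_diff_Suc)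
    moreover have "m - i \<le> r div 2" using False mr div_le_mono[of m r 2] by linarith
    ultimately show ?thesis using fV[OF i] by (auto simp: ball_verts_def)
  qed
  have arcE: "(f i, f j) \<in> ball_arcs (f 0) r" if ij: "i < j" "j < m" "(f i, f j) \<in> E" for i j
  proof -
    have "j = Suc i \<or> (i = 0 \<and> Suc j = m)" using c ij unfolding induced_cycle_def by blast
    then consider "j = Suc i" | "i = 0" "Suc j = m" by blast
    then show ?thesis
    proof cases
      case 1
      have "(f 0, f j) \<in> E ^^ (m - j)" using down[of "m - j - 1"] ij by (auto simp: Suc_diff_Suc)
      then show ?thesis using ball_arcsI[OF ij(3) up[of i], of "m - j"] ij 1 mr by simp
    next
      case 2
      then have j: "j = m - 1" by simp
      have "(f 0, f j) \<in> E ^^ Suc 0" using wrap j by simp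
      then show ?thesis using ball_arcsI[OF ij(3) up[of i], of "Suc 0"] ij 2 r4 by simp
    qed
  qed
  have arcs_sym: "(y, x) \<in> ball_arcs v r" if "(x, y) \<in> ball_arcs v r" for v x y
    using that sym_E unfolding ball_arcs_def by (auto simp: add.commute) (metis add.commute)
  have arc: "(f i, f j) \<in> ball_arcs (f 0) r \<longleftrightarrow> (f i, f j) \<in> E" if ij: "i < m" "j < m" "f i \<noteq> f j" for i j
  proof
    assume "(f i, f j) \<in> ball_arcs (f 0) r" then show "(f i, f j) \<in> E" by (auto simp: ball_arcs_def)
  next
    assume e: "(f i, f j) \<in> E"
    consider "i < j" | "j < i" using ij by (metis nat_neq_iff)
    then show "(f i, f j) \<in> ball_arcs (f 0) r"
      using arcE[of i j] arcE[of j i] ij e arcs_sym sym_E by cases auto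
  qed
  show False
  proof (rule induced_cycle_model[OF c, of l u])
    show "l (f i) \<le> u (f i)" if "i < m" for i using lu inb[OF that] by (auto simp: interval_model_def)
    show "((f i, f j) \<in> E) = (l (f i) \<le> u (f j) \<and> l (f j) \<le> u (f i))"
      if "i < m" "j < m" "f i \<noteq> f j" for i j
      using lu inb[OF that(1)] inb[OF that(2)] arc[OF that] that(3) unfolding interval_model_def by blast
  qed
qed

text \<open>The rim lies in the closed neighbourhood of the hub, so the local model at
  \<open>x\<close> represents the whole cycle, whatever its length.\<close>

lemma no_wheel:
  assumes c: "induced_cycle m f" and x: "\<And>i. i < m \<Longrightarrow> (x, f i) \<in> E"
  shows False
proof -
  have "4 \<le> m" using c by (simp add: induced_cycle_def)
  then have xV: "x \<in> V" using x[of 0] E_in_V by auto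
  obtain l u where R: "local_rep x l u"
    using local_rep_exists[OF xV] by blast
  note a = local_repD(1)[OF R]
  note b = local_repD(2)[OF R]
  note d = local_repD(3)[OF R]
  have n: "f i \<in> nbh x" if "i < m" for i using x that by (simp add: mem_nbh)
  show False
  proof (rule induced_cycle_model[OF c, of l u])
    show "l (f i) \<le> u (f i)" if "i < m" for i using a[OF n[OF that] nbh_self] .
    show "((f i, f j) \<in> E) = (l (f i) \<le> u (f j) \<and> l (f j) \<le> u (f i))"
      if "i < m" "j < m" "f i \<noteq> f j" for i j
      using b[OF n[OF that(1)], of "f j"] d[OF n[OF that(1)] nbh_self n[OF that(2)] nbh_self that(3)] by fastforce
  qed
qed

text \<open>Of the three disjoint intervals meeting that of \<open>c\<close>, the middle one lies
  inside it, so its outer neighbour would meet \<open>c\<close> as well.\<close>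

lemma claw:
  assumes "(c, p) \<in> E" "(c, q) \<in> E" "(c, s) \<in> E"
    and "p \<noteq> q" "q \<noteq> s" "p \<noteq> s" "(p, q) \<notin> E" "(q, s) \<notin> E" "(p, s) \<notin> E"
    and "(p, p') \<in> E" "(q, q') \<in> E" "(s, s') \<in> E"
    and "p' \<notin> nbh c" "q' \<notin> nbh c" "s' \<notin> nbh c"
  shows False
proof -
  have cV: "c \<in> V" using assms(1) E_in_V by blast
  obtain l u where R: "local_rep c l u"
    using local_rep_exists[OF cV] by blast
  note b = local_repD(2)[OF R]
  note d = local_repD(3)[OF R]
  have n: "c \<in> nbh c" "p \<in> nbh c" "q \<in> nbh c" "s \<in> nbh c" "p' \<in> nbh p" "q' \<in> nbh q" "s' \<in> nbh s"
    "p \<in> nbh p" "q \<in> nbh q" "s \<in> nbh s"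
    using assms(1-3,10-12) by (auto simp: mem_nbh)
  have "(p', c) \<notin> E" "(q', c) \<notin> E" "(s', c) \<notin> E" "p' \<noteq> c" "q' \<noteq> c" "s' \<noteq> c"
    using assms(13-15) sym_E by (auto simp: mem_nbh)
  note D = d[OF n(2) n(5) n(1) n(1) this(4) this(1)] d[OF n(3) n(6) n(1) n(1) this(5) this(2)]
    d[OF n(4) n(7) n(1) n(1) this(6) this(3)]
    d[OF n(2) n(8) n(3) n(9) assms(4) assms(7)] d[OF n(3) n(9) n(4) n(10) assms(5) assms(8)]
    d[OF n(2) n(8) n(4) n(10) assms(6) assms(9)]
  note B = b[OF n(2) assms(10)] b[OF n(3) assms(11)] b[OF n(4) assms(12)]
    b[OF n(1) assms(1)] b[OF n(1) assms(2)] b[OF n(1) assms(3)]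
  show False using B D by (smt (verit))
qed

text \<open>A triangle \<open>y\<close>, \<open>p\<close>, \<open>q\<close> with a pendant vertex at
  each corner. Of three pairwise meeting intervals one is contained in the union of the other two,
  which leaves no room for its pendant neighbour.\<close>

lemma net:
  assumes "(y, x) \<in> E" "(y, p) \<in> E" "(y, q) \<in> E" "(p, q) \<in> E" "(p, p') \<in> E" "(q, q') \<in> E"
    and "(x, p) \<notin> E" "(x, q) \<notin> E" "(x, p') \<notin> E" "(x, q') \<notin> E" "(p', q') \<notin> E"
    and "(p', y) \<notin> E" "(p', q) \<notin> E" "(q', y) \<notin> E" "(q', p) \<notin> E"
    and "x \<noteq> p" "x \<noteq> q" "x \<noteq> p'" "x \<noteq> q'" "p' \<noteq> q'" "p' \<noteq> y" "p' \<noteq> q" "q' \<noteq> y" "q' \<noteq> p"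
  shows False
proof -
  have cV: "y \<in> V" using assms(1) E_in_V by blast
  obtain l u where R: "local_rep y l u"
    using local_rep_exists[OF cV] by blast
  note e = local_repD(1)[OF R]
  note b = local_repD(2)[OF R]
  note d = local_repD(3)[OF R]
  have n: "y \<in> nbh y" "x \<in> nbh y" "p \<in> nbh y" "q \<in> nbh y" "p' \<in> nbh p" "q' \<in> nbh q"
    "x \<in> nbh x" "p \<in> nbh p" "q \<in> nbh q"
    using assms(1-6) by (auto simp: mem_nbh)
  note D = d[OF n(2) n(7) n(3) n(8) assms(16) assms(7)]
    d[OF n(2) n(7) n(4) n(9) assms(17) assms(8)]
    d[OF n(2) n(7) n(3) n(5) assms(18) assms(9)]
    d[OF n(2) n(7) n(4) n(6) assms(19) assms(10)]
    d[OF n(3) n(5) n(4) n(6) assms(20) assms(11)]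
    d[OF n(3) n(5) n(1) n(1) assms(21) assms(12)]
    d[OF n(3) n(5) n(4) n(9) assms(22) assms(13)]
    d[OF n(4) n(6) n(1) n(1) assms(23) assms(14)]
    d[OF n(4) n(6) n(3) n(8) assms(24) assms(15)]
  note B = b[OF n(1) assms(1)] b[OF n(1) assms(2)] b[OF n(1) assms(3)] b[OF n(3) assms(4)]
    b[OF n(3) assms(5)] b[OF n(4) assms(6)]
  show False using B D e[OF n(2) n(7)] e[OF n(3) n(8)] e[OF n(4) n(9)] e[OF n(3) n(5)] e[OF n(4) n(6)] e[OF n(1) n(1)] by (smt (verit))
qed

text \<open>The disjoint intervals of \<open>p\<close> and \<open>q\<close> both stick out of that
  of \<open>y\<close>, because of \<open>p'\<close> and \<open>q'\<close>, and hence cover its two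
  ends; \<open>m\<close> meets both and covers the gap between them. So nothing of \<open>y\<close>
  is left where \<open>x\<close> could meet it alone.\<close>

lemma tent:
  assumes "(y, x) \<in> E" "(y, p) \<in> E" "(y, m) \<in> E" "(y, q) \<in> E" "(p, m) \<in> E" "(m, q) \<in> E"
    and "(p, p') \<in> E" "(q, q') \<in> E" "(p, q) \<notin> E" "p \<noteq> q"
    and "(x, p) \<notin> E" "(x, m) \<notin> E" "(x, q) \<notin> E" "x \<noteq> p" "x \<noteq> m" "x \<noteq> q"
    and "(p', y) \<notin> E" "p' \<noteq> y" "(q', y) \<notin> E" "q' \<noteq> y"
  shows False
proof -
  have cV: "y \<in> V" using assms(1) E_in_V by blast
  obtain l u where R: "local_rep y l u"
    using local_rep_exists[OF cV] by blast
  note e = local_repD(1)[OF R]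
  note b = local_repD(2)[OF R]
  note d = local_repD(3)[OF R]
  have n: "y \<in> nbh y" "x \<in> nbh y" "p \<in> nbh y" "q \<in> nbh y" "p' \<in> nbh p" "q' \<in> nbh q"
    "x \<in> nbh x" "p \<in> nbh p" "q \<in> nbh q" "m \<in> nbh y" "m \<in> nbh m"
    using assms(1-8) by (auto simp: mem_nbh)
  note D = d[OF n(3) n(8) n(4) n(9) assms(10) assms(9)]
    d[OF n(2) n(7) n(3) n(8) assms(14) assms(11)]
    d[OF n(2) n(7) n(10) n(11) assms(15) assms(12)]
    d[OF n(2) n(7) n(4) n(9) assms(16) assms(13)]
    d[OF n(3) n(5) n(1) n(1) assms(18) assms(17)]
    d[OF n(4) n(6) n(1) n(1) assms(20) assms(19)]
  note B = b[OF n(1) assms(1)] b[OF n(1) assms(2)] b[OF n(1) assms(3)] b[OF n(1) assms(4)]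
    b[OF n(3) assms(5)] b[OF n(10) assms(6)] b[OF n(3) assms(7)] b[OF n(4) assms(8)]
  show False using B D e[OF n(2) n(7)] e[OF n(3) n(8)] e[OF n(4) n(9)] e[OF n(3) n(5)] e[OF n(4) n(6)] e[OF n(1) n(1)] e[OF n(10) n(11)] by (smt (verit))
qed

end

section \<open>Circular models from a spine\<close>

context locally_interval_graph
begin

lemma local_rep_flip:
  assumes "local_rep v l u"
  shows "local_rep v (\<lambda>x. - u x) (\<lambda>x. - l x)"
  unfolding local_rep_def
proof (intro conjI ballI allI impI)
  note D = local_repD[OF assms]
  show "- u x \<le> - l x" if "w \<in> nbh v" "x \<in> nbh w" for w x using D(1)[OF that] by simp
  show "- u x \<le> - l y" if "x \<in> nbh v" "(x, y) \<in> E" for x y using D(2)[OF that] by simp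
  show "- u y \<le> - l x" if "x \<in> nbh v" "(x, y) \<in> E" for x y using D(2)[OF that] by simp
  show "- l x < - u y \<or> - l y < - u x"
    if "w \<in> nbh v" "x \<in> nbh w" "w' \<in> nbh v" "y \<in> nbh w'" "x \<noteq> y" "(x, y) \<notin> E" for w x w' y
    using D(3)[OF that] by auto
qed

text \<open>The part of a local model around \<open>b\<close> that the vertex order needs, where
  \<open>a\<close>, \<open>b\<close>, \<open>d\<close> are consecutive on the spine and
  \<open>a\<close> lies to the left. The fourth clause serves neighbours \<open>y\<close> whose
  block starts right after \<open>b\<close>. In the last clause \<open>a'\<close> is the spine
  vertex before \<open>a\<close>; its presence makes \<open>a\<close> stick out of \<open>b\<close>
  on the left.\<close>

definition local_order :: "'a \<Rightarrow> 'a \<Rightarrow> 'a \<Rightarrow> ('a \<Rightarrow> int) \<Rightarrow> ('a \<Rightarrow> int) \<Rightarrow> bool" where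
  "local_order a b d l u \<longleftrightarrow> (\<forall>x\<in>nbh b. l x \<le> u x) \<and>
    (\<forall>x\<in>nbh b. \<forall>z\<in>nbh b. l x \<le> l z \<longrightarrow> l z \<le> u x \<longrightarrow> z \<in> nbh x) \<and>
    (\<forall>x\<in>nbh b. \<forall>y\<in>nbh b. (x, y) \<in> E \<longrightarrow> l y \<le> u x) \<and>
    (\<forall>x\<in>nbh b. \<forall>z\<in>nbh b. \<forall>y\<in>nbh d - nbh b. (x, y) \<in> E \<longrightarrow> l z \<le> u x) \<and>
    (\<forall>a'. (a', a) \<in> E \<longrightarrow> a' \<notin> nbh b \<longrightarrow> (\<forall>x\<in>nbh b \<inter> nbh a. \<forall>z\<in>nbh b - nbh a. l x \<le> l z))"

lemma local_order_exists:
  assumes ab: "(a, b) \<in> E" and bd: "(b, d) \<in> E" and ad: "a \<notin> nbh d"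
  shows "\<exists>l u. local_order a b d l u"
proof -
  have bV: "b \<in> V" using ab E_in_V by blast
  have n: "b \<in> nbh b" "a \<in> nbh b" "d \<in> nbh b" "a \<in> nbh a" "d \<in> nbh d"
    using ab bd sym_E by (auto simp: mem_nbh)
  have ad': "a \<noteq> d" "(a, d) \<notin> E" using ad sym_E by (auto simp: mem_nbh)
  obtain l0 u0 where R0: "local_rep b l0 u0" using local_rep_exists[OF bV] by blast
  have "u0 a < l0 d \<or> u0 d < l0 a" by (rule local_repD(3)[OF R0 n(2) n(4) n(3) n(5) ad'])
  \<comment> \<open>The intervals of \<open>a\<close> and \<open>d\<close> are disjoint; a
    reflection, if necessary, puts \<open>a\<close> to the left.\<close>
  then obtain l u where R: "local_rep b l u" and o: "u a < l d"
    using R0 local_rep_flip[OF R0] by (metis neg_less_iff_less)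
  note R1 = local_repD(1)[OF R] and R2 = local_repD(2)[OF R] and R3 = local_repD(3)[OF R]
  have meet: "l x \<le> u y" if "x \<in> nbh b" "y \<in> nbh x" for x y
    using that R1[OF that(1) nbh_self] R2[OF that(1)] by (auto simp: mem_nbh)
  have meet': "l y \<le> u x" if "x \<in> nbh b" "y \<in> nbh x" for x y
    using that R1[OF that(1) nbh_self] R2[OF that(1)] by (auto simp: mem_nbh)
  show ?thesis
    unfolding local_order_def
  proof (rule exI[of _ l], rule exI[of _ u], intro conjI ballI allI impI)
    show "l x \<le> u x" if "x \<in> nbh b" for x using R1[OF that nbh_self] .
    show "z \<in> nbh x" if h: "x \<in> nbh b" "z \<in> nbh b" "l x \<le> l z" "l z \<le> u x" for x z
    proof (rule ccontr)
      assume "z \<notin> nbh x"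
      then have "x \<noteq> z" "(x, z) \<notin> E" by (auto simp: mem_nbh)
      then have "u x < l z \<or> u z < l x" using R3[OF h(1) nbh_self h(2) nbh_self] by blast
      then show False using h(3,4) R1[OF h(2) nbh_self] by linarith
    qed
    show "l y \<le> u x" if "x \<in> nbh b" "y \<in> nbh b" "(x, y) \<in> E" for x y
      using meet'[OF that(1)] that(3) by (simp add: mem_nbh)
    show "l z \<le> u x" if h: "x \<in> nbh b" "z \<in> nbh b" "y \<in> nbh d - nbh b" "(x, y) \<in> E" for x z y
    proof -
      \<comment> \<open>\<open>b\<close> meets \<open>a\<close>, which ends before \<open>d\<close>
        starts; so an interval meeting \<open>d\<close> but not \<open>b\<close> lies to the right
        of \<open>b\<close>. As \<open>x\<close> meets it, \<open>x\<close> reaches past the end of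
        \<open>b\<close> and so past the start of \<open>z\<close>.\<close>
      have y: "y \<in> nbh d" "(b, y) \<notin> E" "b \<noteq> y" using h by (auto simp: mem_nbh)
      have "u b < l y \<or> u y < l b" using R3[OF n(1) n(1) n(3) y(1) y(3) y(2)] .
      moreover have "l d \<le> u y" using meet[OF n(3) y(1)] .
      moreover have "l b \<le> u a" using meet[OF n(1) n(2)] .
      ultimately have "u b < l y" using o by linarith
      moreover have "l y \<le> u x" using meet'[OF h(1)] h(4) by (simp add: mem_nbh)
      moreover have "l z \<le> u b" using meet[OF h(2)] h(2) nbh_sym by blast
      ultimately show ?thesis by linarith
    qed
    show "l x \<le> l z"
      if h: "(a', a) \<in> E" "a' \<notin> nbh b" "x \<in> nbh b \<inter> nbh a" "z \<in> nbh b - nbh a" for a' x z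
    proof -
      \<comment> \<open>\<open>a'\<close> meets \<open>a\<close> but not \<open>b\<close>, and it
        cannot lie to the right of \<open>b\<close> because \<open>a\<close> ends before
        \<open>b\<close> does. So \<open>a\<close> starts before \<open>b\<close>, and whatever
        meets \<open>b\<close> but not \<open>a\<close> starts after the end of
        \<open>a\<close>.\<close>
      have a': "a' \<in> nbh a" "(b, a') \<notin> E" "b \<noteq> a'" using h sym_E by (auto simp: mem_nbh)
      have "u b < l a' \<or> u a' < l b" using R3[OF n(1) n(1) n(2) a'(1) a'(3) a'(2)] .
      moreover have "l a' \<le> u a" "l a \<le> u a'" using meet'[OF n(2) a'(1)] meet[OF n(2) a'(1)] by auto
      moreover have "l d \<le> u b" using meet'[OF n(1) n(3)] .
      ultimately have la: "l a < l b" using o by linarith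
      have z: "z \<in> nbh b" "a \<noteq> z" "(a, z) \<notin> E" using h by (auto simp: mem_nbh)
      have "u a < l z \<or> u z < l a" using R3[OF n(2) nbh_self z(1) nbh_self z(2,3)] .
      moreover have "l b \<le> u z" using meet[OF n(1) z(1)] .
      ultimately have "u a < l z" using la by linarith
      moreover have "l x \<le> u a" using meet'[OF n(2), of x] h(3) by simp
      ultimately show ?thesis by linarith
    qed
  qed
qed

end

text \<open>An arc of the circle of length \<open>N\<close> is given by one of its lifts to the
  line, and \<open>k\<close> selects a translate of the other arc. By \<open>b x < a x + N\<close>
  an arc may contain all \<open>N\<close> points but misses an edge, so it is a path.\<close>

definition circular_model :: "'a set \<Rightarrow> 'a rel \<Rightarrow> int \<Rightarrow> ('a \<Rightarrow> int) \<Rightarrow> ('a \<Rightarrow> int) \<Rightarrow> bool" where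
  "circular_model V E N a b \<longleftrightarrow> (\<forall>x\<in>V. a x \<le> b x \<and> b x < a x + N) \<and>
     (\<forall>x\<in>V. \<forall>y\<in>V. x \<noteq> y \<longrightarrow>
        ((x, y) \<in> E \<longleftrightarrow> (\<exists>k. a x \<le> b y + k * N \<and> a y + k * N \<le> b x)))"

lemma finite_int_bound:
  fixes g :: "'a \<Rightarrow> int"
  assumes "finite A"
  shows "\<exists>B. \<forall>x\<in>A. \<bar>g x\<bar> \<le> B"
  using finite_imageI[OF assms, of "\<lambda>x. \<bar>g x\<bar>"] by (meson Max_ge imageI)

text \<open>Positions along the circle will be two-digit numbers in base \<open>W\<close>: a spine
  index followed by an offset in \<open>0..<W\<close>. Comparing them is then lexicographic.\<close>

lemma lex_le:
  fixes p q f g W :: int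
  assumes "0 \<le> f" "0 \<le> g" "g < W" "p * W + f \<le> q * W + g"
  shows "p < q \<or> (p = q \<and> f \<le> g)"
proof -
  have "\<not> q < p"
  proof
    assume "q < p"
    then have "(q + 1) * W \<le> p * W" using assms by (intro mult_right_mono) auto
    then show False using assms by (simp add: algebra_simps)
  qed
  then show ?thesis using assms by (cases "p = q") auto
qed

text \<open>
  All indices live on the line of integers: \<open>c\<close> has period \<open>M\<close>, and \<open>[s x + k * M, e x + k * M]\<close>,
  for integers \<open>k\<close>, are the runs of indices in \<open>J\<close> whose spine vertex is \<open>x\<close> or a neighbour of \<open>x\<close>.
\<close>

locale spined_graph = locally_interval_graph +
  fixes c :: "int \<Rightarrow> 'a" and M :: int and J :: "int set" and s e :: "'a \<Rightarrow> int"
  assumes M1: "1 < M"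
    and c_per: "c (i + k * M) = c i"
    and J_per: "i + k * M \<in> J \<longleftrightarrow> i \<in> J"
    and s_range: "x \<in> V \<Longrightarrow> 0 \<le> s x \<and> s x < M"
    and s_le_e: "x \<in> V \<Longrightarrow> s x \<le> e x"
    and block: "x \<in> V \<Longrightarrow> i \<in> J \<and> x \<in> nbh (c i) \<longleftrightarrow> (\<exists>k. s x + k * M \<le> i \<and> i \<le> e x + k * M)"
    and short: "x \<in> V \<Longrightarrow> y \<in> V \<Longrightarrow> e x - s x + (e y - s y) < M"
    and meet: "(x, y) \<in> E \<Longrightarrow> \<exists>k. s x \<le> e y + k * M \<and> s y + k * M \<le> e x"
    and spine: "j \<in> J \<Longrightarrow> (c (j - 1), c j) \<in> E \<and> (c j, c (j + 1)) \<in> E \<and> c (j - 1) \<notin> nbh (c (j + 1))"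
begin

lemma in_block: "x \<in> V \<Longrightarrow> s x + k * M \<le> i \<Longrightarrow> i \<le> e x + k * M \<Longrightarrow> i \<in> J \<and> x \<in> nbh (c i)"
  using block by blast

text \<open>Otherwise an earlier translate of the block would extend up to the start of this one and
  have length at least \<open>M - 1\<close>, which \<open>short\<close>, applied to \<open>x\<close>
  twice, forbids.\<close>

lemma before_block:
  assumes x: "x \<in> V" and j: "s x + k * M - 1 \<in> J"
  shows "x \<notin> nbh (c (s x + k * M - 1))"
proof
  assume "x \<in> nbh (c (s x + k * M - 1))"
  then obtain t where t: "s x + t * M \<le> s x + k * M - 1" "s x + k * M - 1 \<le> e x + t * M"
    using block[OF x] j by blast
  have "\<not> k \<le> t"
  proof
    assume "k \<le> t"
    then have "k * M \<le> t * M" using M1 by (intro mult_right_mono) auto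
    then show False using t by linarith
  qed
  then have "(t + 1) * M \<le> k * M" using M1 by (intro mult_right_mono) auto
  then have "M - 1 \<le> e x - s x" using t by (simp add: algebra_simps)
  then show False using short[OF x x] M1 by linarith
qed

lemma s_eq:
  assumes "x \<in> V" "z \<in> V" "s x = s z + k * M"
  shows "k = 0"
proof (rule ccontr)
  assume "k \<noteq> 0"
  then have "k * M \<ge> 1 * M \<or> k * M \<le> (-1) * M"
    using M1 mult_right_mono[of 1 k M] mult_right_mono[of k "-1" M] by linarith
  then show False using assms(3) s_range[OF assms(1)] s_range[OF assms(2)] by linarith
qed

text \<open>The start of \<open>x\<close> encodes its first spine index together with its left end
  in the model around that spine vertex; the arc ends at the furthest start of a neighbour. The
  heart is \<open>claim\<close>: if \<open>z\<close> starts within the arc of \<open>x\<close>, then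
  in the model around the first spine vertex of \<open>z\<close> the interval of \<open>x\<close>
  contains the left end of \<open>z\<close>.\<close>

lemma model_exists:
  "\<exists>a b W. 0 < W \<and> circular_model V E (M * W) a b \<and>
     (\<forall>x\<in>V. s x * W \<le> a x \<and> b x < (e x + 1) * W)"
proof -
  have "\<forall>j\<in>J. \<exists>l u. local_order (c (j - 1)) (c j) (c (j + 1)) l u"
    using spine local_order_exists by blast
  then obtain l u where order: "\<And>j. j \<in> J \<Longrightarrow> local_order (c (j - 1)) (c j) (c (j + 1)) (l j) (u j)"
    by metis
  note key = order[unfolded local_order_def]
  have key_le: "l j x \<le> u j x" if "j \<in> J" "x \<in> nbh (c j)" for j x
    using key[OF that(1)] that(2) by blast
  have key_adj: "z \<in> nbh x"
    if "j \<in> J" "x \<in> nbh (c j)" "z \<in> nbh (c j)" "l j x \<le> l j z" "l j z \<le> u j x" for j x z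
    using key[OF that(1)] that(2-) by blast
  have key_here: "l j y \<le> u j x"
    if "j \<in> J" "x \<in> nbh (c j)" "y \<in> nbh (c j)" "(x, y) \<in> E" for j x y
    using key[OF that(1)] that(2-) by blast
  have key_next: "l j z \<le> u j x" if "j \<in> J" "x \<in> nbh (c j)" "z \<in> nbh (c j)" "(x, y) \<in> E"
    "y \<in> nbh (c (j + 1))" "y \<notin> nbh (c j)" for j x y z
    using key[OF that(1)] that(2-) by blast
  \<comment> \<open>Here \<open>c (j - 2)\<close> plays the part of \<open>a'\<close> in
    \<open>local_order\<close>.\<close>
  have key_prev: "l j x \<le> l j z" if h: "j \<in> J" "j - 1 \<in> J" "x \<in> nbh (c j)" "x \<in> nbh (c (j - 1))"
    "z \<in> nbh (c j)" "z \<notin> nbh (c (j - 1))" for j x z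
  proof -
    have "(c (j - 2), c (j - 1)) \<in> E" "c (j - 2) \<notin> nbh (c j)" using spine[OF h(2)] by auto
    then show ?thesis using key[OF h(1)] h(3-) by blast
  qed
  have path2: "c (j + 2) \<in> nbh (c (j + 1)) - nbh (c j)" if "j + 1 \<in> J" for j
    using spine[OF that] nbh_sym[of "c j" "c (j + 2)"] by (auto simp: mem_nbh add.commute)
  obtain B0 where B0: "\<And>x. x \<in> V \<Longrightarrow> \<bar>l (s x) x\<bar> \<le> B0"
    using finite_int_bound[OF finite_V, of "\<lambda>x. l (s x) x"] by blast
  \<comment> \<open>The offsets \<open>l (s x) x + B\<close> then lie strictly between 0 and
    \<open>W = 2 * B\<close>.\<close>
  define B where "B = \<bar>B0\<bar> + 1"
  have B: "\<bar>l (s x) x\<bar> < B" if "x \<in> V" for x using B0[OF that] by (simp add: B_def)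
  define W where "W = 2 * B"
  have W0: "0 < W" by (simp add: W_def B_def)
  define f where "f x = l (s x) x + B" for x
  have f: "0 \<le> f x" "f x < W" if "x \<in> V" for x using B[OF that] by (auto simp: f_def W_def)
  define N where "N = M * W"
  define a where "a x = s x * W + f x" for x
  have a_shift: "a x + k * N = (s x + k * M) * W + f x" for x k
    by (simp add: a_def N_def algebra_simps)
  \<comment> \<open>Starts of neighbours at or after \<open>a x\<close>. The bound by
    \<open>e x\<close> selects the translate of \<open>y\<close> whose block meets that of
    \<open>x\<close>, and it confines the arc to the block of \<open>x\<close>.\<close>
  define cand where "cand x = {t. t = a x \<or> (\<exists>y k. (x, y) \<in> E \<and> t = a y + k * N \<and> a x \<le> t \<and> s y + k * M \<le> e x)}" for x
  have cand_bd: "a x \<le> t \<and> t < (e x + 1) * W" if x: "x \<in> V" and t: "t \<in> cand x" for x t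
  proof -
    consider "t = a x" | y k where "(x, y) \<in> E" "t = a y + k * N" "a x \<le> t" "s y + k * M \<le> e x"
      using t unfolding cand_def by blast
    then show ?thesis
    proof cases
      case 1
      have "(s x + 1) * W \<le> (e x + 1) * W" using s_le_e[OF x] W0 by (intro mult_right_mono) auto
      moreover have "a x < (s x + 1) * W" using f[OF x] by (simp add: a_def algebra_simps)
      ultimately show ?thesis using 1 by linarith
    next
      case (2 y k)
      have y: "y \<in> V" using 2 E_in_V by blast
      have "(s y + k * M + 1) * W \<le> (e x + 1) * W" using 2 W0 by (intro mult_right_mono) auto
      moreover have "a y + k * N < (s y + k * M + 1) * W"
        using f[OF y] a_shift[of y k] by (simp add: algebra_simps)
      ultimately show ?thesis using 2 by linarith
    qed
  qed
  define b where "b x = Max (cand x)" for x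
  have cand_fin: "finite (cand x)" if "x \<in> V" for x
    by (rule finite_subset[of _ "{a x..(e x + 1) * W}"]) (use cand_bd[OF that] in \<open>force intro: less_imp_le\<close>, simp)
  have cand_a: "a x \<in> cand x" for x by (simp add: cand_def)
  have b_in: "b x \<in> cand x" if "x \<in> V" for x
    unfolding b_def using cand_fin[OF that] cand_a by (intro Max_in) auto
  have b_ge: "t \<le> b x" if "x \<in> V" "t \<in> cand x" for x t
    unfolding b_def using cand_fin[OF that(1)] that(2) by (rule Max_ge)
  have claim: "z \<in> nbh x" if x: "x \<in> V" and z: "z \<in> V" and lo: "a x \<le> a z + k' * N" and hi: "a z + k' * N \<le> b x" for x z k'
  proof -
    define p where "p = s z + k' * M"
    define j where "j = s z"
    have az: "a z + k' * N = p * W + f z" using a_shift by (simp add: p_def)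
    have lex1: "s x < p \<or> (s x = p \<and> f x \<le> f z)"
      using lex_le[of "f x" "f z" W "s x" p] f[OF x] f[OF z] lo az by (simp add: a_def)
    have same: "k' = 0" "s x = s z" if "s x = p"
      using s_eq[OF x z, of k'] that by (auto simp: p_def)
    have zj: "j \<in> J" "z \<in> nbh (c j)" using in_block[OF z, of 0 j] s_le_e[OF z] by (auto simp: j_def)
    have cp: "c (p + i) = c (j + i)" for i
      using c_per[of "j + i" k'] by (simp add: p_def j_def algebra_simps)
    have Jp: "p + i \<in> J \<longleftrightarrow> j + i \<in> J" for i
      using J_per[of "j + i" k'] by (simp add: p_def j_def algebra_simps)
    consider "b x = a x" | y k where "(x, y) \<in> E" "b x = a y + k * N" "s y + k * M \<le> e x"
      using b_in[OF x] unfolding cand_def by blast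
    then show ?thesis
    proof cases
      \<comment> \<open>No neighbour starts later, so \<open>z\<close> starts exactly where
        \<open>x\<close> does, and equal left ends in one model give adjacency.\<close>
      case 1
      then have eq: "p * W + f z = s x * W + f x" using lo hi az by (simp add: a_def)
      have "p < s x \<or> (p = s x \<and> f z \<le> f x)"
        using lex_le[of "f z" "f x" W p "s x"] f[OF x] f[OF z] eq by simp
      then have "p = s x" "f z = f x" using lex1 by auto
      then have "s x = j" "l j z = l j x" using same by (auto simp: j_def f_def)
      moreover have "x \<in> nbh (c j)" using in_block[OF x, of 0 j] s_le_e[OF x] \<open>s x = j\<close> by auto
      ultimately show ?thesis using key_adj[OF zj(1) _ zj(2)] key_le[OF zj(1)] by simp
    next
      case (2 y k)
      have y: "y \<in> V" using 2 E_in_V by blast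
      define q where "q = s y + k * M"
      have lex2: "p < q \<or> (p = q \<and> f z \<le> f y)"
        using lex_le[of "f z" "f y" W p q] f[OF y] f[OF z] hi az 2(2) a_shift[of y k] by (simp add: q_def)
      have p1: "s x \<le> p" and p2: "p \<le> e x" using lex1 lex2 2(3) by (auto simp: q_def)
      have inx: "p + i \<in> J" "x \<in> nbh (c (p + i))" if "s x \<le> p + i" "p + i \<le> e x" for i
        using in_block[OF x, of 0 "p + i"] that by auto
      have xj: "x \<in> nbh (c j)" using inx(2)[of 0] p1 p2 cp[of 0] by simp
      \<comment> \<open>If \<open>x\<close> starts at an earlier index, then
        \<open>c (j - 1)\<close> sees \<open>x\<close> but not \<open>z\<close>, whose block starts
        at \<open>j\<close>; this is the situation of \<open>key_prev\<close>.\<close>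
      have L: "l j x \<le> l j z"
      proof (cases "s x = p")
        case True
        then show ?thesis using lex1 same by (auto simp: j_def f_def)
      next
        case False
        then have h: "p + - 1 \<in> J" "x \<in> nbh (c (p + - 1))" using inx[of "-1"] p1 p2 by auto
        then have "j - 1 \<in> J" "x \<in> nbh (c (j - 1))" using cp[of "-1"] Jp[of "-1"] by auto
        moreover have "z \<notin> nbh (c (j - 1))"
          using before_block[OF z, of 0] \<open>j - 1 \<in> J\<close> by (simp add: j_def)
        ultimately show ?thesis using key_prev[OF zj(1) _ xj _ zj(2)] by blast
      qed
      \<comment> \<open>The neighbour \<open>y\<close> that ends the arc starts at an index
        \<open>q >= p\<close>. For \<open>q = p\<close> it is compared with \<open>z\<close> in the
        same model; for \<open>q = p + 1\<close> it is seen from \<open>c (j + 1)\<close> but not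
        from \<open>c j\<close>, as \<open>key_next\<close> asks.\<close>
      have U: "l j z \<le> u j x"
      proof (cases "p = q")
        case True
        then have "s y = s z + (k' - k) * M" by (simp add: p_def q_def algebra_simps)
        then have "k' = k" "s y = s z" using s_eq[OF y z, of "k' - k"] by auto
        then have "y \<in> nbh (c j)" using in_block[OF y, of 0 j] s_le_e[OF y] by (auto simp: j_def)
        then have "l j y \<le> u j x" using key_here[OF zj(1) xj _ 2(1)] by blast
        moreover have "f z \<le> f y" using lex2 True by simp
        ultimately show ?thesis using \<open>s y = s z\<close> by (simp add: f_def j_def)
      next
        case False
        then have pq: "p < q" using lex2 by simp
        show ?thesis
        proof (cases "q = p + 1")
          case True
          have "y \<in> nbh (c q)" using in_block[OF y, of k q] s_le_e[OF y] by (simp add: q_def)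
          then have "y \<in> nbh (c (j + 1))" using True cp[of 1] by simp
          moreover have "y \<notin> nbh (c (q - 1))"
          proof -
            have "q - 1 \<in> J" using True inx(1)[of 0] p1 p2 by simp
            then show ?thesis using before_block[OF y, of k] by (simp add: q_def)
          qed
          then have "y \<notin> nbh (c j)" using True cp[of 0] by simp
          ultimately show ?thesis using key_next[OF zj(1) xj zj(2) 2(1)] by blast
        next
          case False
          \<comment> \<open>Now \<open>x\<close> itself reaches index \<open>p + 2\<close>, and the
            spine vertex there takes over the part of \<open>y\<close>.\<close>
          then have "p + 2 \<le> e x" using pq 2(3) by (simp add: q_def)
          then have h: "p + 0 \<in> J" "p + 1 \<in> J" "p + 2 \<in> J" "x \<in> nbh (c (p + 2))"
            using inx(1)[of 0] inx(1)[of 1] inx[of 2] p1 by auto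
          have w: "c (p + 2) \<in> nbh (c (p + 1))" "c (p + 2) \<notin> nbh (c p)"
            using path2[of p] h by auto
          have "x \<noteq> c (p + 2)" using w xj cp[of 0] by auto
          then have "(x, c (p + 2)) \<in> E" using h(4) sym_E by (auto simp: mem_nbh)
          then show ?thesis using key_next[OF zj(1) xj zj(2)] w cp[of 0] cp[of 1] by simp
        qed
      qed
      show ?thesis using key_adj[OF zj(1) xj zj(2) L U] .
    qed
  qed
  have bN: "b x < a x + N" if x: "x \<in> V" for x
  proof -
    have "(e x + 1) * W \<le> (s x + M) * W" using short[OF x x] s_le_e[OF x] W0 by (intro mult_right_mono) auto
    then show ?thesis using cand_bd[OF x b_in[OF x]] f[OF x] by (simp add: a_def N_def algebra_simps)
  qed
  \<comment> \<open>Whichever of the two starts first has the start of the other among its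
    candidates.\<close>
  have fwd: "a x \<le> b y + k * N \<and> a y + k * N \<le> b x"
    if xy: "(x, y) \<in> E" and k: "s x \<le> e y + k * M" "s y + k * M \<le> e x" for x y k
  proof (cases "a x \<le> a y + k * N")
    case True
    have xV: "x \<in> V" and yV: "y \<in> V" using xy E_in_V by auto
    have "a y + k * N \<in> cand x" unfolding cand_def using xy True k by blast
    then show ?thesis using b_ge[OF xV] b_ge[OF yV cand_a] True by fastforce
  next
    case False
    have xV: "x \<in> V" and yV: "y \<in> V" using xy E_in_V by auto
    have "a x + (- k) * N \<in> cand y"
      unfolding cand_def using sym_E[OF xy] False k by (auto intro!: exI[of _ x] exI[of _ "-k"])
    then have "a x + (- k) * N \<le> b y" using b_ge[OF yV] by blast
    then show ?thesis using b_ge[OF xV cand_a] False by auto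
  qed
  have "circular_model V E N a b"
    unfolding circular_model_def
  proof (intro conjI ballI impI)
    show "a x \<le> b x" if "x \<in> V" for x using b_ge[OF that cand_a] .
    show "b x < a x + N" if "x \<in> V" for x using bN[OF that] .
    fix x y assume xy: "x \<in> V" "y \<in> V" "x \<noteq> y"
    show "(x, y) \<in> E \<longleftrightarrow> (\<exists>k. a x \<le> b y + k * N \<and> a y + k * N \<le> b x)"
    proof
      assume "(x, y) \<in> E" then show "\<exists>k. a x \<le> b y + k * N \<and> a y + k * N \<le> b x"
        using fwd meet by meson
    next
      assume "\<exists>k. a x \<le> b y + k * N \<and> a y + k * N \<le> b x"
      then obtain k where k: "a x \<le> b y + k * N" "a y + k * N \<le> b x" by blast
      have "y \<in> nbh x \<or> x \<in> nbh y"
      proof (cases "a x \<le> a y + k * N")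
        case True then show ?thesis using claim[OF xy(1,2)] k by blast
      next
        case False then show ?thesis using claim[OF xy(2,1), of "-k"] k by auto
      qed
      then show "(x, y) \<in> E" using xy(3) sym_E by (auto simp: mem_nbh)
    qed
  qed
  moreover have "s x * W \<le> a x \<and> b x < (e x + 1) * W" if "x \<in> V" for x
    using cand_bd[OF that b_in[OF that]] f[OF that] by (simp add: a_def)
  ultimately show ?thesis using W0 unfolding N_def by blast
qed

end

section \<open>Induced paths and the induced cycles they close\<close>

context simple_graph
begin

text \<open>\<open>n\<close> counts edges: the vertices are \<open>f 0\<close> to
  \<open>f n\<close>.\<close>

definition induced_path :: "nat \<Rightarrow> (nat \<Rightarrow> 'a) \<Rightarrow> bool" where
  "induced_path n f \<longleftrightarrow> (\<forall>i\<le>n. f i \<in> V) \<and>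
     (\<forall>i j. i < j \<longrightarrow> j \<le> n \<longrightarrow> f i \<noteq> f j \<and> ((f i, f j) \<in> E \<longleftrightarrow> j = Suc i))"

lemma induced_pathD:
  assumes "induced_path n f"
  shows "\<And>i. i \<le> n \<Longrightarrow> f i \<in> V"
    and "\<And>i j. i < j \<Longrightarrow> j \<le> n \<Longrightarrow> f i \<noteq> f j"
    and "\<And>i j. i < j \<Longrightarrow> j \<le> n \<Longrightarrow> (f i, f j) \<in> E \<longleftrightarrow> j = Suc i"
  using assms unfolding induced_path_def by blast+

lemma induced_path_rev:
  assumes "induced_path n f"
  shows "induced_path n (\<lambda>k. f (n - k))"
  unfolding induced_path_def
proof (intro conjI allI impI)
  note D = induced_pathD[OF assms]
  show "f (n - i) \<in> V" for i using D(1)[of "n - i"] by simp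
  fix i j assume ij: "i < j" "j \<le> n"
  show "f (n - i) \<noteq> f (n - j)" using D(2)[of "n - j" "n - i"] ij by fastforce
  show "((f (n - i), f (n - j)) \<in> E) = (j = Suc i)"
    using D(3)[of "n - j" "n - i"] ij E_commute[of "f (n - i)" "f (n - j)"] by auto
qed

lemma induced_path_segment:
  assumes "induced_path n f" "i + g \<le> n"
  shows "induced_path g (\<lambda>k. f (i + k))"
  unfolding induced_path_def
proof (intro conjI allI impI)
  note D = induced_pathD[OF assms(1)]
  show "f (i + k) \<in> V" if "k \<le> g" for k using D(1)[of "i + k"] that assms(2) by simp
  fix k j assume kj: "k < j" "j \<le> g"
  show "f (i + k) \<noteq> f (i + j)" using D(2)[of "i + k" "i + j"] kj assms(2) by simp
  show "((f (i + k), f (i + j)) \<in> E) = (j = Suc k)"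
    using D(3)[of "i + k" "i + j"] kj assms(2) by auto
qed

lemma induced_path_extend:
  assumes p: "induced_path g h" and y: "(h g, y) \<in> E" and o: "\<And>i. i < g \<Longrightarrow> y \<notin> nbh (h i)"
  shows "induced_path (Suc g) (\<lambda>k. if k \<le> g then h k else y)"
  unfolding induced_path_def
proof (intro conjI allI impI)
  note D = induced_pathD[OF p]
  show "(if k \<le> g then h k else y) \<in> V" for k using D(1)[of k] E_in_V[OF y] by simp
  have ne: "h g \<noteq> y" using y irrefl_E by auto
  fix i j assume ij: "i < j" "j \<le> Suc g"
  show "(if i \<le> g then h i else y) \<noteq> (if j \<le> g then h j else y)"
    using D(2)[of i j] ij o[of i] ne by (cases "i = g") (auto simp: mem_nbh)
  show "((if i \<le> g then h i else y, if j \<le> g then h j else y) \<in> E) = (j = Suc i)"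
    using D(3)[of i j] ij o[of i] y by (cases "i = g") (auto simp: mem_nbh)
qed

text \<open>The \<open>g + 1\<close> vertices of the path move up by one and \<open>x\<close> takes
  index 0, because \<open>induced_cycle\<close> treats the edge between index 0 and the last index
  as the closing one.\<close>

lemma induced_cycle_close:
  assumes p: "induced_path g h" and g: "2 \<le> g" and x: "(x, h 0) \<in> E" "(x, h g) \<in> E"
    and o: "\<And>i. 0 < i \<Longrightarrow> i < g \<Longrightarrow> h i \<notin> nbh x"
  shows "induced_cycle (g + 2) (\<lambda>k. if k = 0 then x else h (k - 1))"
  unfolding induced_cycle_def
proof (intro conjI allI impI)
  note D = induced_pathD[OF p]
  show "4 \<le> g + 2" using g by simp
  show "(if k = 0 then x else h (k - 1)) \<in> V" if "k < g + 2" for k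
    using D(1)[of "k - 1"] E_in_V[OF x(1)] that by auto
  fix i j assume ij: "i < j" "j < g + 2"
  have "h 0 \<noteq> x" "h g \<noteq> x" using x irrefl_E by auto
  then have nx: "h (j - 1) \<noteq> x"
    using o[of "j - 1"] ij by (cases "j = 1"; cases "j = Suc g") (auto simp: mem_nbh)
  show "(if i = 0 then x else h (i - 1)) \<noteq> (if j = 0 then x else h (j - 1))"
    using D(2)[of "i - 1" "j - 1"] ij nx by auto
  show "((if i = 0 then x else h (i - 1), if j = 0 then x else h (j - 1)) \<in> E) =
      (j = Suc i \<or> i = 0 \<and> Suc j = g + 2)"
  proof (cases "i = 0")
    case True
    then show ?thesis using o[of "j - 1"] x ij nx
      by (cases "j = 1"; cases "j = Suc g") (auto simp: mem_nbh)
  next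
    case False
    then show ?thesis using D(3)[of "i - 1" "j - 1"] ij by auto
  qed
qed

lemma induced_cycle_close_edge:
  assumes p: "induced_path g h" and g: "1 \<le> g" and e: "(x, h 0) \<in> E" "(h g, y) \<in> E" "(x, y) \<in> E"
    and ox: "\<And>i. 0 < i \<Longrightarrow> i \<le> g \<Longrightarrow> x \<notin> nbh (h i)" and oy: "\<And>i. i < g \<Longrightarrow> y \<notin> nbh (h i)"
  shows "\<exists>F. induced_cycle (g + 3) F"
proof -
  have "induced_path (Suc g) (\<lambda>k. if k \<le> g then h k else y)"
    by (rule induced_path_extend[OF p e(2) oy])
  then have "induced_cycle (Suc g + 2) (\<lambda>k. if k = 0 then x else (if k - 1 \<le> g then h (k - 1) else y))"
    by (rule induced_cycle_close) (use g e ox nbh_sym[of x] in auto)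
  then show ?thesis by (auto simp: numeral_3_eq_3)
qed

lemma square_chord:
  assumes nc: "\<And>f. \<not> induced_cycle 4 f"
    and "(p, q) \<in> E" "(q, s) \<in> E" "(s, t) \<in> E" "(t, p) \<in> E" "p \<noteq> s" "q \<noteq> t"
  shows "(p, s) \<in> E \<or> (q, t) \<in> E"
proof (rule ccontr)
  assume "\<not> ?thesis"
  then have "induced_cycle 4 (\<lambda>i. if i = 0 then p else if i = 1 then q else if i = 2 then s else t)"
    using assms(2-) E_in_V[of p q] E_in_V[of s t] irrefl_E E_commute[of t p] unfolding induced_cycle_def
    by (auto simp: less_Suc_eq numeral_eq_Suc)
  then show False using nc by blast
qed

end

section \<open>Minimal connected dominating sets\<close>

context locally_interval_graph
begin

definition (in simple_graph) connected_dominating :: "'a set \<Rightarrow> bool" where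
  "connected_dominating D \<longleftrightarrow> D \<subseteq> V \<and> (\<forall>x\<in>V. \<exists>d\<in>D. x \<in> nbh d) \<and>
     (\<forall>S\<subseteq>D. S \<noteq> {} \<longrightarrow> S \<noteq> D \<longrightarrow> (\<exists>x\<in>S. \<exists>y\<in>D - S. (x, y) \<in> E))"

lemma (in simple_graph) connected_dominatingD:
  assumes "connected_dominating D"
  shows "D \<subseteq> V" and "\<And>x. x \<in> V \<Longrightarrow> \<exists>d\<in>D. x \<in> nbh d"
    and "\<And>S. S \<subseteq> D \<Longrightarrow> S \<noteq> {} \<Longrightarrow> S \<noteq> D \<Longrightarrow> \<exists>x\<in>S. \<exists>y\<in>D - S. (x, y) \<in> E"
  using assms unfolding connected_dominating_def by simp_all

text \<open>Whatever \<open>d\<close> dominates or connects, \<open>y\<close> or \<open>z\<close>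
  takes over, and the adjacency of \<open>y\<close> and \<open>z\<close> keeps the detour connected.
  With \<open>y = z\<close> this covers the case of one neighbourhood containing another.\<close>

lemma connected_dominating_remove:
  assumes D: "connected_dominating D" and d: "d \<in> D" and yz: "y \<in> D" "z \<in> D" "y \<noteq> d" "z \<noteq> d"
    and adj: "y = z \<or> (y, z) \<in> E" and sub: "nbh d \<subseteq> nbh y \<union> nbh z"
  shows "connected_dominating (D - {d})"
  unfolding connected_dominating_def
proof (intro conjI ballI allI impI)
  show "D - {d} \<subseteq> V" using D by (auto simp: connected_dominating_def)
  show "\<exists>d'\<in>D - {d}. x \<in> nbh d'" if xV: "x \<in> V" for x
  proof -
    obtain d' where d': "d' \<in> D" "x \<in> nbh d'" using connected_dominatingD(2)[OF D xV] by blast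
    show ?thesis
    proof (cases "d' = d")
      case True then show ?thesis using d' sub yz by blast
    next
      case False then show ?thesis using d' by blast
    qed
  qed
  fix S assume S: "S \<subseteq> D - {d}" "S \<noteq> {}" "S \<noteq> D - {d}"
  have cut: "\<exists>x\<in>T. \<exists>t\<in>D - T. (x, t) \<in> E" if "T \<subseteq> D" "T \<noteq> {}" "T \<noteq> D" for T
    using connected_dominatingD(3)[OF D that] .
  have via: "(x, y) \<in> E \<or> (x, z) \<in> E" if "(x, d) \<in> E" "x \<noteq> y" "x \<noteq> z" for x
  proof -
    have "x \<in> nbh d" using that(1) sym_E by (simp add: mem_nbh)
    then have "x \<in> nbh y \<or> x \<in> nbh z" using sub by blast
    then show ?thesis using that(2,3) sym_E unfolding mem_nbh by blast
  qed
  \<comment> \<open>If both lie in \<open>S\<close>, the cut of \<open>D\<close> is taken with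
    \<open>d\<close> added to \<open>S\<close>; if neither does, with \<open>d\<close> outside. An
    edge of the cut that ends in \<open>d\<close> is rerouted to \<open>y\<close> or
    \<open>z\<close>. If they are separated, the edge \<open>yz\<close> crosses.\<close>
  consider "y \<in> S" "z \<in> S" | "y \<notin> S" "z \<notin> S" | "y \<in> S" "z \<notin> S" | "y \<notin> S" "z \<in> S" by blast
  then show "\<exists>x\<in>S. \<exists>t\<in>D - {d} - S. (x, t) \<in> E"
  proof cases
    case 1
    have "insert d S \<subseteq> D" "insert d S \<noteq> {}" "insert d S \<noteq> D" using S d by auto
    from cut[OF this] obtain x t where xt: "x \<in> insert d S" "t \<in> D - insert d S" "(x, t) \<in> E" by blast
    show ?thesis
    proof (cases "x = d")
      case True
      have "t \<noteq> y" "t \<noteq> z" using 1 xt by auto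
      then have "(t, y) \<in> E \<or> (t, z) \<in> E" using via[of t] xt True sym_E by blast
      then show ?thesis using 1 xt sym_E by blast
    next
      case False then show ?thesis using xt by blast
    qed
  next
    case 2
    have "S \<subseteq> D" "S \<noteq> {}" "S \<noteq> D" using S d by auto
    from cut[OF this] obtain x t where xt: "x \<in> S" "t \<in> D - S" "(x, t) \<in> E" by blast
    show ?thesis
    proof (cases "t = d")
      case True
      have "x \<noteq> y" "x \<noteq> z" using 2 xt by auto
      then have "(x, y) \<in> E \<or> (x, z) \<in> E" using via[of x] xt True by blast
      then show ?thesis using 2 xt yz by blast
    next
      case False then show ?thesis using xt by blast
    qed
  next
    case 3 then show ?thesis using adj yz by blast
  next
    case 4 then show ?thesis using adj yz sym_E by blast
  qed
qed

lemma minimal_connected_dominating: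
  obtains D where "connected_dominating D"
    "\<And>d. d \<in> D \<Longrightarrow> \<not> connected_dominating (D - {d})"
proof -
  have "connected_dominating V"
    using cut_edge unfolding connected_dominating_def by (auto simp: mem_nbh)
  then obtain D where D: "connected_dominating D" and m: "\<And>D'. connected_dominating D' \<Longrightarrow> card D \<le> card D'"
    using ex_has_least_nat[of connected_dominating V card] by blast
  have fin: "finite D" using connected_dominatingD(1)[OF D] finite_V finite_subset by blast
  show thesis
  proof (rule that[OF D])
    fix d assume "d \<in> D"
    then have "card (D - {d}) < card D" using fin by (meson card_Diff1_less)
    then show "\<not> connected_dominating (D - {d})" using m by fastforce
  qed
qed

end

locale locally_interval_chordal = locally_interval_graph +
  assumes chordal: "\<not> induced_cycle m f"
begin

text \<open>Minimality supplies private neighbours. They turn a triangle in \<open>D\<close> into a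
  net and a vertex with three neighbours in \<open>D\<close> into a claw, so \<open>D\<close>
  induces a connected graph of maximum degree 2 without cycles. Incomparability of the
  neighbourhoods is recorded because it later supplies spine neighbours for the two ends.\<close>

lemma dominating_path:
  "\<exists>n f. induced_path n f \<and> (\<forall>x\<in>V. \<exists>i\<le>n. x \<in> nbh (f i)) \<and>
     (\<forall>i j. i \<le> n \<longrightarrow> j \<le> n \<longrightarrow> i \<noteq> j \<longrightarrow> \<not> nbh (f i) \<subseteq> nbh (f j))"
proof -
  obtain D where D: "connected_dominating D" and m: "\<And>d. d \<in> D \<Longrightarrow> \<not> connected_dominating (D - {d})"
    using minimal_connected_dominating by blast
  have DV: "D \<subseteq> V" using D by (simp add: connected_dominating_def)
  then have finD: "finite D" using finite_V finite_subset by blast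
  have priv: "\<exists>w. (d, w) \<in> E \<and> w \<notin> nbh y \<and> w \<notin> nbh z"
    if h: "d \<in> D" "y \<in> D" "z \<in> D" "y \<noteq> d" "z \<noteq> d" "y = z \<or> (y, z) \<in> E" "(y, d) \<in> E" for d y z
  proof -
    obtain w where w: "w \<in> nbh d" "w \<notin> nbh y" "w \<notin> nbh z"
      using connected_dominating_remove[OF D h(1-6)] m[OF h(1)] by blast
    have "w \<noteq> d" using w(2) h(7) by (auto simp: mem_nbh)
    then show ?thesis using w by (auto simp: mem_nbh)
  qed
  have incomp: "\<not> nbh d \<subseteq> nbh y" if "d \<in> D" "y \<in> D" "y \<noteq> d" for d y
    using connected_dominating_remove[OF D that(1) that(2) that(2) that(3) that(3)] m[OF that(1)] by blast
  have no_triangle: False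
    if D3: "x \<in> D" "y \<in> D" "z \<in> D" and e: "(x, y) \<in> E" "(y, z) \<in> E" "(x, z) \<in> E" for x y z
  proof -
    have e': "(y, x) \<in> E" "(z, y) \<in> E" "(z, x) \<in> E" using e sym_E by auto
    have ne: "x \<noteq> y" "y \<noteq> z" "x \<noteq> z" using e irrefl_E by auto
    obtain x' where x': "(x, x') \<in> E" "x' \<notin> nbh y" "x' \<notin> nbh z"
      using priv[of x y z] D3 e e' ne by auto
    obtain y' where y': "(y, y') \<in> E" "y' \<notin> nbh x" "y' \<notin> nbh z"
      using priv[of y x z] D3 e e' ne by auto
    obtain z' where z': "(z, z') \<in> E" "z' \<notin> nbh x" "z' \<notin> nbh y"
      using priv[of z x y] D3 e e' ne by auto
    \<comment> \<open>Adjacent private neighbours would form a 4-cycle with their owners, and a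
      chord of it contradicts privacy.\<close>
    have sq: "(p', q') \<notin> E"
      if "(p, p') \<in> E" "(q, q') \<in> E" "(p, q) \<in> E" "p' \<notin> nbh q" "q' \<notin> nbh p" for p q p' q'
    proof
      assume "(p', q') \<in> E"
      then have "(p, q') \<in> E \<or> (p', q) \<in> E"
        using square_chord[of p p' q' q] chordal that sym_E by (auto simp: mem_nbh)
      then show False using that sym_E by (auto simp: mem_nbh)
    qed
    have nn: "(x', y) \<notin> E" "(x', z) \<notin> E" "(y', x) \<notin> E" "(y', z) \<notin> E" "(z', x) \<notin> E" "(z', y) \<notin> E"
      "x' \<noteq> y" "x' \<noteq> z" "y' \<noteq> x" "y' \<noteq> z" "z' \<noteq> x" "z' \<noteq> y"
      using x' y' z' sym_E by (auto simp: mem_nbh)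
    have nx: "x' \<noteq> y'" "x' \<noteq> z'" "y' \<noteq> z'" using x' y' z' by (auto simp: mem_nbh)
    show False
      by (rule net[of x x' y z y' z'])
        (use x'(1) y'(1) z'(1) e nn nx sq[OF x'(1) y'(1) e(1)] sq[OF x'(1) z'(1) e(3)] sq[OF y'(1) z'(1) e(2)]
           x' y' z' in auto)
  qed
  have deg2: False
    if D3: "c \<in> D" "p \<in> D" "q \<in> D" "s \<in> D" and e: "(c, p) \<in> E" "(c, q) \<in> E" "(c, s) \<in> E"
      and ne: "p \<noteq> q" "q \<noteq> s" "p \<noteq> s" for c p q s
  proof -
    have pr: "\<exists>w. (d, w) \<in> E \<and> w \<notin> nbh c" if "d \<in> D" "(c, d) \<in> E" for d
      using priv[of d c c] that D3(1) irrefl_E by auto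
    have "(p, q) \<notin> E" "(q, s) \<notin> E" "(p, s) \<notin> E" using no_triangle D3 e by blast+
    then show False using claw[of c p q s] e ne pr[OF D3(2) e(1)] pr[OF D3(3) e(2)] pr[OF D3(4) e(3)] by blast
  qed
  \<comment> \<open>A longest induced path within \<open>D\<close> turns out to be all of
    \<open>D\<close>: a further vertex attached to an inner vertex violates \<open>deg2\<close>, one
    attached to an end lengthens the path.\<close>
  define P where "P n \<longleftrightarrow> (\<exists>f. induced_path n f \<and> f ` {..n} \<subseteq> D)" for n
  have "D \<noteq> {}" using connected_dominatingD(2)[OF D] V_nonempty by blast
  then obtain d0 where d0: "d0 \<in> D" by blast
  have "P 0" unfolding P_def induced_path_def using d0 DV by (auto intro!: exI[of _ "\<lambda>_. d0"])
  moreover have "n \<le> card D" if "P n" for n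
  proof -
    obtain f where f: "induced_path n f" "f ` {..n} \<subseteq> D" using \<open>P n\<close> P_def by blast
    have "inj_on f {..n}"
      using induced_pathD(2)[OF f(1)] by (intro linorder_inj_onI) auto
    then have "card {..n} \<le> card D" using card_inj_on_le[OF _ f(2) finD] by blast
    then show ?thesis by simp
  qed
  ultimately obtain n where n: "P n" "\<And>k. P k \<Longrightarrow> k \<le> n"
    using ex_has_greatest_nat[of P 0 id "Suc (card D)"] by (auto simp: less_Suc_eq_le)
  obtain f where f: "induced_path n f" and fD: "f ` {..n} \<subseteq> D" using n(1) P_def by blast
  have interior: False
    if g: "induced_path n g" "g ` {..n} \<subseteq> D" and i: "0 < i" "i < n"
      and t: "t \<in> D" "t \<notin> g ` {..n}" "(g i, t) \<in> E" for g i t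
  proof -
    note G = induced_pathD[OF g(1)]
    have "(g i, g (i - 1)) \<in> E" using G(3)[of "i - 1" i] i sym_E by auto
    moreover have "(g i, g (i + 1)) \<in> E" using G(3)[of i "i + 1"] i by auto
    moreover have "g (i - 1) \<noteq> g (i + 1)" using G(2)[of "i - 1" "i + 1"] i by auto
    moreover have "g i \<in> D" "g (i - 1) \<in> D" "g (i + 1) \<in> D" using g(2) i by auto
    moreover have "t \<noteq> g (i - 1)" "t \<noteq> g (i + 1)" using t(2) i by auto
    ultimately show False using deg2[of "g i" "g (i - 1)" "g (i + 1)" t] t(1,3) by auto
  qed
  have not_end: False
    if g: "induced_path n g" "g ` {..n} \<subseteq> D" and t: "t \<in> D" "t \<notin> g ` {..n}" "(g n, t) \<in> E" for g t
  proof -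
    note G = induced_pathD[OF g(1)]
    have gD: "g i \<in> D" if "i \<le> n" for i using g(2) that by auto
    have tn: "t \<noteq> g i" if "i \<le> n" for i using t(2) that by auto
    have inner: "(g i, t) \<notin> E" if "0 < i" "i < n" for i
      using interior[OF g that t(1,2)] by blast
    \<comment> \<open>An edge between \<open>t\<close> and the other end would close a triangle or
      an induced cycle.\<close>
    have first: "(g 0, t) \<notin> E" if "0 < n"
    proof
      assume e: "(g 0, t) \<in> E"
      show False
      proof (cases "n = 1")
        case True
        then show False using no_triangle[of "g 0" "g 1" t] G(3)[of 0 1] gD[of 0] gD[of 1] t e by auto
      next
        case False
        then have "2 \<le> n" using \<open>0 < n\<close> by simp
        then show False
          using induced_cycle_close[OF g(1), of t] e t(3) sym_E inner tn chordal
          by (auto simp: mem_nbh) (metis less_imp_le_nat sym_E)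
      qed
    qed
    have "induced_path (Suc n) (\<lambda>k. if k \<le> n then g k else t)"
    proof (rule induced_path_extend[OF g(1) t(3)])
      fix i assume "i < n"
      then show "t \<notin> nbh (g i)" using inner[of i] first tn[of i] by (cases "i = 0") (auto simp: mem_nbh)
    qed
    moreover have "(\<lambda>k. if k \<le> n then g k else t) ` {..Suc n} \<subseteq> D" using gD t by auto
    ultimately have "P (Suc n)" unfolding P_def by blast
    then show False using n(2) by fastforce
  qed
  have all: "f ` {..n} = D"
  proof (rule ccontr)
    assume ne: "f ` {..n} \<noteq> D"
    have "f ` {..n} \<noteq> {}" by auto
    then have "\<exists>x\<in>f ` {..n}. \<exists>t\<in>D - f ` {..n}. (x, t) \<in> E"
      using connected_dominatingD(3)[OF D fD] ne by blast
    then obtain i t where it: "i \<le> n" "t \<in> D" "t \<notin> f ` {..n}" "(f i, t) \<in> E" by blast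
    note F = induced_pathD[OF f]
    consider "i = n" | "i = 0" | "0 < i" "i < n" using it by linarith
    then show False
    proof cases
      case 1 then show False using not_end[OF f fD it(2,3)] it by blast
    next
      case 2
      have im: "(\<lambda>k. f (n - k)) ` {..n} \<subseteq> f ` {..n}" by auto
      then show False using not_end[OF induced_path_rev[OF f], of t] it 2 fD by auto
    next
      case 3 then show False using interior[OF f fD _ _ it(2,3,4)] by blast
    qed
  qed
  have "\<exists>i\<le>n. x \<in> nbh (f i)" if "x \<in> V" for x
    using connected_dominatingD(2)[OF D that] unfolding all[symmetric] by blast
  moreover have "\<not> nbh (f i) \<subseteq> nbh (f j)" if "i \<le> n" "j \<le> n" "i \<noteq> j" for i j
    using incomp[of "f i" "f j"] fD that induced_pathD(2)[OF f, of i j] induced_pathD(2)[OF f, of j i]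
    by (metis atMost_iff image_subset_iff nat_neq_iff)
  ultimately show ?thesis using f by blast
qed

end

lemma mult_int_cases:
  fixes k N :: int
  assumes "0 < N"
  obtains "k = 0" | "1 \<le> k" "N \<le> k * N" | "k \<le> -1" "k * N \<le> - N"
proof -
  consider "k = 0" | "1 \<le> k" | "k \<le> -1" by linarith
  then show thesis
    using that assms mult_right_mono[of 1 k N] mult_right_mono[of k "-1" N] by cases auto
qed

section \<open>The circular model of a chordal graph\<close>

context locally_interval_chordal
begin

text \<open>The case of a one-vertex spine, where incomparability yields no spine neighbours. One
  local model then represents the whole graph, and its line is closed to a circle.\<close>

lemma center_model:
  assumes d: "d \<in> V" and dom: "V \<subseteq> nbh d"
  shows "\<exists>N a b. 3 \<le> N \<and> circular_model V E N a b \<and>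
    (\<exists>q. \<forall>x\<in>V. \<forall>k. \<not> (a x + k * N \<le> q \<and> q < b x + k * N))"
proof -
  obtain l u where R: "local_rep d l u" using local_rep_exists[OF d] by blast
  obtain B1 B2 where B12: "\<And>x. x \<in> V \<Longrightarrow> \<bar>l x\<bar> \<le> B1" "\<And>x. x \<in> V \<Longrightarrow> \<bar>u x\<bar> \<le> B2"
    using finite_int_bound[OF finite_V, of l] finite_int_bound[OF finite_V, of u] by blast
  define B where "B = \<bar>B1\<bar> + \<bar>B2\<bar> + 1"
  have B: "- B < l x" "u x < B" "l x \<le> u x" if "x \<in> V" for x
    using B12[OF that] local_repD(1)[OF R _ nbh_self] dom that by (auto simp: B_def)
  \<comment> \<open>All endpoints lie strictly between \<open>- B\<close> and \<open>B\<close>, so a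
    nonzero translate of an arc meets no arc, and no translate covers the edge at
    \<open>B\<close>.\<close>
  define N where "N = 2 * B + 3"
  have N: "0 < N" "3 \<le> N" by (auto simp: N_def B_def)
  have "circular_model V E N l u"
    unfolding circular_model_def
  proof (intro conjI ballI impI)
    show "l x \<le> u x" "u x < l x + N" if "x \<in> V" for x using B[OF that] by (auto simp: N_def)
    fix x y assume xy: "x \<in> V" "y \<in> V" "x \<noteq> y"
    have *: "(x, y) \<in> E \<longleftrightarrow> l x \<le> u y \<and> l y \<le> u x"
      using local_repD(2)[OF R, of x y] local_repD(3)[OF R _ nbh_self _ nbh_self, of x y] dom xy by fastforce
    show "(x, y) \<in> E \<longleftrightarrow> (\<exists>k. l x \<le> u y + k * N \<and> l y + k * N \<le> u x)"
    proof
      assume "(x, y) \<in> E"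
      then show "\<exists>k. l x \<le> u y + k * N \<and> l y + k * N \<le> u x" using * by (intro exI[of _ 0]) auto
    next
      assume "\<exists>k. l x \<le> u y + k * N \<and> l y + k * N \<le> u x"
      then obtain k where k: "l x \<le> u y + k * N" "l y + k * N \<le> u x" by blast
      have "k = 0"
      proof (cases rule: mult_int_cases[OF N(1), of k])
        case 2 then show ?thesis using k B[OF xy(1)] B[OF xy(2)] N_def by linarith
      next
        case 3 then show ?thesis using k B[OF xy(1)] B[OF xy(2)] N_def by linarith
      qed
      then show "(x, y) \<in> E" using k * by auto
    qed
  qed
  moreover have "\<not> (l x + k * N \<le> B \<and> B < u x + k * N)" if "x \<in> V" for x k
  proof (cases rule: mult_int_cases[OF N(1), of k])
    case 1 then show ?thesis using B[OF that] by simp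
  next
    case 2 then show ?thesis using B[OF that] N_def by linarith
  next
    case 3 then show ?thesis using B[OF that] N_def by linarith
  qed
  ultimately show ?thesis using N(2) by blast
qed

text \<open>The path occupies only part of the circle. The idle stretch lets the construction of
  \<open>spined_graph\<close> serve both cases, and it contains the edge that no arc covers.\<close>

lemma chordal_model:
  "\<exists>N a b. 3 \<le> N \<and> circular_model V E N a b \<and>
    (\<exists>q. \<forall>x\<in>V. \<forall>k. \<not> (a x + k * N \<le> q \<and> q < b x + k * N))"
proof -
  obtain n f where f: "induced_path n f" and dom: "\<And>x. x \<in> V \<Longrightarrow> \<exists>i\<le>n. x \<in> nbh (f i)"
    and incomp: "\<And>i j. i \<le> n \<Longrightarrow> j \<le> n \<Longrightarrow> i \<noteq> j \<Longrightarrow> \<not> nbh (f i) \<subseteq> nbh (f j)"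
    using dominating_path by blast
  note F = induced_pathD[OF f]
  show ?thesis
  proof (cases "n = 0")
    case True
    then have "V \<subseteq> nbh (f 0)" using dom by auto
    then show ?thesis using center_model[of "f 0"] F(1)[of 0] by blast
  next
    case False
    then have n1: "1 \<le> n" by simp
    have edge: "(f i, f (i + 1)) \<in> E" if "i < n" for i using F(3)[of i "i + 1"] that by simp
    define A where "A x = {i. i \<le> n \<and> x \<in> nbh (f i)}" for x
    have A: "finite (A x)" "x \<in> V \<Longrightarrow> A x \<noteq> {}" for x
      using dom by (auto simp: A_def intro: finite_subset[of _ "{..n}"])
    define sn where "sn x = Min (A x)" for x
    define en where "en x = Max (A x)" for x
    have sn: "sn x \<in> A x" "\<And>i. i \<in> A x \<Longrightarrow> sn x \<le> i" if "x \<in> V" for x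
      using A[of x] that by (auto simp: sn_def)
    have en: "en x \<in> A x" "\<And>i. i \<in> A x \<Longrightarrow> i \<le> en x" if "x \<in> V" for x
      using A[of x] that by (auto simp: en_def)
    \<comment> \<open>A gap in the set of spine vertices seen by \<open>x\<close> would close
      through \<open>x\<close> to an induced cycle.\<close>
    have contig: "k \<in> A x" if x: "x \<in> V" and k: "sn x \<le> k" "k \<le> en x" for x k
    proof (rule ccontr)
      assume k': "k \<notin> A x"
      define i where "i = Max {i \<in> A x. i \<le> k}"
      define j where "j = Min {i \<in> A x. k \<le> i}"
      have fin: "finite {i \<in> A x. i \<le> k}" "finite {i \<in> A x. k \<le> i}" using A(1)[of x] by auto
      have "i \<in> {i \<in> A x. i \<le> k}" unfolding i_def using fin sn(1)[OF x] k by (intro Max_in) auto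
      then have i: "i \<in> A x" "i < k" using k' by (auto simp: le_less)
      have i2: "t \<le> i" if "t \<in> A x" "t \<le> k" for t unfolding i_def using fin that by (intro Max_ge) auto
      have "j \<in> {i \<in> A x. k \<le> i}" unfolding j_def using fin en(1)[OF x] k by (intro Min_in) auto
      then have j: "j \<in> A x" "k < j" using k' by (auto simp: le_less)
      have j2: "j \<le> t" if "t \<in> A x" "k \<le> t" for t unfolding j_def using fin that by (intro Min_le) auto
      have jn: "j \<le> n" using j by (simp add: A_def)
      have gap: "t \<notin> A x" if "i < t" "t < j" for t using i2[of t] j2[of t] that by fastforce
      have "x \<noteq> f i"
      proof
        assume "x = f i"
        then have "i + 1 \<in> A x" using edge[of i] sym_E i j jn by (auto simp: A_def mem_nbh)
        moreover have "i + 1 < j" using i(2) j(2) by linarith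
        ultimately show False using gap[of "i + 1"] by simp
      qed
      have "x \<noteq> f j"
      proof
        assume "x = f j"
        then have "j - 1 \<in> A x" using edge[of "j - 1"] i j jn by (auto simp: A_def mem_nbh)
        moreover have "i < j - 1" "j - 1 < j" using i(2) j(2) by linarith+
        ultimately show False using gap by blast
      qed
      have p: "induced_path (j - i) (\<lambda>k. f (i + k))" using induced_path_segment[OF f, of i "j - i"] i j jn by auto
      have "induced_cycle (j - i + 2) (\<lambda>k. if k = 0 then x else f (i + (k - 1)))"
      proof (rule induced_cycle_close[OF p])
        show "2 \<le> j - i" using i j by auto
        show "(x, f (i + 0)) \<in> E" using i \<open>x \<noteq> f i\<close> sym_E by (auto simp: A_def mem_nbh)
        show "(x, f (i + (j - i))) \<in> E" using i j \<open>x \<noteq> f j\<close> sym_E by (auto simp: A_def mem_nbh)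
        show "f (i + t) \<notin> nbh x" if "0 < t" "t < j - i" for t
          using gap[of "i + t"] that jn nbh_sym[of x] by (auto simp: A_def)
      qed
      then show False using chordal by blast
    qed
    \<comment> \<open>Here the stretch between two disjoint blocks would close through the edge
      \<open>xy\<close> to an induced cycle.\<close>
    have meet0: False if xy: "(x, y) \<in> E" and lt: "en x < sn y" for x y
    proof -
      have V: "x \<in> V" "y \<in> V" using xy E_in_V by auto
      have ex: "x \<in> nbh (f (en x))" "en x \<le> n" using en(1)[OF V(1)] by (auto simp: A_def)
      have sy: "y \<in> nbh (f (sn y))" "sn y \<le> n" using sn(1)[OF V(2)] by (auto simp: A_def)
      have nx: "x \<notin> nbh (f t)" if "en x < t" "t \<le> n" for t using en(2)[OF V(1), of t] that by (auto simp: A_def)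
      have ny: "y \<notin> nbh (f t)" if "t < sn y" for t using sn(2)[OF V(2), of t] that sy(2) by (auto simp: A_def)
      have "y \<noteq> f (sn y)" using nx[of "sn y"] sy lt xy sym_E by (auto simp: mem_nbh)
      moreover have "x \<noteq> f (en x)" using ny[of "en x"] lt xy by (auto simp: mem_nbh)
      ultimately have e: "(f (sn y), y) \<in> E" "(f (en x), x) \<in> E" using ex sy by (auto simp: mem_nbh)
      define g where "g = sn y - en x"
      have p: "induced_path g (\<lambda>k. f (en x + k))" using induced_path_segment[OF f, of "en x" g] lt sy(2) by (simp add: g_def)
      have "\<exists>F. induced_cycle (g + 3) F"
        by (rule induced_cycle_close_edge[OF p, of x y])
          (use e sym_E xy lt nx ny sy in \<open>auto simp: g_def\<close>)
      then show False using chordal by blast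
    qed
    \<comment> \<open>The ends of the path need a spine neighbour on their outer side too, not
      adjacent to the inner one: it is what orients the local model.\<close>
    obtain q0 where q0: "q0 \<in> nbh (f 0)" "q0 \<notin> nbh (f 1)" using incomp[of 0 1] n1 by auto
    obtain q1 where q1: "q1 \<in> nbh (f n)" "q1 \<notin> nbh (f (n - 1))" using incomp[of n "n - 1"] n1 by fastforce
    have "q0 \<noteq> f 0" using q0(2) edge[of 0] sym_E n1 by (auto simp: mem_nbh)
    then have q0e: "(q0, f 0) \<in> E" using q0 sym_E by (auto simp: mem_nbh)
    have "q1 \<noteq> f n" using q1(2) edge[of "n - 1"] n1 by (auto simp: mem_nbh)
    then have q1e: "(f n, q1) \<in> E" using q1 by (auto simp: mem_nbh)
    \<comment> \<open>\<open>short\<close> asks for \<open>M > 2 * n\<close>, and index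
      \<open>-1\<close>, which is \<open>2 * n + 4\<close> modulo \<open>M\<close>, must differ from
      \<open>n + 1\<close>.\<close>
    define M where "M = 2 * int n + 5"
    \<comment> \<open>Index \<open>-1\<close> is a private neighbour of the first spine vertex, index \<open>n + 1\<close> one of the last.\<close>
    define c where "c i = (if i mod M \<le> int n then f (nat (i mod M)) else if i mod M = int n + 1 then q1 else q0)" for i
    define J where "J = {i. i mod M \<le> int n}"
    define s where "s x = int (sn x)" for x
    define e where "e x = int (en x)" for x
    have se: "0 \<le> s x" "s x \<le> e x" "e x \<le> int n" if "x \<in> V" for x
      using sn[OF that] en[OF that] by (auto simp: s_def e_def A_def)
    have M0: "0 < M" by (simp add: M_def)
    have blk: "i \<in> J \<and> x \<in> nbh (c i) \<longleftrightarrow> (\<exists>k. s x + k * M \<le> i \<and> i \<le> e x + k * M)" if x: "x \<in> V" for x i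
    proof
      assume h: "i \<in> J \<and> x \<in> nbh (c i)"
      then have "nat (i mod M) \<in> A x" using M0 by (auto simp: A_def J_def c_def nat_le_iff)
      then have "sn x \<le> nat (i mod M)" "nat (i mod M) \<le> en x" using sn[OF x] en[OF x] by auto
      moreover have "0 \<le> i mod M" using M0 by simp
      ultimately have "s x \<le> i mod M" "i mod M \<le> e x" unfolding s_def e_def by linarith+
      moreover have "i = i mod M + i div M * M" by simp
      ultimately show "\<exists>k. s x + k * M \<le> i \<and> i \<le> e x + k * M"
        by (intro exI[of _ "i div M"]) linarith
    next
      assume "\<exists>k. s x + k * M \<le> i \<and> i \<le> e x + k * M"
      then obtain k where "s x + k * M \<le> i" "i \<le> e x + k * M" by blast
      then have k: "s x \<le> i - k * M" "i - k * M \<le> e x" by linarith+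
      then have t: "0 \<le> i - k * M" "i - k * M \<le> int n" "i - k * M < M" using se[OF x] by (auto simp: M_def)
      have "i mod M = (i - k * M) mod M" using mod_mult_self1[of "i - k * M" k M] by simp
      then have im: "i mod M = i - k * M" using t by simp
      have "nat (i - k * M) \<in> A x" using contig[OF x, of "nat (i - k * M)"] k t by (auto simp: s_def e_def)
      then show "i \<in> J \<and> x \<in> nbh (c i)" using im t by (auto simp: J_def c_def A_def)
    qed
    interpret spined_graph V E r c M J s e
    proof
      show "1 < M" by (simp add: M_def)
      show "c (i + k * M) = c i" for i k by (simp add: c_def)
      show "(i + k * M \<in> J) = (i \<in> J)" for i k by (simp add: J_def)
      show "0 \<le> s x \<and> s x < M" "s x \<le> e x" if "x \<in> V" for x using se[OF that] by (auto simp: M_def)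
      show "i \<in> J \<and> x \<in> nbh (c i) \<longleftrightarrow> (\<exists>k. s x + k * M \<le> i \<and> i \<le> e x + k * M)" if "x \<in> V" for x i
        using blk[OF that] .
      show "e x - s x + (e y - s y) < M" if "x \<in> V" "y \<in> V" for x y
        using se[OF that(1)] se[OF that(2)] by (auto simp: M_def)
      show "\<exists>k. s x \<le> e y + k * M \<and> s y + k * M \<le> e x" if "(x, y) \<in> E" for x y
      proof -
        have "\<not> en x < sn y" "\<not> en y < sn x" using meet0[OF that] meet0[OF sym_E[OF that]] by auto
        then show ?thesis by (intro exI[of _ 0]) (auto simp: s_def e_def)
      qed
      fix j assume "j \<in> J"
      define t where "t = nat (j mod M)"
      have t: "t \<le> n" "j mod M = int t" using \<open>j \<in> J\<close> M0 by (auto simp: J_def t_def nat_le_iff)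
      have cj: "c j = f t" using t by (simp add: c_def)
      have "(j + 1) mod M = (j mod M + 1) mod M" by (simp add: mod_add_left_eq)
      then have m1: "(j + 1) mod M = int t + 1" using t by (simp add: M_def)
      have c1: "c (j + 1) = (if t < n then f (t + 1) else q1)" using t m1 by (auto simp: c_def nat_add_distrib)
      have "(j - 1) mod M = (j mod M - 1) mod M" by (simp add: mod_diff_left_eq)
      then have "(j - 1) mod M = (int t - 1) mod M" using t by simp
      moreover have "(int t - 1) mod M = (if t = 0 then M - 1 else int t - 1)"
        using t zmod_minus1[OF M0] by (auto simp: M_def)
      ultimately have c0: "c (j - 1) = (if t = 0 then q0 else f (t - 1))"
        using t by (auto simp: c_def M_def nat_diff_distrib)
      have a1: "(c (j - 1), c j) \<in> E" using c0 cj q0e edge[of "t - 1"] t by auto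
      have a2: "(c j, c (j + 1)) \<in> E" using c1 cj q1e edge[of t] t by auto
      have a3: "c (j - 1) \<notin> nbh (c (j + 1))"
      proof (cases "t = 0")
        case True then show ?thesis using c0 c1 q0 n1 by simp
      next
        case False
        show ?thesis
        proof (cases "t < n")
          case True
          have "t - 1 < t + 1" "t + 1 \<le> n" "t + 1 \<noteq> Suc (t - 1)" using True False by linarith+
          then have "f (t - 1) \<noteq> f (t + 1)" "(f (t - 1), f (t + 1)) \<notin> E" using F(2,3) by blast+
          then show ?thesis using c0 c1 False True sym_E by (auto simp: mem_nbh)
        next
          case False
          then show ?thesis using c0 c1 \<open>t \<noteq> 0\<close> t q1 nbh_sym by (auto simp: le_antisym)
        qed
      qed
      show "(c (j - 1), c j) \<in> E \<and> (c j, c (j + 1)) \<in> E \<and> c (j - 1) \<notin> nbh (c (j + 1))"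
        using a1 a2 a3 by blast
    qed
    obtain a b W where W: "0 < W" and cm: "circular_model V E (M * W) a b"
      and ab: "\<And>x. x \<in> V \<Longrightarrow> s x * W \<le> a x \<and> b x < (e x + 1) * W" using model_exists by blast
    have "M * 1 \<le> M * W" using W M0 by (intro mult_left_mono) auto
    moreover have "3 \<le> M" by (simp add: M_def)
    ultimately have N3: "3 \<le> M * W" by linarith
    \<comment> \<open>All arcs end before index \<open>n + 1\<close>, and the next turn starts only
      at \<open>M * W\<close>.\<close>
    define q where "q = (int n + 1) * W"
    have free: "\<not> (a x + k * (M * W) \<le> q \<and> q < b x + k * (M * W))" if x: "x \<in> V" for x k
    proof -
      have "0 \<le> s x * W" using se[OF x] W by simp
      moreover have "(e x + 1) * W \<le> q" unfolding q_def using se[OF x] W by (intro mult_right_mono) auto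
      ultimately have ax: "0 \<le> a x" "b x < q" using ab[OF x] by auto
      have qM: "q < M * W" unfolding q_def using W by (intro mult_strict_right_mono) (auto simp: M_def)
      have "0 < M * W" using N3 by simp
      then show ?thesis
      proof (cases rule: mult_int_cases[of "M * W" k])
        case 1 then show ?thesis using ax by simp
      next
        case 2 then show ?thesis using ax qM by linarith
      next
        case 3 then show ?thesis using ax N3 by linarith
      qed
    qed
    show ?thesis using N3 cm free by blast
  qed
qed

end

section \<open>Graphs with a long induced cycle\<close>

locale locally_interval_cycle = locally_interval_graph +
  fixes n :: nat and f :: "nat \<Rightarrow> 'a"
  assumes cycle: "induced_cycle n f"
    and shortest: "induced_cycle m g \<Longrightarrow> n \<le> m"
begin

lemma n_gt_r: "r < n"
  by (rule induced_cycle_long[OF cycle])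

definition M :: int where "M = int n"

definition c :: "int \<Rightarrow> 'a" where "c i = f (nat (i mod M))"

lemma M5: "5 \<le> M"
  using n_gt_r r4 by (simp add: M_def)

lemma c_per: "c (i + k * M) = c i"
  by (simp add: c_def)

lemma c_V: "c i \<in> V"
proof -
  have "0 \<le> i mod M" "i mod M < M" using M5 by auto
  then show ?thesis unfolding c_def M_def by (intro induced_cycleD(2)[OF cycle]) linarith
qed

lemma c_far:
  assumes "i < j" "j < i + M"
  shows "c i \<noteq> c j" and "(c i, c j) \<in> E \<longleftrightarrow> j = i + 1 \<or> j = i + M - 1"
proof -
  note C = induced_cycleD[OF cycle]
  define p where "p = i mod M"
  define q where "q = j mod M"
  have p: "0 \<le> p" "p < M" and q: "0 \<le> q" "q < M" using M5 by (auto simp: p_def q_def)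
  have qm: "q = (p + (j - i)) mod M" unfolding p_def q_def by (simp add: mod_add_left_eq)
  then have cases: "q = p + (j - i) \<or> q = p + (j - i) - M"
  proof (cases "p + (j - i) < M")
    case True
    then show ?thesis using qm p assms by simp
  next
    case False
    have "(p + (j - i)) mod M = (p + (j - i) - M + 1 * M) mod M" by simp
    also have "\<dots> = (p + (j - i) - M) mod M" by (rule mod_mult_self1)
    also have "\<dots> = p + (j - i) - M" using False p assms by (intro mod_pos_pos_trivial) auto
    finally show ?thesis using qm by simp
  qed
  define P where "P = nat p"
  define Q where "Q = nat q"
  have PQ: "int P = p" "int Q = q" "P < n" "Q < n" using p q by (auto simp: P_def Q_def M_def)
  have cc: "c i = f P" "c j = f Q" by (simp_all add: c_def P_def Q_def p_def q_def)
  have "c i \<noteq> c j \<and> ((c i, c j) \<in> E \<longleftrightarrow> j = i + 1 \<or> j = i + M - 1)"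
  proof (cases "q = p + (j - i)")
    case True
    then have lt: "P < Q" using PQ assms by linarith
    have "(Q = Suc P \<or> P = 0 \<and> Suc Q = n) \<longleftrightarrow> j = i + 1 \<or> j = i + M - 1"
      using True PQ assms by (auto simp: M_def)
    then show ?thesis using C(3)[OF lt PQ(4)] C(4)[OF lt PQ(4)] cc by simp
  next
    case False
    then have eq: "q = p + (j - i) - M" using cases by simp
    then have lt: "Q < P" using PQ assms by linarith
    have "(P = Suc Q \<or> Q = 0 \<and> Suc P = n) \<longleftrightarrow> j = i + 1 \<or> j = i + M - 1"
      using eq PQ assms M_def by presburger
    moreover have "(c i, c j) \<in> E \<longleftrightarrow> (f Q, f P) \<in> E" unfolding cc by (rule E_commute)
    ultimately show ?thesis using C(3)[OF lt PQ(3)] C(4)[OF lt PQ(3)] cc by metis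
  qed
  then show "c i \<noteq> c j" "(c i, c j) \<in> E \<longleftrightarrow> j = i + 1 \<or> j = i + M - 1" by auto
qed

lemma c_step: "(c i, c (i + 1)) \<in> E"
  using c_far(2)[of i "i + 1"] M5 by simp

lemma c_apart:
  assumes "i + 2 \<le> j" "j + 2 \<le> i + M"
  shows "c i \<noteq> c j" "(c i, c j) \<notin> E" "(c j, c i) \<notin> E" "c i \<notin> nbh (c j)" "c j \<notin> nbh (c i)"
proof -
  show *: "c i \<noteq> c j" "(c i, c j) \<notin> E" using c_far[of i j] assms by auto
  show "(c j, c i) \<notin> E" using * sym_E by blast
  then show "c i \<notin> nbh (c j)" "c j \<notin> nbh (c i)" using * by (auto simp: mem_nbh)
qed

lemma c_segment:
  assumes "int g \<le> M - 2"
  shows "induced_path g (\<lambda>k. c (i + int k))"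
  unfolding induced_path_def
proof (intro conjI allI impI)
  show "c (i + int k) \<in> V" for k by (rule c_V)
  fix k j assume kj: "k < j" "j \<le> g"
  show "c (i + int k) \<noteq> c (i + int j)" using c_far(1)[of "i + int k" "i + int j"] kj assms by simp
  show "((c (i + int k), c (i + int j)) \<in> E) = (j = Suc k)"
    using c_far(2)[of "i + int k" "i + int j"] kj assms by auto
qed

text \<open>A vertex of the cycle is seen from both of its neighbours on it, so \<open>x\<close>
  cannot be \<open>c i\<close> itself.\<close>

lemma nbh_boundary:
  assumes "x \<in> nbh (c i)" "x \<notin> nbh (c (i + 1)) \<or> x \<notin> nbh (c (i - 1))"
  shows "x \<noteq> c i" "(x, c i) \<in> E" "(c i, x) \<in> E"
proof -
  show "x \<noteq> c i"
    using assms(2) c_step[of i] c_step[of "i - 1"] sym_E by (auto simp: mem_nbh)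
  then show "(c i, x) \<in> E" using assms(1) by (simp add: mem_nbh)
  then show "(x, c i) \<in> E" using sym_E by blast
qed

text \<open>The gap closes through \<open>x\<close> to an induced cycle with
  \<open>j - i + 2\<close> vertices, and the spine is a shortest one.\<close>

lemma gap_long:
  assumes i: "x \<in> nbh (c i)" and j: "x \<in> nbh (c j)" and ij: "2 \<le> j - i"
    and gap: "\<And>t. i < t \<Longrightarrow> t < j \<Longrightarrow> x \<notin> nbh (c t)"
  shows "M - 2 \<le> j - i"
proof (rule ccontr)
  assume h: "\<not> M - 2 \<le> j - i"
  define g where "g = nat (j - i)"
  have g: "int g = j - i" using ij by (simp add: g_def)
  have xi: "(x, c i) \<in> E" using nbh_boundary[OF i] gap[of "i + 1"] ij by auto
  have xj: "(x, c j) \<in> E" using nbh_boundary[OF j] gap[of "j - 1"] ij by auto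
  have "induced_path g (\<lambda>k. c (i + int k))" using c_segment g h by simp
  then have "induced_cycle (g + 2) (\<lambda>k. if k = 0 then x else c (i + int (k - 1)))"
  proof (rule induced_cycle_close)
    show "2 \<le> g" using g ij by linarith
    show "(x, c (i + int 0)) \<in> E" "(x, c (i + int g)) \<in> E" using xi xj g by simp_all
    show "c (i + int t) \<notin> nbh x" if "0 < t" "t < g" for t
      using gap[of "i + int t"] that g nbh_sym[of x] by auto
  qed
  then have "n \<le> g + 2" by (rule shortest)
  then show False using h g by (simp add: M_def)
qed

text \<open>\<open>s\<close> is normalised to \<open>0..<M\<close> while \<open>e\<close> may exceed
  \<open>M\<close>, so that a run through index 0 is still one interval. The bound of three indices
  is what \<open>gap_long\<close> leaves of a turn.\<close>

definition block :: "'a \<Rightarrow> int \<Rightarrow> int \<Rightarrow> bool" where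
  "block x s e \<longleftrightarrow> 0 \<le> s \<and> s < M \<and> s \<le> e \<and> e \<le> s + 2 \<and>
     (\<forall>i. x \<in> nbh (c i) \<longleftrightarrow> (\<exists>k. s + k * M \<le> i \<and> i \<le> e + k * M))"

lemma block_in: "block x s e \<Longrightarrow> s + k * M \<le> i \<Longrightarrow> i \<le> e + k * M \<Longrightarrow> x \<in> nbh (c i)"
  unfolding block_def by blast

lemma block_out:
  assumes b: "block x s e" and i: "e + k * M < i" "i < s + (k + 1) * M"
  shows "x \<notin> nbh (c i)"
proof
  assume "x \<in> nbh (c i)"
  then obtain t where t: "s + t * M \<le> i" "i \<le> e + t * M" using b unfolding block_def by blast
  have "k < t"
  proof (rule ccontr)
    assume "\<not> k < t"
    then have "t * M \<le> k * M" using M5 by (intro mult_right_mono) auto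
    then show False using t i by linarith
  qed
  then have "(k + 1) * M \<le> t * M" using M5 by (intro mult_right_mono) auto
  then show False using t i by linarith
qed

text \<open>By \<open>no_wheel\<close> some seen index \<open>i\<close> is followed by an unseen
  one. The gap from \<open>i\<close> to the next seen index \<open>j\<close> has length at least
  \<open>M - 2\<close>, so at most three indices remain from \<open>j\<close> to
  \<open>i + M\<close>; if the middle one of three were unseen, it would leave a gap of length 2,
  which is less than \<open>M - 2\<close>.\<close>

lemma block_exists:
  assumes x: "x \<in> nbh (c i0)"
  shows "\<exists>s e. block x s e"
proof -
  define A where "A = {i. x \<in> nbh (c i)}"
  have per: "i + k * M \<in> A \<longleftrightarrow> i \<in> A" for i k by (simp add: A_def c_per)
  have "\<exists>i. i \<in> A \<and> i + 1 \<notin> A"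
  proof (rule ccontr)
    assume "\<not> ?thesis"
    then have up: "\<And>i. i \<in> A \<Longrightarrow> i + 1 \<in> A" by blast
    have up': "i0 + int k \<in> A" for k
    proof (induction k)
      case 0 then show ?case using x by (simp add: A_def)
    next
      case (Suc k) then show ?case using up[of "i0 + int k"] by (simp add: ac_simps)
    qed
    have all: "i \<in> A" for i
    proof -
      define D where "D = \<bar>i0 - i\<bar>"
      have "D * 1 \<le> D * M" using M5 by (intro mult_left_mono) (auto simp: D_def)
      moreover have "i0 - i \<le> D" by (simp add: D_def)
      ultimately have "0 \<le> i + D * M - i0" by linarith
      then have "i + D * M \<in> A" using up'[of "nat (i + D * M - i0)"] by simp
      then show ?thesis using per by blast
    qed
    have "(x, f i) \<in> E" if "i < n" for i
    proof -
      have fi: "f i = c (int i)" using that by (simp add: c_def M_def)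
      have "x \<noteq> c (int i)"
      proof
        assume "x = c (int i)"
        then show False using all[of "int i + 2"] c_apart(4)[of "int i" "int i + 2"] M5 by (simp add: A_def)
      qed
      then show ?thesis using all[of "int i"] fi sym_E by (auto simp: A_def mem_nbh)
    qed
    then show False using no_wheel[OF cycle] by blast
  qed
  then obtain i where i: "i \<in> A" "i + 1 \<notin> A" by blast
  define Q where "Q g \<longleftrightarrow> 0 < g \<and> i + int g \<in> A" for g
  have Qn: "Q n" using i(1) per[of i 1] M5 by (simp add: Q_def M_def)
  define g where "g = (LEAST g. Q g)"
  have Qg: "Q g" unfolding g_def using Qn by (rule LeastI)
  have gn: "int g \<le> M" unfolding g_def M_def using Least_le[of Q, OF Qn] by simp
  have gmin: "\<not> Q t" if "t < g" for t using that not_less_Least unfolding g_def by blast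
  have "g \<noteq> 1" using Qg i(2) by (auto simp: Q_def)
  then have g2: "2 \<le> g" using Qg by (auto simp: Q_def)
  define j where "j = i + int g"
  have jA: "j \<in> A" using Qg by (simp add: Q_def j_def)
  have gap: "t \<notin> A" if "i < t" "t < j" for t
    using gmin[of "nat (t - i)"] that by (auto simp: Q_def j_def)
  have long: "M - 2 \<le> int g"
    using gap_long[of x i j] i jA gap g2 by (auto simp: A_def j_def)
  have inA: "t \<in> A \<longleftrightarrow> j \<le> t" if t: "i < t" "t \<le> i + M" for t
  proof
    assume "t \<in> A" then show "j \<le> t" using gap[of t] t by force
  next
    assume jt: "j \<le> t"
    have iM: "i + M \<in> A" using per[of i 1] i(1) by simp
    consider "t = j" | "t = i + M" | "t = j + 1" "i + M = j + 2" using jt t long j_def by linarith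
    then show "t \<in> A"
    proof cases
      case 3
      show ?thesis
      proof (rule ccontr)
        assume nA: "t \<notin> A"
        have "M - 2 \<le> (i + M) - j"
        proof (rule gap_long[of x])
          show "x \<in> nbh (c j)" "x \<in> nbh (c (i + M))" using jA iM by (auto simp: A_def)
          show "2 \<le> i + M - j" using 3 by simp
          show "x \<notin> nbh (c u)" if "j < u" "u < i + M" for u
          proof -
            have "u = t" using that 3 by linarith
            then show ?thesis using nA by (simp add: A_def)
          qed
        qed
        then show False using 3 M5 by linarith
      qed
    qed (use jA iM in auto)
  qed
  define s where "s = j mod M"
  define e where "e = s + (M - int g)"
  define d where "d = j div M"
  have js: "j = s + d * M" by (simp add: s_def d_def)
  have je: "i + M = e + d * M" using js by (simp add: e_def j_def)
  have "x \<in> nbh (c i') \<longleftrightarrow> (\<exists>k. s + k * M \<le> i' \<and> i' \<le> e + k * M)" for i'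
  proof
    assume "x \<in> nbh (c i')"
    define k where "k = (i' - i - 1) div M"
    define t where "t = i' + (- k) * M"
    have "t = i + 1 + (i' - i - 1) mod M"
      using div_mult_mod_eq[of "i' - i - 1" M] unfolding t_def k_def by linarith
    moreover have "0 \<le> (i' - i - 1) mod M" "(i' - i - 1) mod M < M" using M5 by auto
    ultimately have t: "i < t" "t \<le> i + M" by linarith+
    have "t \<in> A" unfolding t_def per using \<open>x \<in> nbh (c i')\<close> by (simp add: A_def)
    then have "j \<le> t" using inA t by blast
    then have "s + (k + d) * M \<le> i' \<and> i' \<le> e + (k + d) * M"
      using t js je by (simp add: t_def algebra_simps)
    then show "\<exists>k. s + k * M \<le> i' \<and> i' \<le> e + k * M" by blast
  next
    assume "\<exists>k. s + k * M \<le> i' \<and> i' \<le> e + k * M"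
    then obtain k where k: "s + k * M \<le> i'" "i' \<le> e + k * M" by blast
    define t where "t = i' + (d - k) * M"
    have "j \<le> t" "t \<le> i + M" using k js je by (auto simp: t_def algebra_simps)
    then have "t \<in> A" using inA[of t] g2 by (simp add: j_def)
    then show "x \<in> nbh (c i')" unfolding t_def per by (simp add: A_def)
  qed
  moreover have "0 \<le> s" "s < M" using M5 by (auto simp: s_def)
  moreover have "s \<le> e" "e \<le> s + 2" using gn long by (auto simp: e_def)
  ultimately show ?thesis unfolding block_def by blast
qed

text \<open>Otherwise \<open>claw\<close> applies at \<open>c s\<close> with legs through
  \<open>c (s - 1)\<close>, \<open>c (s + 1)\<close> and \<open>x\<close>, whose outer neighbours
  are \<open>c (s - 2)\<close>, \<open>c (s + 2)\<close> and \<open>y\<close>.\<close>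

lemma single_block:
  assumes b: "block x s s" and xy: "(x, y) \<in> E" and y: "y \<notin> nbh (c s)"
  shows False
proof -
  have x: "x \<in> nbh (c s)" "x \<notin> nbh (c (s + 1))" using block_in[OF b, of 0 s] block_out[OF b, of 0 "s + 1"] M5 by auto
  have x': "x \<notin> nbh (c (s - 1))"
    using block_out[OF b, of "-1" "s - 1"] M5 by auto
  have ne: "x \<noteq> c (s + 1)" "(x, c (s + 1)) \<notin> E" "x \<noteq> c (s - 1)" "(x, c (s - 1)) \<notin> E"
    using x x' sym_E by (auto simp: mem_nbh)
  have st: "(c s, c (s - 1)) \<in> E" "(c s, c (s + 1)) \<in> E" "(c (s - 1), c (s - 2)) \<in> E" "(c (s + 1), c (s + 2)) \<in> E"
    using c_step[of "s - 1"] c_step[of s] c_step[of "s - 2"] c_step[of "s + 1"] sym_E by (auto simp: add.assoc)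
  have ap: "c (s - 1) \<noteq> c (s + 1)" "(c (s - 1), c (s + 1)) \<notin> E" "c (s - 2) \<notin> nbh (c s)" "c (s + 2) \<notin> nbh (c s)"
    using c_apart[of "s - 1" "s + 1"] c_apart[of "s - 2" s] c_apart[of s "s + 2"] M5 by auto
  have sx: "(c s, x) \<in> E" using nbh_boundary[OF x(1)] x(2) by blast
  have ne': "c (s - 1) \<noteq> x" "c (s + 1) \<noteq> x" "(c (s - 1), x) \<notin> E" "(c (s + 1), x) \<notin> E"
    using ne sym_E by auto
  show False
    using claw[OF st(1,2) sx ap(1) ne'(2,1) ap(2) ne'(4,3) st(3,4) xy ap(3,4) y] .
qed

text \<open>Connectivity gives an edge from a dominated \<open>y\<close> to an undominated
  \<open>w\<close>. According as the block of \<open>y\<close> has one, two or three indices, this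
  edge and the surrounding spine vertices form the obstruction of \<open>single_block\<close>,
  \<open>net\<close> or \<open>tent\<close>.\<close>

lemma cycle_dominates:
  assumes "x \<in> V"
  shows "\<exists>i. x \<in> nbh (c i)"
proof (rule ccontr)
  assume nx: "\<nexists>i. x \<in> nbh (c i)"
  define S where "S = {x \<in> V. \<exists>i. x \<in> nbh (c i)}"
  have "S \<subseteq> V" by (auto simp: S_def)
  moreover have "S \<noteq> {}" using c_V[of 0] by (auto simp: S_def mem_nbh)
  moreover have "S \<noteq> V" using nx assms by (auto simp: S_def)
  ultimately obtain y w where y: "y \<in> S" and w: "w \<in> V - S" and yw: "(y, w) \<in> E"
    using cut_edge by blast
  have nw: "w \<notin> nbh (c i)" for i using w by (auto simp: S_def)
  have nw': "w \<noteq> c i" "(w, c i) \<notin> E" for i using nw[of i] sym_E by (auto simp: mem_nbh)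
  obtain s e where b: "block y s e" using y block_exists unfolding S_def by blast
  have se: "s \<le> e" "e \<le> s + 2" using b by (auto simp: block_def)
  have i1: "y \<in> nbh (c i)" if "s \<le> i" "i \<le> e" for i using block_in[OF b, of 0 i] that by simp
  have o1: "y \<notin> nbh (c i)" if "e < i" "i < s + M" for i using block_out[OF b, of 0 i] that by simp
  have o2: "y \<notin> nbh (c i)" if "e - M < i" "i < s" for i using block_out[OF b, of "-1" i] that by simp
  have yne: "y \<noteq> c i" for i using nw[of i] yw by (auto simp: mem_nbh)
  have ye: "(y, c i) \<in> E" if "s \<le> i" "i \<le> e" for i
    using i1[OF that] yne[of i] sym_E by (auto simp: mem_nbh)
  have yo: "(c i, y) \<notin> E" "c i \<noteq> y" if "y \<notin> nbh (c i)" for i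
    using that by (auto simp: mem_nbh)
  have stm: "(c s, c (s - 1)) \<in> E" using c_step[of "s - 1"] sym_E by simp
  have ym: "(c (s - 1), y) \<notin> E" "c (s - 1) \<noteq> y" using yo[OF o2[of "s - 1"]] se M5 by auto
  have yp: "(c (e + 1), y) \<notin> E" "c (e + 1) \<noteq> y" using yo[OF o1[of "e + 1"]] se M5 by auto
  consider "e = s" | "e = s + 1" | "e = s + 2" using se by linarith
  then show False
  proof cases
    case 1
    then show False using single_block b yw nw by blast
  next
    case 2
    have st: "(c s, c (s + 1)) \<in> E" "(c (s + 1), c (s + 2)) \<in> E"
      using c_step[of s] c_step[of "s + 1"] by (auto simp: add.assoc)
    have ap: "(c (s - 1), c (s + 2)) \<notin> E" "(c (s - 1), c (s + 1)) \<notin> E" "(c (s + 2), c s) \<notin> E"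
      "c (s - 1) \<noteq> c (s + 2)" "c (s - 1) \<noteq> c (s + 1)" "c (s + 2) \<noteq> c s"
      using c_apart[of "s - 1" "s + 2"] c_apart[of "s - 1" "s + 1"] c_apart[of s "s + 2"] M5 by auto
    have yp': "(c (s + 2), y) \<notin> E" "c (s + 2) \<noteq> y" using yp 2 by (auto simp: add.assoc)
    show False
      using net[OF yw ye[of s] ye[of "s + 1"] st(1) stm st(2) nw'(2) nw'(2) nw'(2) nw'(2) ap(1)
          ym(1) ap(2) yp'(1) ap(3) nw'(1) nw'(1) nw'(1) nw'(1) ap(4) ym(2) ap(5) yp'(2) ap(6)] 2 by simp
  next
    case 3
    have st: "(c s, c (s + 1)) \<in> E" "(c (s + 1), c (s + 2)) \<in> E" "(c (s + 2), c (s + 3)) \<in> E"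
      using c_step[of s] c_step[of "s + 1"] c_step[of "s + 2"] by (auto simp: add.assoc)
    have ap: "(c s, c (s + 2)) \<notin> E" "c s \<noteq> c (s + 2)" using c_apart[of s "s + 2"] M5 by auto
    have yp': "(c (s + 3), y) \<notin> E" "c (s + 3) \<noteq> y" using yp 3 by (auto simp: add.assoc)
    show False
      using tent[OF yw ye[of s] ye[of "s + 1"] ye[of "s + 2"] st(1,2) stm st(3) ap nw'(2) nw'(2) nw'(2)
          nw'(1) nw'(1) nw'(1) ym yp'] 3 by simp
  qed
qed

text \<open>As in \<open>gap_long\<close>, but the cycle closes through the edge \<open>xy\<close>
  and has \<open>j - i + 3\<close> vertices.\<close>

lemma gap_edge_long:
  assumes xy: "(x, y) \<in> E" and i: "x \<in> nbh (c i)" and j: "y \<in> nbh (c j)" and ij: "i < j"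
    and gx: "\<And>t. i < t \<Longrightarrow> t \<le> j \<Longrightarrow> x \<notin> nbh (c t)"
    and gy: "\<And>t. i \<le> t \<Longrightarrow> t < j \<Longrightarrow> y \<notin> nbh (c t)"
  shows "M - 3 \<le> j - i"
proof (rule ccontr)
  assume h: "\<not> M - 3 \<le> j - i"
  define g where "g = nat (j - i)"
  have g: "int g = j - i" using ij by (simp add: g_def)
  have xi: "(x, c i) \<in> E" using nbh_boundary[OF i] gx[of "i + 1"] ij by auto
  have yj: "(c j, y) \<in> E" using nbh_boundary[OF j] gy[of "j - 1"] ij by auto
  have p: "induced_path g (\<lambda>k. c (i + int k))" using c_segment g h by simp
  have "\<exists>F. induced_cycle (g + 3) F"
    by (rule induced_cycle_close_edge[OF p, of x y]) (use g ij xi yj xy gx gy in auto)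
  then have "n \<le> g + 3" using shortest by blast
  then show False using h g by (simp add: M_def)
qed

text \<open>If the blocks are disjoint, both gaps between them have length at least
  \<open>M - 3\<close>. As gaps and block lengths add up to \<open>M >= 5\<close>, the block lengths
  sum to at most 1, so one block is a single index and \<open>single_block\<close> applies.\<close>

lemma blocks_meet:
  assumes xy: "(x, y) \<in> E" and bx: "block x s e" and by': "block y s' e'"
  shows "\<exists>k. s \<le> e' + k * M \<and> s' + k * M \<le> e"
proof (rule ccontr)
  assume no: "\<not> ?thesis"
  \<comment> \<open>The translate of the block of \<open>y\<close> that starts in the turn beginning
    at \<open>s\<close>.\<close>
  define k where "k = (if s \<le> s' then 0 else 1 :: int)"
  have se: "0 \<le> s" "s < M" "s \<le> e" "e \<le> s + 2" "0 \<le> s'" "s' < M" "s' \<le> e'" "e' \<le> s' + 2"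
    using bx by' by (auto simp: block_def)
  define p where "p = s' + k * M"
  define q where "q = e' + k * M"
  have pq: "p \<le> q" "q \<le> p + 2" "s \<le> p" "p < s + M" using se by (auto simp: p_def q_def k_def)
  have "\<not> (s \<le> q \<and> p \<le> e)" using no by (auto simp: p_def q_def)
  then have ep: "e < p" using pq by linarith
  have "\<not> (s \<le> e' + (k - 1) * M \<and> s' + (k - 1) * M \<le> e)" using no by blast
  then have "\<not> (s \<le> q - M \<and> p - M \<le> e)" by (simp add: p_def q_def algebra_simps)
  then have qs: "q < s + M" using pq se by linarith
  have xin: "x \<in> nbh (c e)" "x \<in> nbh (c s)" "x \<in> nbh (c (s + M))"
    using block_in[OF bx, of 0 e] block_in[OF bx, of 0 s] block_in[OF bx, of 1 "s + M"] se by auto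
  have yin: "y \<in> nbh (c p)" "y \<in> nbh (c q)"
    using block_in[OF by', of k p] block_in[OF by', of k q] se by (auto simp: p_def q_def)
  have xout: "x \<notin> nbh (c t)" if "e < t" "t < s + M" for t using block_out[OF bx, of 0 t] that by simp
  have yout: "y \<notin> nbh (c t)" if "q < t" "t < p + M" for t
    using block_out[OF by', of k t] that by (simp add: p_def q_def algebra_simps)
  have yout': "y \<notin> nbh (c t)" if "q - M < t" "t < p" for t
    using block_out[OF by', of "k - 1" t] that by (simp add: p_def q_def algebra_simps)
  have 1: "M - 3 \<le> p - e"
    using gap_edge_long[OF xy xin(1) yin(1) ep] xout yout' pq qs se by simp
  have 2: "M - 3 \<le> s + M - q"
    using gap_edge_long[OF sym_E[OF xy] yin(2) xin(3) qs] xout yout pq ep se by simp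
  have "e = s \<or> p = q" using 1 2 pq se M5 by linarith
  then show False
  proof
    assume "e = s"
    then show False using single_block[of x s y] bx xy yout'[of s] qs ep se by auto
  next
    assume "p = q"
    then have "e' = s'" by (simp add: p_def q_def)
    moreover have "x \<notin> nbh (c s')"
      using xout[of p] ep pq c_per[of s' k] by (simp add: p_def)
    ultimately show False using single_block[of y s' x] by' sym_E[OF xy] by simp
  qed
qed

end

text \<open>\<open>q\<close> stands for the edge of the circle from \<open>q\<close> to
  \<open>q + 1\<close>, hence the strict inequality on the right: the arcs of \<open>X\<close> all
  avoid one edge.\<close>

definition acyclic_model :: "nat \<Rightarrow> 'a set \<Rightarrow> int \<Rightarrow> ('a \<Rightarrow> int) \<Rightarrow> ('a \<Rightarrow> int) \<Rightarrow> bool" where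
  "acyclic_model r V N a b \<longleftrightarrow>
     (\<forall>X\<subseteq>V. card X \<le> r \<longrightarrow> (\<exists>q. \<forall>x\<in>X. \<forall>k. \<not> (a x + k * N \<le> q \<and> q < b x + k * N)))"

section \<open>Winding walks and acyclicity\<close>

context locally_interval_cycle
begin

definition st :: "'a \<Rightarrow> int" where "st x = (SOME s. \<exists>e. block x s e)"

definition en :: "'a \<Rightarrow> int" where "en x = (SOME e. block x (st x) e)"

lemma block_st_en:
  assumes "x \<in> V"
  shows "block x (st x) (en x)"
proof -
  obtain s e where "block x s e" using cycle_dominates[OF assms] block_exists by blast
  then have "\<exists>e. block x (st x) e" unfolding st_def by (metis (mono_tags, lifting) someI)
  then show ?thesis unfolding en_def by (rule someI_ex)
qed

lemma st_en:
  assumes "x \<in> V"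
  shows "0 \<le> st x" "st x < M" "st x \<le> en x" "en x \<le> st x + 2"
  using block_st_en[OF assms] by (auto simp: block_def)

text \<open>Every index belongs to the spine here. Two block lengths add up to at most 4, which is
  below \<open>M\<close>, as \<open>short\<close> asks.\<close>

lemma cycle_model:
  "\<exists>a b W. 0 < W \<and> circular_model V E (M * W) a b \<and>
     (\<forall>x\<in>V. st x * W \<le> a x \<and> b x < (en x + 1) * W)"
proof -
  interpret spined_graph V E r c M UNIV st en
  proof
    show "1 < M" using M5 by simp
    show "c (i + k * M) = c i" for i k by (rule c_per)
    show "(i + k * M \<in> UNIV) = (i \<in> UNIV)" for i k :: int by simp
    show "0 \<le> st x \<and> st x < M" "st x \<le> en x" if "x \<in> V" for x using st_en[OF that] by auto
    show "i \<in> UNIV \<and> x \<in> nbh (c i) \<longleftrightarrow> (\<exists>k. st x + k * M \<le> i \<and> i \<le> en x + k * M)" if "x \<in> V" for x i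
      using block_st_en[OF that] by (auto simp: block_def)
    show "en x - st x + (en y - st y) < M" if "x \<in> V" "y \<in> V" for x y
      using st_en[OF that(1)] st_en[OF that(2)] M5 by linarith
    show "\<exists>k. st x \<le> en y + k * M \<and> st y + k * M \<le> en x" if "(x, y) \<in> E" for x y
      using blocks_meet[OF that] block_st_en E_in_V[OF that] by blast
    show "(c (j - 1), c j) \<in> E \<and> (c j, c (j + 1)) \<in> E \<and> c (j - 1) \<notin> nbh (c (j + 1))" for j
      using c_step[of "j - 1"] c_step[of j] c_apart(4)[of "j - 1" "j + 1"] M5 by simp
  qed
  show ?thesis by (rule model_exists)
qed

text \<open>Adjacency in the infinite cyclic cover: the integer attached to a vertex counts turns
  around the spine.\<close>

definition near :: "'a \<Rightarrow> int \<Rightarrow> 'a \<Rightarrow> int \<Rightarrow> bool" where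
  "near x k y k' \<longleftrightarrow> (x, y) \<in> E \<and> st x + k * M \<le> en y + k' * M \<and> st y + k' * M \<le> en x + k * M"

lemma near_sym: "near x k y k' \<Longrightarrow> near y k' x k"
  using sym_E by (auto simp: near_def)

lemma near_shift: "near x k y k' \<Longrightarrow> near x (k + d) y (k' + d)"
  by (simp add: near_def algebra_simps)

lemma near_exists:
  assumes "(x, y) \<in> E"
  shows "\<exists>k'. near x k y k'"
proof -
  obtain t where "st x \<le> en y + t * M" "st y + t * M \<le> en x"
    using blocks_meet[OF assms] block_st_en E_in_V[OF assms] by blast
  then have "near x k y (k + t)" using assms by (simp add: near_def algebra_simps)
  then show ?thesis by blast
qed

text \<open>Two translates of \<open>y\<close> are at least \<open>M >= 5\<close> apart, while two
  block lengths add up to at most 4.\<close>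

lemma near_unique:
  assumes "near x k y k'" "near x k y k''"
  shows "k' = k''"
proof -
  have V: "x \<in> V" "y \<in> V" using assms E_in_V by (auto simp: near_def)
  have *: "\<not> p < q" if n: "near x k y p" "near x k y q" for p q
  proof
    assume "p < q"
    then have "(p + 1) * M \<le> q * M" using M5 by (intro mult_right_mono) auto
    moreover have "st x + k * M \<le> en y + p * M" "st y + q * M \<le> en x + k * M" using n by (auto simp: near_def)
    ultimately have "M \<le> en x - st x + (en y - st y)" by (simp add: algebra_simps)
    then show False using st_en[OF V(1)] st_en[OF V(2)] M5 by linarith
  qed
  show ?thesis using *[OF assms] *[OF assms(2,1)] by linarith
qed

text \<open>Otherwise \<open>x\<close>, \<open>y\<close> and two consecutive vertices of the cycle form an induced 4-cycle.\<close>

lemma near_not_tight: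
  assumes nr: "near x k y k'"
  shows "en y + k' * M + 1 \<noteq> st x + (k + 1) * M"
proof
  assume eq: "en y + k' * M + 1 = st x + (k + 1) * M"
  have xy: "(x, y) \<in> E" using nr by (simp add: near_def)
  have V: "x \<in> V" "y \<in> V" using E_in_V[OF xy] by auto
  note bx = block_st_en[OF V(1)] and by' = block_st_en[OF V(2)]
  define q where "q = en y + k' * M"
  have yq: "y \<in> nbh (c q)" using block_in[OF by', of k' q] st_en[OF V(2)] by (simp add: q_def)
  have yq1: "y \<notin> nbh (c (q + 1))"
    using block_out[OF by', of k' "q + 1"] st_en[OF V(2)] M5 by (simp add: q_def algebra_simps)
  have xq1: "x \<in> nbh (c (q + 1))"
    using block_in[OF bx, of "k + 1" "q + 1"] st_en[OF V(1)] eq by (simp add: q_def)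
  have xq: "x \<notin> nbh (c q)"
    using block_out[OF bx, of k q] st_en[OF V(1)] eq M5 by (simp add: q_def algebra_simps)
  have e: "(y, c q) \<in> E" "(c (q + 1), x) \<in> E"
    using nbh_boundary[OF yq] nbh_boundary[OF xq1] yq1 xq by auto
  have "(y, c (q + 1)) \<in> E \<or> (c q, x) \<in> E"
  proof (rule square_chord[OF _ e(1) c_step e(2) xy])
    show "\<not> induced_cycle 4 g" for g using shortest[of 4 g] M5 by (auto simp: M_def)
    show "y \<noteq> c (q + 1)" "c q \<noteq> x" using yq1 xq by (auto simp: mem_nbh)
  qed
  then show False using yq1 xq sym_E by (auto simp: mem_nbh)
qed

text \<open>
  Blocks have at most three elements, so a triangle can only wind around a spine of length at
  most 6: length 5 contradicts the previous lemma, and length 6 gives a net.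
\<close>

lemma no_winding_triangle:
  assumes n1: "near x k0 y k1" and n2: "near y k1 z k2" and n3: "near z k2 x k3" and lt: "k0 < k3"
  shows False
proof -
  have E: "(x, y) \<in> E" "(y, z) \<in> E" "(z, x) \<in> E" using assms by (auto simp: near_def)
  have V: "x \<in> V" "y \<in> V" "z \<in> V" using E E_in_V by auto
  note bx = block_st_en[OF V(1)] and by' = block_st_en[OF V(2)] and bz = block_st_en[OF V(3)]
  define p p' where "p = st x + k0 * M" and "p' = en x + k0 * M"
  define q q' where "q = st y + k1 * M" and "q' = en y + k1 * M"
  define t t' where "t = st z + k2 * M" and "t' = en z + k2 * M"
  have lens: "p \<le> p'" "p' \<le> p + 2" "q \<le> q'" "q' \<le> q + 2" "t \<le> t'" "t' \<le> t + 2"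
    using st_en[OF V(1)] st_en[OF V(2)] st_en[OF V(3)]
    by (auto simp: p_def p'_def q_def q'_def t_def t'_def)
  have link: "q \<le> p'" "p \<le> q'" "t \<le> q'" "q \<le> t'"
    using n1 n2 by (auto simp: near_def p_def p'_def q_def q'_def t_def t'_def)
  have n3': "st x + k3 * M \<le> t'" using n3 by (simp add: near_def t'_def)
  have "\<not> k0 + 2 \<le> k3"
  proof
    assume "k0 + 2 \<le> k3"
    then have "(k0 + 2) * M \<le> k3 * M" using M5 by (intro mult_right_mono) auto
    then have "p + 2 * M \<le> t'" using n3' by (simp add: p_def algebra_simps)
    then show False using lens link M5 by linarith
  qed
  then have k3: "k3 = k0 + 1" using lt by linarith
  have pt: "p + M \<le> t'" using n3' k3 by (simp add: p_def algebra_simps)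
  have "M \<le> 6" using pt lens link by linarith
  then consider "M = 5" | "M = 6" using M5 by linarith
  then show False
  proof cases
    case 1
    have a1: "q' + 1 \<noteq> p + M" using near_not_tight[OF n1] by (simp add: p_def q'_def algebra_simps)
    have a2: "t' + 1 \<noteq> q + M" using near_not_tight[OF n2] by (simp add: q_def t'_def algebra_simps)
    have a3: "p' + 1 \<noteq> t" using near_not_tight[OF n3] k3 by (simp add: p'_def t_def algebra_simps)
    have "q' = p + 3" using a1 lens link pt 1 by linarith
    moreover from this have "q = p + 2" "p' = p + 2" "t = p + 3" using a2 lens link pt 1 by linarith+
    ultimately show False using a3 by linarith
  next
    case 2
    have eqs: "p' = p + 2" "q = p + 2" "q' = p + 4" "t = p + 4" "t' = p + 6"
      using 2 lens link pt by linarith+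
    have xin: "x \<in> nbh (c i)" if "p \<le> i" "i \<le> p + 2" for i
      using block_in[OF bx, of k0 i] that eqs by (simp add: p_def p'_def)
    have xout: "x \<notin> nbh (c i)" if "p + 2 < i" "i < p + 6" for i
      using block_out[OF bx, of k0 i] that eqs 2 by (simp add: p_def p'_def algebra_simps)
    have yin: "y \<in> nbh (c i)" if "p + 2 \<le> i" "i \<le> p + 4" for i
      using block_in[OF by', of k1 i] that eqs by (simp add: q_def q'_def)
    have yout: "y \<notin> nbh (c i)" if "p + 4 < i" "i < p + 8" for i
      using block_out[OF by', of k1 i] that eqs 2 by (simp add: q_def q'_def algebra_simps)
    have zin: "z \<in> nbh (c i)" if "p + 4 \<le> i" "i \<le> p + 6" for i
      using block_in[OF bz, of k2 i] that eqs by (simp add: t_def t'_def)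
    have zout: "z \<notin> nbh (c i)" if "p + 6 < i" "i < p + 10" for i
      using block_out[OF bz, of k2 i] that eqs 2 by (simp add: t_def t'_def algebra_simps)
    have wrap: "c (i + 6) = c i" for i using c_per[of i 1] 2 by simp
    have no: "x \<notin> nbh (c (p + 3))" "x \<notin> nbh (c (p + 5))" "y \<notin> nbh (c (p + 5))" "y \<notin> nbh (c (p + 1))"
      "z \<notin> nbh (c (p + 1))" "z \<notin> nbh (c (p + 3))"
      using xout[of "p + 3"] xout[of "p + 5"] yout[of "p + 5"] yout[of "p + 7"] zout[of "p + 7"] zout[of "p + 9"]
        wrap[of "p + 1"] wrap[of "p + 3"] by (simp_all add: add.commute)
    \<comment> \<open>All three blocks have three indices, and the middle ones \<open>p + 1\<close>,
      \<open>p + 3\<close>, \<open>p + 5\<close> are each seen by just one of \<open>x\<close>,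
      \<open>y\<close>, \<open>z\<close>: they carry the pendant vertices of the net.\<close>
    have "x \<noteq> c (p + 1)" "y \<noteq> c (p + 3)" "z \<noteq> c (p + 5)" using no(2,4,6) E by (auto simp: mem_nbh)
    then have e: "(x, c (p + 1)) \<in> E" "(y, c (p + 3)) \<in> E" "(z, c (p + 5)) \<in> E"
      using xin[of "p + 1"] yin[of "p + 3"] zin[of "p + 5"] sym_E by (auto simp: mem_nbh)
    have no': "(c (p + 1), z) \<notin> E" "(c (p + 1), y) \<notin> E" "(c (p + 5), x) \<notin> E" "(c (p + 5), y) \<notin> E"
      "(c (p + 3), x) \<notin> E" "(c (p + 3), z) \<notin> E" "c (p + 1) \<noteq> z" "c (p + 1) \<noteq> y" "c (p + 5) \<noteq> x"
      "c (p + 5) \<noteq> y" "c (p + 3) \<noteq> x" "c (p + 3) \<noteq> z"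
      using no by (auto simp: mem_nbh)
    note ap = c_apart[of "p + 1" "p + 3"] c_apart[of "p + 1" "p + 5"] c_apart[of "p + 3" "p + 5"]
    show False
      by (rule net[OF e(1) sym_E[OF E(3)] E(1) sym_E[OF E(2)] e(3) e(2)]) (use no' ap 2 in auto)
  qed
qed

text \<open>A closed walk whose lift to the cyclic cover does not close.\<close>

definition winding_walk :: "nat \<Rightarrow> (nat \<Rightarrow> 'a) \<Rightarrow> (nat \<Rightarrow> int) \<Rightarrow> bool" where
  "winding_walk m w k \<longleftrightarrow> (\<forall>i<m. near (w i) (k i) (w (Suc i)) (k (Suc i))) \<and> w m = w 0 \<and> k m \<noteq> k 0"

text \<open>A repeated vertex or a chord splits a winding walk into two shorter closed walks, one of
  which winds. So a minimal one is an induced cycle, and no shorter than the spine. Lengths up to 3,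
  where it would be no \<open>induced_cycle\<close>, are excluded separately.\<close>

lemma winding_walk_long:
  assumes "winding_walk m w k"
  shows "n \<le> m"
  using assms
proof (induction m arbitrary: w k rule: less_induct)
  case (less m)
  note W = less.prems[unfolded winding_walk_def]
  have st: "near (w i) (k i) (w (Suc i)) (k (Suc i))" if "i < m" for i using W that by blast
  have wm: "w m = w 0" and km: "k m \<noteq> k 0" using W by auto
  have sub: "n \<le> m" if "winding_walk m' w' k'" "m' < m" for m' w' k'
    using less.IH[OF that(2,1)] that(2) by simp
  show ?case
  proof (rule ccontr)
    assume nm: "\<not> n \<le> m"
    have short: "\<not> winding_walk m' w' k'" if "m' < m" for m' w' k'
      using sub that nm by blast
    have m0: "m \<noteq> 0" using km by (metis)
    have m1: "m \<noteq> 1" using st[of 0] wm irrefl_E by (auto simp: near_def)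
    have m2: "m \<noteq> 2"
    proof
      assume "m = 2"
      then have "near (w 0) (k 0) (w 1) (k 1)" "near (w 1) (k 1) (w 0) (k 2)"
        using st[of 0] st[of 1] wm by (auto simp: numeral_2_eq_2)
      then have "k 0 = k 2" using near_unique near_sym by blast
      then show False using km \<open>m = 2\<close> by simp
    qed
    have m3: "m \<noteq> 3"
    proof
      assume "m = 3"
      then have nn: "near (w 0) (k 0) (w 1) (k 1)" "near (w 1) (k 1) (w 2) (k 2)" "near (w 2) (k 2) (w 0) (k 3)"
        using st[of 0] st[of 1] st[of 2] wm by (auto simp: numeral_eq_Suc)
      have "k 0 < k 3 \<or> k 3 < k 0" using km \<open>m = 3\<close> by auto
      then show False
        using no_winding_triangle[OF nn] no_winding_triangle[OF near_sym[OF nn(3)] near_sym[OF nn(2)] near_sym[OF nn(1)]]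
        by blast
    qed
    have m4: "4 \<le> m" using m0 m1 m2 m3 by linarith
    have inE: "(w i, w (Suc i)) \<in> E" if "i < m" for i using st[OF that] by (simp add: near_def)
    have neq: "w i \<noteq> w j" if ij: "i < j" "j < m" for i j
    proof
      assume eq: "w i = w j"
      show False
      \<comment> \<open>If the part between \<open>i\<close> and \<open>j\<close> does not wind, it
        is cut out; otherwise it is itself a shorter winding walk.\<close>
      proof (cases "k i = k j")
        case True
        define w' where "w' t = (if t \<le> i then w t else w (t + (j - i)))" for t
        define k' where "k' t = (if t \<le> i then k t else k (t + (j - i)))" for t
        have "near (w' t) (k' t) (w' (Suc t)) (k' (Suc t))" if t: "t < m - (j - i)" for t
        proof -
          consider "t < i" | "t = i" | "i < t" by linarith
          then show ?thesis
          proof cases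
            case 1 then show ?thesis using st[of t] ij by (simp add: w'_def k'_def)
          next
            case 2 then show ?thesis using st[of j] ij eq True by (simp add: w'_def k'_def)
          next
            case 3 then show ?thesis using st[of "t + (j - i)"] ij t by (simp add: w'_def k'_def)
          qed
        qed
        then have "winding_walk (m - (j - i)) w' k'"
          using wm km ij unfolding winding_walk_def by (auto simp: w'_def k'_def)
        then show False using short[of "m - (j - i)"] ij by simp
      next
        case False
        have "winding_walk (j - i) (\<lambda>t. w (i + t)) (\<lambda>t. k (i + t))"
          using st ij eq False unfolding winding_walk_def by auto
        then show False using short[of "j - i"] ij by simp
      qed
    qed
    have chord: "j = Suc i \<or> (i = 0 \<and> Suc j = m)" if ij: "i < j" "j < m" and e: "(w i, w j) \<in> E" for i j
    proof (rule ccontr)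
      assume no: "\<not> ?thesis"
      obtain \<kappa> where \<kappa>: "near (w i) (k i) (w j) \<kappa>" using near_exists[OF e] by blast
      show False
      \<comment> \<open>If the lifted chord ends at the same lift as the walk, it is a shortcut that
        keeps the winding; otherwise the part between \<open>i\<close> and \<open>j\<close>, closed
        by the chord, winds.\<close>
      proof (cases "\<kappa> = k j")
        case True
        define d where "d = j - i - 1"
        have d: "0 < d" "i + 1 + d = j" using no ij by (auto simp: d_def)
        define w' where "w' t = (if t \<le> i then w t else w (t + d))" for t
        define k' where "k' t = (if t \<le> i then k t else k (t + d))" for t
        have "near (w' t) (k' t) (w' (Suc t)) (k' (Suc t))" if t: "t < m - d" for t
        proof -
          consider "t < i" | "t = i" | "i < t" by linarith
          then show ?thesis
          proof cases
            case 1 then show ?thesis using st[of t] ij by (simp add: w'_def k'_def)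
          next
            case 2 then show ?thesis using \<kappa> d True by (auto simp: w'_def k'_def)
          next
            case 3 then show ?thesis using st[of "t + d"] t by (simp add: w'_def k'_def)
          qed
        qed
        moreover have "i < m - d" using d ij by linarith
        moreover have "m - d + d = m" using d ij by linarith
        ultimately have "winding_walk (m - d) w' k'"
          using wm km ij unfolding winding_walk_def by (auto simp: w'_def k'_def)
        then show False using short[of "m - d"] d ij by simp
      next
        case False
        define g where "g = j - i"
        have g: "i + g = j" "0 < g" "Suc g < m" using ij no by (auto simp: g_def)
        define w' where "w' t = (if t \<le> g then w (i + t) else w i)" for t
        \<comment> \<open>The chord is traversed backwards from \<open>w j\<close>, so its lift is
          moved by \<open>k j - \<kappa>\<close> to start at \<open>k j\<close>.\<close>
        define k' where "k' t = (if t \<le> g then k (i + t) else k i + (k j - \<kappa>))" for t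
        have "near (w' t) (k' t) (w' (Suc t)) (k' (Suc t))" if t: "t < Suc g" for t
        proof (cases "t = g")
          case True
          have "near (w j) (\<kappa> + (k j - \<kappa>)) (w i) (k i + (k j - \<kappa>))"
            using near_shift[OF near_sym[OF \<kappa>]] .
          then show ?thesis using True g by (simp add: w'_def k'_def)
        next
          case False
          then show ?thesis using st[of "i + t"] t g ij by (simp add: w'_def k'_def)
        qed
        then have "winding_walk (Suc g) w' k'"
          using False unfolding winding_walk_def by (auto simp: w'_def k'_def)
        then show False using short[of "Suc g"] g by simp
      qed
    qed
    have wrap: "(w 0, w (m - 1)) \<in> E"
      using inE[of "m - 1"] m4 wm sym_E by simp
    have "induced_cycle m w"
      unfolding induced_cycle_def
    proof (intro conjI allI impI)
      show "4 \<le> m" by (rule m4)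
      show "w i \<in> V" if "i < m" for i using inE[OF that] E_in_V by blast
      fix i j assume ij: "i < j" "j < m"
      show "w i \<noteq> w j" by (rule neq[OF ij])
      show "((w i, w j) \<in> E) = (j = Suc i \<or> i = 0 \<and> Suc j = m)"
      proof
        assume "(w i, w j) \<in> E" then show "j = Suc i \<or> i = 0 \<and> Suc j = m" by (rule chord[OF ij])
      next
        assume "j = Suc i \<or> i = 0 \<and> Suc j = m"
        then consider "j = Suc i" | "i = 0" "j = m - 1" by auto
        then show "(w i, w j) \<in> E" using inE[of i] ij wrap by cases auto
      qed
    qed
    then show False using shortest nm by blast
  qed
qed

text \<open>If the arcs of \<open>X\<close> covered every edge, one could travel greedily from the
  right end of an arc to an arc of \<open>X\<close> containing the next edge. Right ends increase
  strictly, so among \<open>card X + 1\<close> arcs a vertex repeats in another turn, and the walk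
  in between winds in at most \<open>r < n\<close> steps.\<close>

lemma acyclic_cycle_model:
  assumes W: "0 < W" and cm: "circular_model V E (M * W) a b"
    and ab: "\<And>x. x \<in> V \<Longrightarrow> st x * W \<le> a x \<and> b x < (en x + 1) * W"
  shows "acyclic_model r V (M * W) a b"
  unfolding acyclic_model_def
proof (intro allI impI, rule ccontr)
  fix X assume X: "X \<subseteq> V" "card X \<le> r"
  assume cov: "\<nexists>q. \<forall>x\<in>X. \<forall>k. \<not> (a x + k * (M * W) \<le> q \<and> q < b x + k * (M * W))"
  define N where "N = M * W"
  have N0: "0 < N" using W M5 by (simp add: N_def)
  have cov': "\<exists>x\<in>X. \<exists>k. a x + k * N \<le> q \<and> q < b x + k * N" for q using cov N_def by blast
  have finX: "finite X" using X finite_V finite_subset by blast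
  define R where "R s s' \<longleftrightarrow> a (fst s') + snd s' * N \<le> b (fst s) + snd s * N \<and>
      b (fst s) + snd s * N < b (fst s') + snd s' * N" for s s' :: "'a \<times> int"
  have "\<exists>s. \<forall>i. fst (s i) \<in> X \<and> R (s i) (s (Suc i))"
  proof -
    have "\<exists>s. fst s \<in> X" using cov'[of 0] by (metis fst_conv)
    moreover have "\<exists>s'. fst s' \<in> X \<and> R s s'" for s
      using cov'[of "b (fst s) + snd s * N"] unfolding R_def by (metis fst_conv snd_conv)
    ultimately show ?thesis
      using dependent_nat_choice[of "\<lambda>_ s. fst s \<in> X" "\<lambda>_ s s'. R s s'"] by blast
  qed
  then obtain s where sX: "\<And>i. fst (s i) \<in> X" and sR: "\<And>i. R (s i) (s (Suc i))" by blast
  define w where "w i = fst (s i)" for i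
  define k where "k i = snd (s i)" for i
  have wV: "w i \<in> V" for i using sX X by (auto simp: w_def)
  have r1: "a (w (Suc i)) + k (Suc i) * N \<le> b (w i) + k i * N"
    and r2: "b (w i) + k i * N < b (w (Suc i)) + k (Suc i) * N" for i
    using sR[of i] by (auto simp: R_def w_def k_def)
  have ord: "a x \<le> b x" "b x < a x + N" if "x \<in> V" for x
    using cm that by (auto simp: circular_model_def N_def)
  have nr: "near (w i) (k i) (w (Suc i)) (k (Suc i))" for i
  proof -
    define x y where "x = w i" and "y = w (Suc i)"
    define p q where "p = k i" and "q = k (Suc i)"
    have V: "x \<in> V" "y \<in> V" using wV by (auto simp: x_def y_def)
    have h1: "a y + q * N \<le> b x + p * N" and h2: "b x + p * N < b y + q * N"
      using r1[of i] r2[of i] by (auto simp: x_def y_def p_def q_def)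
    have h3: "a x + p * N \<le> b y + q * N" using ord[OF V(1)] h2 by linarith
    \<comment> \<open>An arc is shorter than a turn, so its own translate cannot follow it.\<close>
    have "x \<noteq> y"
    proof
      assume "x = y"
      then have "p * N < q * N" using h2 by simp
      then have "p < q" using N0 by (simp add: mult_less_cancel_right)
      then have "(p + 1) * N \<le> q * N" using N0 by (intro mult_right_mono) auto
      then show False using h1 \<open>x = y\<close> ord[OF V(1)] by (simp add: algebra_simps)
    qed
    moreover have "a x \<le> b y + (q - p) * N \<and> a y + (q - p) * N \<le> b x"
      using h1 h3 by (simp add: algebra_simps)
    ultimately have "(x, y) \<in> E" using cm V unfolding circular_model_def N_def by blast
    \<comment> \<open>Dividing positions by \<open>W\<close> returns from arcs to spine
      indices.\<close>
    moreover have "st u + t * M \<le> en v + t' * M"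
      if "u \<in> V" "v \<in> V" "a u + t * N \<le> b v + t' * N" for u v t t'
    proof -
      have "st u * W + t * N < (en v + 1) * W + t' * N" using ab[OF that(1)] ab[OF that(2)] that(3) by linarith
      then have "(st u + t * M) * W < (en v + 1 + t' * M) * W" by (simp add: N_def algebra_simps)
      then have "st u + t * M < en v + 1 + t' * M" using W by (simp add: mult_less_cancel_right)
      then show ?thesis by linarith
    qed
    ultimately show ?thesis using h1 h3 V unfolding near_def x_def[symmetric] y_def[symmetric] p_def[symmetric] q_def[symmetric]
      by blast
  qed
  have "\<not> inj_on w {..card X}"
  proof
    assume "inj_on w {..card X}"
    moreover have "w ` {..card X} \<subseteq> X" using sX by (auto simp: w_def)
    ultimately have "card {..card X} \<le> card X" using card_inj_on_le finX by blast
    then show False by simp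
  qed
  then obtain i j where ij: "i < j" "j \<le> card X" "w i = w j"
    by (metis (no_types, lifting) linorder_inj_onI atMost_iff nat_le_linear)
  have mono: "b (w i) + k i * N < b (w (i + Suc d)) + k (i + Suc d) * N" for d
  proof (induction d)
    case 0 then show ?case using r2[of i] by simp
  next
    case (Suc d) then show ?case using r2[of "i + Suc d"] by simp
  qed
  have "b (w i) + k i * N < b (w j) + k j * N" using mono[of "j - i - 1"] ij by simp
  then have "k i \<noteq> k j" using ij by auto
  then have "winding_walk (j - i) (\<lambda>t. w (i + t)) (\<lambda>t. k (i + t))"
    using nr ij unfolding winding_walk_def by auto
  then have "n \<le> j - i" by (rule winding_walk_long)
  then show False using ij X n_gt_r by linarith
qed

end

context locally_interval_graph
begin

theorem acyclic_circular_model: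
  "\<exists>N a b. 3 \<le> N \<and> circular_model V E N a b \<and> acyclic_model r V N a b"
proof (cases "\<exists>m f. induced_cycle m f")
  case False
  then interpret locally_interval_chordal V E r by unfold_locales blast
  obtain N a b q where "3 \<le> N" "circular_model V E N a b"
    "\<forall>x\<in>V. \<forall>k. \<not> (a x + k * N \<le> q \<and> q < b x + k * N)"
    using chordal_model by blast
  then show ?thesis unfolding acyclic_model_def by (meson subsetD)
next
  case True
  define n where "n = (LEAST m. \<exists>f. induced_cycle m f)"
  obtain f where f: "induced_cycle n f" using LeastI_ex[OF True] unfolding n_def by blast
  interpret locally_interval_cycle V E r n f
    by unfold_locales (use f in \<open>auto simp: n_def intro: Least_le\<close>)
  obtain a b W where W: "0 < W" "circular_model V E (M * W) a b"
    "\<And>x. x \<in> V \<Longrightarrow> st x * W \<le> a x \<and> b x < (en x + 1) * W"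
    using cycle_model by blast
  have "M * 1 \<le> M * W" using W M5 by (intro mult_left_mono) auto
  then have "3 \<le> M * W" using M5 by linarith
  then show ?thesis using acyclic_cycle_model[OF W] W(2) by blast
qed

end

section \<open>Unrolling an acyclic circular model\<close>

lemma relpow_sym:
  assumes "sym R" "(x, y) \<in> R ^^ m"
  shows "(y, x) \<in> R ^^ m"
  using assms(2)
proof (induction m arbitrary: y)
  case 0 then show ?case by simp
next
  case (Suc m)
  then obtain z where "(x, z) \<in> R ^^ m" "(z, y) \<in> R" by auto
  then have "(y, z) \<in> R" "(z, x) \<in> R ^^ m" using Suc.IH assms(1) by (auto dest: symD)
  then show ?case by (rule relpow_Suc_I2)
qed

text \<open>After scaling by \<open>W\<close>, offsets below \<open>W\<close> can break ties without
  affecting comparisons of the original endpoints.\<close>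

lemma scaled_le_iff:
  fixes W p q s :: int
  assumes "0 \<le> s" "s < W"
  shows "W * p \<le> W * q + s \<longleftrightarrow> p \<le> q"
proof
  assume h: "W * p \<le> W * q + s"
  show "p \<le> q"
  proof (rule ccontr)
    assume "\<not> p \<le> q"
    then have "W * (q + 1) \<le> W * p" using assms by (intro mult_left_mono) auto
    then show False using h assms by (simp add: algebra_simps)
  qed
next
  assume "p \<le> q"
  then have "W * p \<le> W * q" using assms by (intro mult_left_mono) auto
  then show "W * p \<le> W * q + s" using assms by linarith
qed

locale arc_model = simple_graph +
  fixes r :: nat and N :: int and a b :: "'a \<Rightarrow> int"
  assumes r4: "4 \<le> r" and N0: "0 < N"
    and model: "circular_model V E N a b" and acyclic: "acyclic_model r V N a b"
begin

text \<open>Adjacency in the cyclic cover of the model: \<open>(x, k)\<close> is the arc of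
  \<open>x\<close> moved by \<open>k\<close> turns.\<close>

definition lift :: "(('a \<times> int) \<times> ('a \<times> int)) set" where
  "lift = {((x, k), (y, k')). (x, y) \<in> E \<and> a x + k * N \<le> b y + k' * N \<and> a y + k' * N \<le> b x + k * N}"

lemma lift_sym: "sym lift"
  using sym_E by (auto simp: sym_def lift_def)

lemma lift_shift:
  assumes "((x, k), (y, k')) \<in> lift ^^ m"
  shows "((x, k + d), (y, k' + d)) \<in> lift ^^ m"
  using assms
proof (induction m arbitrary: y k')
  case 0 then show ?case by simp
next
  case (Suc m)
  then obtain z k'' where z: "((x, k), (z, k'')) \<in> lift ^^ m" "((z, k''), (y, k')) \<in> lift" by auto
  have "((z, k'' + d), (y, k' + d)) \<in> lift" using z(2) by (simp add: lift_def algebra_simps)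
  then show ?case using Suc.IH[OF z(1)] by auto
qed

lemma ab: "x \<in> V \<Longrightarrow> a x \<le> b x" "x \<in> V \<Longrightarrow> b x < a x + N"
  using model by (auto simp: circular_model_def)

lemma adj_iff: "x \<in> V \<Longrightarrow> y \<in> V \<Longrightarrow> x \<noteq> y \<Longrightarrow>
    (x, y) \<in> E \<longleftrightarrow> (\<exists>k. a x \<le> b y + k * N \<and> a y + k * N \<le> b x)"
  using model by (auto simp: circular_model_def)

lemma lift_exists:
  assumes "(x, y) \<in> E"
  shows "\<exists>k'. ((x, k), (y, k')) \<in> lift"
proof -
  have "x \<noteq> y" using assms irrefl_E by auto
  then obtain t where "a x \<le> b y + t * N" "a y + t * N \<le> b x"
    using adj_iff[of x y] assms E_in_V[OF assms] by blast
  then have "((x, k), (y, k + t)) \<in> lift" using assms by (simp add: lift_def algebra_simps)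
  then show ?thesis by blast
qed

lemma uncovered:
  assumes "X \<subseteq> V" "card X \<le> r"
  shows "\<exists>q. \<forall>x\<in>X. \<forall>k. \<not> (a x + k * N \<le> q \<and> q < b x + k * N)"
  using acyclic assms unfolding acyclic_model_def by simp

text \<open>The walk visits at most \<open>r\<close> vertices, so some edge of the circle is avoided
  by all their arcs. Consecutive lifts meet, so the walk cannot get past a lift of that edge, while
  reaching \<open>k'\<close> would take a full turn.\<close>

lemma lift_closed_less:
  assumes w: "((x, k), (x, k')) \<in> lift ^^ m" and m: "m \<le> r" and k: "k < k'"
  shows False
proof -
  obtain f where f: "f 0 = (x, k)" "f m = (x, k')" "\<And>i. i < m \<Longrightarrow> (f i, f (Suc i)) \<in> lift"
    using w[unfolded relpow_fun_conv] by blast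
  define w where "w i = fst (f i)" for i
  define t where "t i = snd (f i)" for i
  have ends: "w 0 = x" "w m = x" "t 0 = k" "t m = k'" using f by (auto simp: w_def t_def)
  have m0: "m \<noteq> 0" using ends k by (metis less_irrefl)
  have l: "(w i, w (Suc i)) \<in> E" "a (w (Suc i)) + t (Suc i) * N \<le> b (w i) + t i * N" if "i < m" for i
    using f(3)[OF that] by (auto simp: lift_def w_def t_def split: prod.splits)
  define X where "X = w ` {..<m}"
  have "X \<subseteq> V" using l(1) E_in_V by (auto simp: X_def)
  moreover have "card X \<le> r" using card_image_le[of "{..<m}" w] m by (simp add: X_def)
  ultimately obtain q0 where q0': "\<forall>y\<in>X. \<forall>j. \<not> (a y + j * N \<le> q0 \<and> q0 < b y + j * N)"
    using uncovered[of X] by auto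
  have q0: "\<not> (a y + j * N \<le> q0 \<and> q0 < b y + j * N)" if "y \<in> X" for y j
    using bspec[OF q0' that] by (rule spec)
  have inX: "w i \<in> X" if "i \<le> m" for i
    using that m0 ends by (cases "i = m") (auto simp: X_def intro: rev_image_eqI[of 0])
  \<comment> \<open>The free edge is moved by whole turns into the first turn after the start
    \<open>p\<close> of the walk.\<close>
  define p where "p = a x + k * N"
  define d where "d = (q0 - p) div N"
  define q where "q = q0 - d * N"
  have "q = p + (q0 - p) mod N" using div_mult_mod_eq[of "q0 - p" N] unfolding q_def d_def by linarith
  then have pq: "p \<le> q" "q < p + N" using N0 by auto
  have free: "b y + j * N \<le> q" if "y \<in> X" "a y + j * N \<le> q" for y j
    using q0[OF that(1), of "j + d"] that(2) by (simp add: q_def algebra_simps)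
  have below: "b (w i) + t i * N \<le> q" if "i \<le> m" for i
    using that
  proof (induction i)
    case 0 then show ?case using free[OF inX[of 0]] pq ends by (simp add: p_def)
  next
    case (Suc i)
    then show ?case using free[OF inX[of "Suc i"]] l(2)[of i] by fastforce
  qed
  have "b x + k' * N \<le> q" using below[of m] ends by simp
  moreover have "(k + 1) * N \<le> k' * N" using k N0 by (intro mult_right_mono) auto
  moreover have "x \<in> V" using l(1)[of 0] m0 ends E_in_V by auto
  ultimately show False using pq ab(1)[of x] by (simp add: p_def algebra_simps)
qed

lemma lift_closed:
  assumes "((x, k), (x, k')) \<in> lift ^^ m" "m \<le> r"
  shows "k = k'"
  using lift_closed_less[OF assms] lift_closed_less[OF relpow_sym[OF lift_sym assms(1)] assms(2)]
  by (cases k k' rule: linorder_cases) auto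

text \<open>The two walks, the second one reversed and shifted, combine to a closed walk of length
  \<open>d + d'\<close>.\<close>

lemma lift_unique:
  assumes "((v, j), (x, k)) \<in> lift ^^ d" "((v, j), (x, k')) \<in> lift ^^ d'" "d + d' \<le> r"
  shows "k = k'"
proof -
  have "((x, k'), (v, j)) \<in> lift ^^ d'" by (rule relpow_sym[OF lift_sym assms(2)])
  then have "((x, k), (v, j + (k - k'))) \<in> lift ^^ d'" using lift_shift[of x k' v j d' "k - k'"] by simp
  then have "((v, j), (v, j + (k - k'))) \<in> lift ^^ (d + d')"
    using assms(1) by (auto simp: relpow_add)
  then show ?thesis using lift_closed assms(3) by fastforce
qed

lemma walk_lift:
  assumes "(v, x) \<in> E ^^ d"
  shows "\<exists>k. ((v, 0), (x, k)) \<in> lift ^^ d"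
  using assms
proof (induction d arbitrary: x)
  case 0 then show ?case by auto
next
  case (Suc d)
  then obtain y where "(v, y) \<in> E ^^ d" "(y, x) \<in> E" by auto
  then obtain k where "((v, 0), (y, k)) \<in> lift ^^ d" using Suc.IH by blast
  then show ?case using lift_exists[OF \<open>(y, x) \<in> E\<close>, of k] by auto
qed

text \<open>Lifts are taken along shortest walks. An edge of the ball gives a second walk of length
  \<open>d x + 1\<close> to its end \<open>y\<close>, and \<open>d x + 1 + d y \<le> r\<close> is
  just what \<open>lift_unique\<close> needs. For odd \<open>r\<close> no vertex is
  \<open>far\<close> and the lifts themselves form the model.\<close>

theorem ball_interval_model:
  assumes vV: "v \<in> V"
  shows "\<exists>l u. interval_model (ball_verts v r) (ball_arcs v r) l u"
proof -
  define d where "d x = (LEAST k. (v, x) \<in> E ^^ k)" for x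
  define h where "h = r div 2"
  define B where "B = ball_verts v r"
  have d_le: "d x \<le> k" if "(v, x) \<in> E ^^ k" for x k
    unfolding d_def using that by (rule Least_le)
  have inB: "x \<in> V" "(v, x) \<in> E ^^ d x" "d x \<le> h" if xB: "x \<in> B" for x
  proof -
    obtain k where k: "x \<in> V" "k \<le> h" "(v, x) \<in> E ^^ k"
      using xB unfolding B_def ball_verts_def h_def by blast
    show "x \<in> V" "d x \<le> h" using k d_le[OF k(3)] by auto
    show "(v, x) \<in> E ^^ d x" unfolding d_def using k(3) by (rule LeastI)
  qed
  have B_I: "x \<in> B" if "x \<in> V" "(v, x) \<in> E ^^ k" "k \<le> h" for x k
    using that by (auto simp: B_def ball_verts_def h_def)
  have arcs: "(x, y) \<in> ball_arcs v r \<longleftrightarrow> (x, y) \<in> E \<and> d x + d y < r" if "x \<in> B" "y \<in> B" for x y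
  proof
    assume "(x, y) \<in> ball_arcs v r"
    then obtain k m where km: "(x, y) \<in> E" "k + m < r" "(v, x) \<in> E ^^ k" "(v, y) \<in> E ^^ m"
      by (auto simp: ball_arcs_def)
    then show "(x, y) \<in> E \<and> d x + d y < r" using d_le[OF km(3)] d_le[OF km(4)] by simp
  next
    assume "(x, y) \<in> E \<and> d x + d y < r"
    then show "(x, y) \<in> ball_arcs v r" using ball_arcsI inB(2)[OF that(1)] inB(2)[OF that(2)] by blast
  qed
  have d_step: "d y \<le> d x + 1" if "x \<in> B" "(x, y) \<in> E" for x y
    using d_le[of y "Suc (d x)"] inB(2)[OF that(1)] that(2) by auto
  have pred: "\<exists>z\<in>B. (z, y) \<in> E \<and> d z = j" if y: "y \<in> B" "d y = Suc j" for y j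
  proof -
    obtain z where z: "(v, z) \<in> E ^^ j" "(z, y) \<in> E" using inB(2)[OF y(1)] y(2) by auto
    have "z \<in> B" using B_I[of z j] z E_in_V[OF z(2)] inB(3)[OF y(1)] y(2) by simp
    moreover have "d z = j" using d_le[OF z(1)] d_step[OF \<open>z \<in> B\<close> z(2)] y(2) by linarith
    ultimately show ?thesis using z by blast
  qed
  define \<kappa> where "\<kappa> x = (SOME k. ((v, 0), (x, k)) \<in> lift ^^ d x)" for x
  have \<kappa>: "((v, 0), (x, \<kappa> x)) \<in> lift ^^ d x" if "x \<in> B" for x
    unfolding \<kappa>_def using walk_lift[OF inB(2)[OF that]] by (rule someI_ex)
  define L where "L x = a x + \<kappa> x * N" for x
  define U where "U x = b x + \<kappa> x * N" for x
  have LU: "L x \<le> U x" if "x \<in> B" for x using ab(1) inB(1)[OF that] by (simp add: L_def U_def)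
  have disj: "(x, y) \<in> E" if xy: "x \<in> B" "y \<in> B" "x \<noteq> y" and o: "L x \<le> U y" "L y \<le> U x" for x y
    using adj_iff[OF inB(1)[OF xy(1)] inB(1)[OF xy(2)] xy(3)] o
    by (auto simp: L_def U_def algebra_simps intro!: exI[of _ "\<kappa> y - \<kappa> x"])
  have ovl: "L x \<le> U y \<and> L y \<le> U x" if xy: "x \<in> B" "y \<in> B" "(x, y) \<in> E" "d x + d y < r" for x y
  proof -
    obtain k where k: "((x, \<kappa> x), (y, k)) \<in> lift" using lift_exists[OF xy(3)] by blast
    then have "((v, 0), (y, k)) \<in> lift ^^ Suc (d x)" using \<kappa>[OF xy(1)] by auto
    from lift_unique[OF this \<kappa>[OF xy(2)]] have "k = \<kappa> y" using xy(4) by simp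
    then show ?thesis using k by (simp add: lift_def L_def U_def)
  qed
  have vB: "v \<in> B" and dv: "d v = 0" using B_I[of v 0] d_le[of v 0] vV by auto
  define far where "far x \<longleftrightarrow> 2 * d x = r" for x
  have near: "d x + d y < r" if "x \<in> B" "y \<in> B" "\<not> far x \<or> \<not> far y" for x y
    using inB(3)[OF that(1)] inB(3)[OF that(2)] that(3) by (auto simp: far_def h_def)
  have far_d: "d x = h" "2 * h = r" "2 \<le> h" if "far x" for x using that r4 by (auto simp: far_def h_def)
  have apart: "U y < L x \<or> U x < L y" if x: "x \<in> B" "far x" and y: "y \<in> B" "d y + 2 \<le> h" for x y
  proof -
    have "x \<noteq> y" using far_d[OF x(2)] y by auto
    moreover have "(x, y) \<notin> E" using d_step[OF y(1), of x] far_d[OF x(2)] y(2) sym_E by fastforce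
    ultimately show ?thesis using disj[OF x(1) y(1)] by fastforce
  qed
  \<comment> \<open>Vertices at distance at most \<open>h - 2\<close> are not adjacent to
    \<open>x\<close>, which has distance \<open>h\<close>. Moving outwards from \<open>v\<close>
    through meeting intervals therefore never crosses \<open>x\<close>.\<close>
  have sides: "if U v < L x then U y < L x else U x < L y"
    if x: "x \<in> B" "far x" and y: "y \<in> B" "d y + 2 \<le> h" for x y
    using y
  proof (induction "d y" arbitrary: y)
    case 0
    then have "y = v" using inB(2)[OF 0(2)] by simp
    then show ?case using x apart[OF x vB] dv far_d[OF x(2)] by auto
  next
    case (Suc j)
    obtain z where z: "z \<in> B" "(z, y) \<in> E" "d z = j" using pred[OF Suc(3)] Suc(2) by metis
    have "if U v < L x then U z < L x else U x < L z" using Suc(1)[of z] z Suc by simp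
    moreover have "L y \<le> U z" "L z \<le> U y"
      using ovl[OF z(1) Suc(3) z(2)] z(3) Suc(2,4) far_d[OF x(2)] by simp_all
    ultimately show ?case using apart[OF x Suc(3,4)] LU[OF x(1)] by (auto split: if_splits)
  qed
  have right: "U y < L x" if "x \<in> B" "far x" "U v < L x" "y \<in> B" "d y + 2 \<le> h" for x y
    using sides[OF that(1,2,4,5)] that(3) by simp
  have left: "U x < L y" if "x \<in> B" "far x" "\<not> U v < L x" "y \<in> B" "d y + 2 \<le> h" for x y
    using sides[OF that(1,2,4,5)] that(3) by simp
  define pt where "pt x = (if U v < L x then L x else U x)" for x
  have pt: "(x, y) \<in> E \<longleftrightarrow> L y \<le> pt x \<and> pt x \<le> U y"
    if x: "x \<in> B" "far x" and y: "y \<in> B" "\<not> far y" for x y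
  proof -
    have xy: "x \<noteq> y" using x y by auto
    have dy: "d y + 1 \<le> h" using inB(3)[OF y(1)] y(2) far_d[OF x(2)] by (auto simp: far_def)
    have iff: "(x, y) \<in> E \<longleftrightarrow> L x \<le> U y \<and> L y \<le> U x"
      using disj[OF x(1) y(1) xy] ovl[OF x(1) y(1)] near[OF x(1) y(1)] y(2) by blast
    show ?thesis
    proof (cases "d y + 2 \<le> h")
      case True
      then show ?thesis
        using iff right[OF x _ y(1) True] left[OF x _ y(1) True] LU[OF x(1)] LU[OF y(1)]
        by (auto simp: pt_def)
    next
      case False
      \<comment> \<open>At distance \<open>h - 1\<close>, \<open>y\<close> meets some
        \<open>z\<close> at distance \<open>h - 2\<close>, which lies on the side of
        \<open>v\<close>. If \<open>y\<close> also meets \<open>x\<close>, it contains the end of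
        \<open>x\<close> facing \<open>v\<close>, so shrinking \<open>x\<close> to that end keeps
        the edge. The bound \<open>2 \<le> h\<close> comes from \<open>4 \<le> r\<close>.\<close>
      then have "d y = Suc (h - 2)" using dy far_d[OF x(2)] by linarith
      then obtain z where z: "z \<in> B" "(z, y) \<in> E" "d z = h - 2" using pred[OF y(1)] by metis
      have dz: "d z + 2 \<le> h" using z(3) far_d[OF x(2)] by simp
      have o: "L z \<le> U y" "L y \<le> U z"
        using ovl[OF z(1) y(1) z(2)] near[OF z(1) y(1)] y(2) by auto
      show ?thesis
        using iff right[OF x _ z(1) dz] left[OF x _ z(1) dz] o LU[OF x(1)]
        by (auto simp: pt_def)
    qed
  qed
  \<comment> \<open>Several far vertices may share the same end; numbering the vertices separates
    their points.\<close>
  obtain \<phi> :: "'a \<Rightarrow> nat" where \<phi>: "inj_on \<phi> V" "\<phi> ` V = {0..<card V}"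
    using ex_bij_betw_finite_nat[OF finite_V] by (auto simp: bij_betw_def)
  define W where "W = int (card V)"
  have \<phi>W: "0 \<le> int (\<phi> x)" "int (\<phi> x) < W" if "x \<in> V" for x
  proof -
    have "\<phi> x \<in> {0..<card V}" using \<phi>(2) that by blast
    then show "0 \<le> int (\<phi> x)" "int (\<phi> x) < W" by (auto simp: W_def)
  qed
  have W0: "0 < W" using \<phi>W[OF vV] by linarith
  \<comment> \<open>The other intervals are lengthened by \<open>W - 1\<close>, so that they absorb
    every offset of a far point.\<close>
  define l where "l x = (if far x then W * pt x + int (\<phi> x) else W * L x)" for x
  define u where "u x = (if far x then W * pt x + int (\<phi> x) else W * U x + (W - 1))" for x
  have mix: "(x, y) \<in> E \<longleftrightarrow> l x \<le> u y \<and> l y \<le> u x"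
    if x: "x \<in> B" "far x" and y: "y \<in> B" "\<not> far y" for x y
  proof -
    have f: "0 \<le> int (\<phi> x)" "int (\<phi> x) < W" using \<phi>W[OF inB(1)[OF x(1)]] by auto
    have "l y \<le> u x \<longleftrightarrow> L y \<le> pt x"
      using scaled_le_iff[OF f, of "L y" "pt x"] x y by (simp add: l_def u_def)
    moreover have "l x \<le> u y \<longleftrightarrow> pt x \<le> U y"
    proof -
      have "l x \<le> u y \<longleftrightarrow> W * pt x \<le> W * U y + (W - 1 - int (\<phi> x))"
        using x y by (auto simp: l_def u_def)
      also have "\<dots> \<longleftrightarrow> pt x \<le> U y" using f by (intro scaled_le_iff) auto
      finally show ?thesis .
    qed
    ultimately show ?thesis using pt[OF x y] by blast
  qed
  have "interval_model B (ball_arcs v r) l u"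
    unfolding interval_model_def
  proof (intro conjI ballI impI)
    show "l x \<le> u x" if "x \<in> B" for x
      using LU[OF that] W0 scaled_le_iff[of "W - 1" W "L x" "U x"] by (simp add: l_def u_def)
    fix x y assume xy: "x \<in> B" "y \<in> B" "x \<noteq> y"
    consider "far x" "far y" | "far x" "\<not> far y" | "\<not> far x" "far y" | "\<not> far x" "\<not> far y" by blast
    then show "(x, y) \<in> ball_arcs v r \<longleftrightarrow> l x \<le> u y \<and> l y \<le> u x"
    proof cases
      case 1
      have "(x, y) \<notin> ball_arcs v r" using arcs[OF xy(1,2)] 1 by (auto simp: far_def)
      moreover have "\<not> (l x \<le> u y \<and> l y \<le> u x)"
      proof
        assume "l x \<le> u y \<and> l y \<le> u x"
        then have eq: "W * pt x + int (\<phi> x) = W * pt y + int (\<phi> y)" using 1 by (simp add: l_def u_def)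
        then have "(W * pt x + int (\<phi> x)) mod W = (W * pt y + int (\<phi> y)) mod W" by simp
        then have "int (\<phi> x) mod W = int (\<phi> y) mod W" by simp
        then have "\<phi> x = \<phi> y" using \<phi>W[OF inB(1)[OF xy(1)]] \<phi>W[OF inB(1)[OF xy(2)]] by simp
        then show False using \<phi>(1) inB(1)[OF xy(1)] inB(1)[OF xy(2)] xy(3) by (auto dest: inj_onD)
      qed
      ultimately show ?thesis by blast
    next
      case 2
      then show ?thesis using arcs[OF xy(1,2)] near[OF xy(1,2)] mix[OF xy(1) _ xy(2)] by blast
    next
      case 3
      then show ?thesis using arcs[OF xy(1,2)] near[OF xy(1,2)] mix[OF xy(2) _ xy(1)] E_commute by blast
    next
      case 4
      have "l x \<le> u y \<longleftrightarrow> L x \<le> U y" "l y \<le> u x \<longleftrightarrow> L y \<le> U x"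
        using 4 W0 scaled_le_iff[of "W - 1" W] by (auto simp: l_def u_def)
      moreover have "(x, y) \<in> E \<longleftrightarrow> L x \<le> U y \<and> L y \<le> U x"
        using disj[OF xy] ovl[OF xy(1,2)] near[OF xy(1,2)] 4 by blast
      ultimately show ?thesis using arcs[OF xy(1,2)] near[OF xy(1,2)] 4 by blast
    qed
  qed
  then show ?thesis unfolding B_def by blast
qed

end

section \<open>Distances and balls\<close>

lemma pair_graph_simple_graph:
  assumes "pair_graph G"
  shows "simple_graph (pverts G) (parcs G)"
proof -
  interpret P: pair_graph G by (rule assms)
  show ?thesis
  proof
    show "finite (pverts G)" by (rule P.pair_finite_verts)
    show "\<And>x y. (x, y) \<in> parcs G \<Longrightarrow> x \<in> pverts G \<and> y \<in> pverts G" using P.wellformed' by blast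
    show "\<And>x y. (x, y) \<in> parcs G \<Longrightarrow> (y, x) \<in> parcs G" by (rule P.arcs_symmetric)
    show "\<And>x. (x, x) \<notin> parcs G" using P.pair_no_loops by fastforce
  qed
qed

lemma pair_graph_connected_simple_graph:
  assumes G: "pair_graph G" and c: "connected G"
  shows "connected_simple_graph (pverts G) (parcs G)"
proof -
  interpret pair_graph G by (rule G)
  interpret simple_graph "pverts G" "parcs G" by (rule pair_graph_simple_graph[OF G])
  have sym: "(y, x) \<in> parcs G" if "(x, y) \<in> parcs G" for x y using arcs_symmetric[OF that] .
  \<comment> \<open>\<open>connected\<close> refers to the symmetric closure, which adds nothing to
    a symmetric graph.\<close>
  have mk: "parcs (mk_symmetric G) = parcs G"
    using sym by (auto simp: parcs_mk_symmetric)
  have sc: "strongly_connected (mk_symmetric G)" using c by (simp add: connected_def)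
  have ne: "pverts G \<noteq> {}" using sc by (simp add: strongly_connected_def)
  have reach: "(u, v) \<in> (parcs G)\<^sup>*" if "u \<in> pverts G" "v \<in> pverts G" for u v
  proof -
    have "u \<rightarrow>\<^sup>*\<^bsub>with_proj (mk_symmetric G)\<^esub> v" using sc that by (simp add: strongly_connected_def)
    from reachable_rtranclI[OF this] show ?thesis by (simp add: mk)
  qed
  show ?thesis
  proof
    show "pverts G \<noteq> {}" by (rule ne)
    show "\<exists>x\<in>S. \<exists>y\<in>pverts G - S. (x, y) \<in> parcs G" if S: "S \<subseteq> pverts G" "S \<noteq> {}" "S \<noteq> pverts G" for S
    proof -
      obtain u w where u: "u \<in> S" and w: "w \<in> pverts G" "w \<notin> S" using S by blast
      have "(u, w) \<in> (parcs G)\<^sup>*" using reach u w S by blast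
      then have "w \<in> S \<or> (\<exists>x\<in>S. \<exists>y\<in>pverts G - S. (x, y) \<in> parcs G)"
      proof (induction rule: rtrancl_induct)
        case base then show ?case using u by simp
      next
        case (step y z)
        then show ?case using wellformed' by blast
      qed
      then show ?thesis using w by blast
    qed
  qed
qed

lemma awalk_length_iff:
  assumes "pair_wf_digraph G"
  shows "u \<in> pverts G \<Longrightarrow>
    (\<exists>p. pre_digraph.awalk (with_proj G) u p v \<and> length p = n) \<longleftrightarrow> (u, v) \<in> parcs G ^^ n"
proof (induction n arbitrary: u)
  interpret pair_wf_digraph G by (rule assms)
  case 0
  then show ?case by (auto simp: awalk_Nil_iff)
next
  interpret pair_wf_digraph G by (rule assms)
  case (Suc n)
  show ?case
  proof
    assume "\<exists>p. awalk u p v \<and> length p = Suc n"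
    then obtain p where p: "awalk u p v" "length p = Suc n" by blast
    then obtain e q where eq: "p = e # q" by (cases p) auto
    then have e: "e \<in> parcs G" "u = fst e" "awalk (snd e) q v" "length q = n"
      using p by (auto simp: awalk_Cons_iff)
    have "(snd e, v) \<in> parcs G ^^ n" using Suc.IH[of "snd e"] arc_snd_in_verts[OF e(1)] e by blast
    moreover have "(u, snd e) \<in> parcs G" using e by simp
    ultimately show "(u, v) \<in> parcs G ^^ Suc n" by (metis relpow_Suc_I2)
  next
    assume "(u, v) \<in> parcs G ^^ Suc n"
    then obtain z where z: "(u, z) \<in> parcs G" "(z, v) \<in> parcs G ^^ n" by (metis relpow_Suc_D2)
    then obtain q where "awalk z q v" "length q = n" using Suc.IH[of z] in_arcsD2 by blast
    then have "awalk u ((u, z) # q) v \<and> length ((u, z) # q) = Suc n" using z by (simp add: awalk_Cons_iff)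
    then show "\<exists>p. awalk u p v \<and> length p = Suc n" by blast
  qed
qed

lemma graph_dist_eq:
  assumes G: "pair_wf_digraph G" and u: "u \<in> pverts G"
  shows "graph_dist G u v = (INF n\<in>{n. (u, v) \<in> parcs G ^^ n}. ereal (real n))"
proof -
  interpret pair_wf_digraph G by (rule G)
  have cost: "awalk_cost (\<lambda>_. 1) p = real (length p)" for p :: "('a \<times> 'a) list"
    by (induction p) auto
  have len: "length ` {p. awalk u p v} = {n. (u, v) \<in> parcs G ^^ n}"
  proof (rule set_eqI)
    fix n
    have "n \<in> length ` {p. awalk u p v} \<longleftrightarrow> (\<exists>p. awalk u p v \<and> length p = n)" by blast
    then show "n \<in> length ` {p. awalk u p v} \<longleftrightarrow> n \<in> {n. (u, v) \<in> parcs G ^^ n}"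
      using awalk_length_iff[OF G u, of v n] by simp
  qed
  have "(\<lambda>n. ereal (real n)) ` {n. (u, v) \<in> parcs G ^^ n} =
      (\<lambda>p. ereal (awalk_cost (\<lambda>_. 1) p)) ` {p. awalk u p v}"
    by (simp add: image_image cost flip: len)
  then show ?thesis unfolding graph_dist_def \<mu>_def by simp
qed

text \<open>Walk lengths are natural numbers, so the infimum is attained unless there is no walk at
  all.\<close>

lemma graph_dist_cases:
  assumes G: "pair_wf_digraph G" and u: "u \<in> pverts G"
  obtains n where "(u, v) \<in> parcs G ^^ n" "graph_dist G u v = ereal (real n)"
      "\<And>m. (u, v) \<in> parcs G ^^ m \<Longrightarrow> n \<le> m"
    | "\<And>m. (u, v) \<notin> parcs G ^^ m" "graph_dist G u v = \<infinity>"
proof (cases "\<exists>n. (u, v) \<in> parcs G ^^ n")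
  case True
  define n where "n = (LEAST n. (u, v) \<in> parcs G ^^ n)"
  have n: "(u, v) \<in> parcs G ^^ n" unfolding n_def using True by (rule LeastI_ex)
  have least: "n \<le> m" if "(u, v) \<in> parcs G ^^ m" for m
    unfolding n_def using that by (rule Least_le)
  have "graph_dist G u v = ereal (real n)"
    unfolding graph_dist_eq[OF G u] by (rule INF_eqI) (use n least in auto)
  then show thesis using that(1) n least by blast
next
  case False
  then have "graph_dist G u v = \<infinity>" unfolding graph_dist_eq[OF G u] by (simp add: top_ereal_def)
  then show thesis using that(2) False by blast
qed

lemma graph_dist_le_iff:
  assumes "pair_wf_digraph G" "u \<in> pverts G"
  shows "graph_dist G u v \<le> ereal (real m) \<longleftrightarrow> (\<exists>k\<le>m. (u, v) \<in> parcs G ^^ k)"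
  by (rule graph_dist_cases[OF assms, of v]) (auto intro: order_trans)

lemma graph_dist_add_less_iff:
  assumes "pair_wf_digraph G" "u \<in> pverts G"
  shows "graph_dist G u v + graph_dist G u w < ereal (real r) \<longleftrightarrow>
    (\<exists>k m. k + m < r \<and> (u, v) \<in> parcs G ^^ k \<and> (u, w) \<in> parcs G ^^ m)"
proof (rule graph_dist_cases[OF assms, of v])
  fix n assume n: "(u, v) \<in> parcs G ^^ n" "graph_dist G u v = ereal (real n)"
    "\<And>m. (u, v) \<in> parcs G ^^ m \<Longrightarrow> n \<le> m"
  show ?thesis
  proof (rule graph_dist_cases[OF assms, of w])
    fix n' assume n': "(u, w) \<in> parcs G ^^ n'" "graph_dist G u w = ereal (real n')"
      "\<And>m. (u, w) \<in> parcs G ^^ m \<Longrightarrow> n' \<le> m"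
    have "graph_dist G u v + graph_dist G u w < ereal (real r) \<longleftrightarrow> n + n' < r"
      using n(2) n'(2) by (simp flip: of_nat_add)
    also have "\<dots> \<longleftrightarrow> (\<exists>k m. k + m < r \<and> (u, v) \<in> parcs G ^^ k \<and> (u, w) \<in> parcs G ^^ m)"
      using n(1,3) n'(1,3) by (meson add_mono le_less_trans)
    finally show ?thesis .
  qed (use n in auto)
qed auto

lemma half_ball_eq:
  assumes G: "pair_graph G" and v: "v \<in> pverts G"
  shows "pverts (half_ball G v r) = simple_graph.ball_verts (pverts G) (parcs G) v r"
    and "parcs (half_ball G v r) = simple_graph.ball_arcs (parcs G) v r"
proof -
  interpret P: pair_graph G by (rule G)
  interpret simple_graph "pverts G" "parcs G" by (rule pair_graph_simple_graph[OF G])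
  have W: "pair_wf_digraph G" ..
  show "pverts (half_ball G v r) = ball_verts v r"
    using graph_dist_le_iff[OF W v] by (auto simp: half_ball_def ball_verts_def)
  show "parcs (half_ball G v r) = ball_arcs v r"
    using graph_dist_add_less_iff[OF W v] by (auto simp: half_ball_def ball_arcs_def)
qed

section \<open>Paths and cycles as images of the integers\<close>

lemma symcl_iff: "(x, y) \<in> R\<^sup>s \<longleftrightarrow> (x, y) \<in> R \<or> (y, x) \<in> R"
  by (force simp: symcl_def)

lemma set_vwalk_arcs: "set (vwalk_arcs xs) = {(xs ! i, xs ! Suc i) | i. Suc i < length xs}"
proof (induction xs rule: vwalk_arcs.induct)
  case (3 x y xs)
  define F where "F i = ((x # y # xs) ! i, (x # y # xs) ! Suc i)" for i
  have "Suc i < length (x # y # xs) \<longleftrightarrow> i = 0 \<or> (\<exists>j. i = Suc j \<and> Suc j < length (y # xs))" for i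
    by (cases i) auto
  then have "{F i | i. Suc i < length (x # y # xs)} =
      {F i | i. i = 0 \<or> (\<exists>j. i = Suc j \<and> Suc j < length (y # xs))}" by simp
  also have "\<dots> = insert (F 0) {F (Suc j) | j. Suc j < length (y # xs)}" by blast
  finally show ?case using 3 by (simp add: F_def)
qed auto

text \<open>Hosts are parametrised by the integers, injectively on a range for a path and
  periodically for a cycle, so that their subpaths become images of integer intervals.\<close>

definition arc_path :: "(int \<Rightarrow> 'b) \<Rightarrow> int \<Rightarrow> int \<Rightarrow> 'b pair_pre_digraph" where
  "arc_path c a b = \<lparr>pverts = c ` {a..b}, parcs = ((\<lambda>t. (c t, c (t + 1))) ` {a..<b})\<^sup>s\<rparr>"

definition circle :: "(int \<Rightarrow> 'b) \<Rightarrow> 'b pair_pre_digraph" where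
  "circle c = \<lparr>pverts = range c, parcs = {(c t, c (t + 1)) | t. True}\<^sup>s\<rparr>"

text \<open>\<open>N\<close> is the exact period: \<open>c\<close> takes \<open>N\<close> distinct
  values, and \<open>3 \<le> N\<close> matches \<open>cycle_graph\<close>.\<close>

definition periodic :: "int \<Rightarrow> (int \<Rightarrow> 'b) \<Rightarrow> bool" where
  "periodic N c \<longleftrightarrow> 3 \<le> N \<and> (\<forall>t t'. c t = c t' \<longleftrightarrow> t mod N = t' mod N)"

lemma arc_path_parcs: "(x, y) \<in> parcs (arc_path c a b) \<longleftrightarrow>
    (\<exists>t. a \<le> t \<and> t < b \<and> (x = c t \<and> y = c (t + 1) \<or> x = c (t + 1) \<and> y = c t))"
  by (fastforce simp: arc_path_def symcl_iff)

lemma circle_parcs: "(x, y) \<in> parcs (circle c) \<longleftrightarrow>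
    (\<exists>t. x = c t \<and> y = c (t + 1) \<or> x = c (t + 1) \<and> y = c t)"
  by (auto simp: circle_def symcl_iff)

lemma pair_pre_digraph_eqI:
  assumes "\<And>x. x \<in> pverts G \<longleftrightarrow> x \<in> pverts H" "\<And>x y. (x, y) \<in> parcs G \<longleftrightarrow> (x, y) \<in> parcs H"
  shows "G = (H :: 'b pair_pre_digraph)"
  using assms by (cases G; cases H) auto

lemma arc_path_list:
  "\<lparr>pverts = set xs, parcs = (set (vwalk_arcs xs))\<^sup>s\<rparr> = arc_path (\<lambda>t. xs ! nat t) 0 (int (length xs) - 1)"
proof -
  have int: "{0..<k} = int ` {..<nat k}" for k
  proof (intro set_eqI iffI)
    fix t assume "t \<in> {0..<k}"
    then show "t \<in> int ` {..<nat k}" by (intro image_eqI[of _ _ "nat t"]) auto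
  qed auto
  have ivl: "{0..int (length xs) - 1} = {0..<int (length xs)}" by auto
  have "set xs = (\<lambda>t. xs ! nat t) ` {0..int (length xs) - 1}"
    unfolding ivl int image_image by (auto simp: set_conv_nth)
  moreover have "set (vwalk_arcs xs) = (\<lambda>t. (xs ! nat t, xs ! nat (t + 1))) ` {0..<int (length xs) - 1}"
    unfolding int image_image set_vwalk_arcs by (auto simp: nat_add_distrib)
  ultimately show ?thesis by (simp add: arc_path_def)
qed

lemma arc_path_shift:
  assumes "\<And>t. 0 \<le> t \<Longrightarrow> t \<le> m \<Longrightarrow> g t = c (a + t)"
  shows "arc_path g 0 m = arc_path c a (a + m)"
proof -
  have I: "{a..a + m} = (+) a ` {0..m}" "{a..<a + m} = (+) a ` {0..<m}" by (simp_all add: add.commute)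
  have "g ` {0..m} = c ` {a..a + m}"
    unfolding I image_image by (intro image_cong) (auto simp: assms)
  moreover have "(\<lambda>t. (g t, g (t + 1))) ` {0..<m} = (\<lambda>t. (c t, c (t + 1))) ` {a..<a + m}"
    unfolding I image_image by (intro image_cong) (auto simp: assms add.assoc)
  ultimately show ?thesis by (simp add: arc_path_def)
qed

text \<open>Serves subpaths that run against the direction of the parametrisation.\<close>

lemma arc_path_mirror: "arc_path (\<lambda>t. g (m - t)) 0 m = arc_path g 0 m"
proof -
  have verts: "(\<lambda>t. g (m - t)) ` {0..m} = g ` {0..m}" by (simp add: image_image[of g "(-) m", symmetric])
  have "(\<lambda>t. (g (m - t), g (m - (t + 1)))) ` {0..<m} = (\<lambda>t. (g (t + 1), g t)) ` (-) (m - 1) ` {0..m - 1}"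
    unfolding image_image by (intro image_cong) (auto simp: algebra_simps)
  moreover have "{0..m - 1} = {0..<m}" "{- 1<..m - 1} = {0..<m}" by auto
  ultimately have "(\<lambda>t. (g (m - t), g (m - (t + 1)))) ` {0..<m} = prod.swap ` (\<lambda>t. (g t, g (t + 1))) ` {0..<m}"
    by (simp add: image_image)
  moreover have "(prod.swap ` R)\<^sup>s = R\<^sup>s" for R :: "'a rel"
    by (auto simp: set_eq_iff symcl_iff)
  ultimately show ?thesis using verts by (simp add: arc_path_def)
qed

lemma path_graph_arc_path:
  assumes "a \<le> b" "inj_on c {a..b}"
  shows "path_graph (arc_path c a b)"
proof -
  define xs where "xs = map (\<lambda>i. c (a + int i)) [0..<nat (b - a + 1)]"
  have len: "length xs = nat (b - a + 1)" by (simp add: xs_def)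
  have "distinct xs"
    unfolding xs_def distinct_map
    using assms by (auto intro!: inj_onI dest: inj_onD)
  moreover have "xs \<noteq> []" using assms(1) len by auto
  moreover have "arc_path (\<lambda>t. xs ! nat t) 0 (int (length xs) - 1) = arc_path c a (a + (int (length xs) - 1))"
    by (rule arc_path_shift) (use assms(1) len in \<open>auto simp: xs_def\<close>)
  then have "arc_path c a b = \<lparr>pverts = set xs, parcs = (set (vwalk_arcs xs))\<^sup>s\<rparr>"
    using arc_path_list[of xs] len assms(1) by simp
  ultimately show ?thesis unfolding path_graph_def by blast
qed

lemma path_graphE:
  assumes "path_graph P"
  obtains c m where "inj_on c {0..int m}" "P = arc_path c 0 (int m)"
proof -
  obtain xs where xs: "xs \<noteq> []" "distinct xs" "P = \<lparr>pverts = set xs, parcs = (set (vwalk_arcs xs))\<^sup>s\<rparr>"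
    using assms unfolding path_graph_def by blast
  have m: "int (length xs) - 1 = int (length xs - 1)" using xs(1) by (cases xs) auto
  have "inj_on (\<lambda>t. xs ! nat t) {0..int (length xs - 1)}"
  proof (rule inj_onI)
    fix s t assume st: "s \<in> {0..int (length xs - 1)}" "t \<in> {0..int (length xs - 1)}" "xs ! nat s = xs ! nat t"
    have "s \<le> int (length xs - 1)" "t \<le> int (length xs - 1)" "0 < length xs" using st xs(1) by auto
    then have "nat s < length xs" "nat t < length xs" by linarith+
    then have "nat s = nat t" using nth_eq_iff_index_eq[OF xs(2)] st(3) by blast
    moreover have "0 \<le> s" "0 \<le> t" using st by auto
    ultimately show "s = t" by (simp add: eq_nat_nat_iff)
  qed
  moreover have "P = arc_path (\<lambda>t. xs ! nat t) 0 (int (length xs - 1))"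
    using xs(3) arc_path_list[of xs] unfolding m by (rule trans)
  ultimately show thesis by (rule that)
qed

lemma circle_list:
  assumes "3 \<le> length xs"
  shows "\<lparr>pverts = set xs, parcs = (set (vwalk_arcs (xs @ [hd xs])))\<^sup>s\<rparr> =
    circle (\<lambda>t. xs ! nat (t mod int (length xs)))"
proof (rule pair_pre_digraph_eqI)
  define n where "n = length xs"
  have n0: "0 < int n" using assms unfolding n_def by linarith
  define c where "c t = xs ! nat (t mod int n)" for t
  fix x y
  have "x \<in> set xs \<longleftrightarrow> x \<in> range c"
  proof
    assume "x \<in> set xs"
    then obtain i where "i < n" "x = xs ! i" by (auto simp: in_set_conv_nth n_def)
    then show "x \<in> range c" by (intro range_eqI[of _ _ "int i"]) (simp add: c_def)
  next
    assume "x \<in> range c"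
    then obtain t where "x = xs ! nat (t mod int n)" by (auto simp: c_def)
    moreover have "nat (t mod int n) < n" using n0 by (simp add: nat_less_iff)
    ultimately show "x \<in> set xs" by (simp add: n_def)
  qed
  then show "x \<in> pverts \<lparr>pverts = set xs, parcs = (set (vwalk_arcs (xs @ [hd xs])))\<^sup>s\<rparr> \<longleftrightarrow>
      x \<in> pverts (circle (\<lambda>t. xs ! nat (t mod int (length xs))))"
    by (simp add: circle_def c_def n_def)
  have nxt: "(xs @ [hd xs]) ! i = c (int i)" if "i \<le> n" for i
  proof (cases "i = n")
    case True
    have "length xs \<noteq> 0" using assms by linarith
    then have "xs \<noteq> []" by simp
    then show ?thesis using True by (simp add: c_def n_def hd_conv_nth)
  next
    case False
    then show ?thesis using that by (simp add: c_def n_def nth_append)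
  qed
  have cper: "c (t + k * int n) = c t" for t k by (simp add: c_def)
  have "(x', y') \<in> set (vwalk_arcs (xs @ [hd xs])) \<longleftrightarrow> (\<exists>t. x' = c t \<and> y' = c (t + 1))" for x' y'
  proof
    assume "(x', y') \<in> set (vwalk_arcs (xs @ [hd xs]))"
    then obtain i where i: "x' = (xs @ [hd xs]) ! i" "y' = (xs @ [hd xs]) ! Suc i" "i < n"
      unfolding set_vwalk_arcs by (auto simp: n_def)
    then show "\<exists>t. x' = c t \<and> y' = c (t + 1)"
      using nxt[of i] nxt[of "Suc i"] by (intro exI[of _ "int i"]) (simp add: add.commute)
  next
    assume "\<exists>t. x' = c t \<and> y' = c (t + 1)"
    then obtain t where t: "x' = c t" "y' = c (t + 1)" by blast
    define i where "i = nat (t mod int n)"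
    have i: "int i = t mod int n" "i < n" using n0 by (auto simp: i_def nat_less_iff)
    have "t = int i + (t div int n) * int n" using i by simp
    then have "c t = c (int i)" "c (t + 1) = c (int (Suc i))"
      using cper[of "int i" "t div int n"] cper[of "int i + 1" "t div int n"] by (simp_all add: algebra_simps)
    then have "x' = (xs @ [hd xs]) ! i" "y' = (xs @ [hd xs]) ! Suc i"
      using t nxt[of i] nxt[of "Suc i"] i(2) by auto
    then show "(x', y') \<in> set (vwalk_arcs (xs @ [hd xs]))"
      unfolding set_vwalk_arcs using i(2) by (auto simp: n_def)
  qed
  then show "(x, y) \<in> parcs \<lparr>pverts = set xs, parcs = (set (vwalk_arcs (xs @ [hd xs])))\<^sup>s\<rparr> \<longleftrightarrow>
      (x, y) \<in> parcs (circle (\<lambda>t. xs ! nat (t mod int (length xs))))"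
    unfolding circle_parcs c_def n_def by (simp add: symcl_iff) blast
qed

lemma cycle_graphE:
  assumes "cycle_graph C"
  obtains c N where "periodic N c" "C = circle c"
proof -
  obtain xs where xs: "3 \<le> length xs" "distinct xs"
    "C = \<lparr>pverts = set xs, parcs = (set (vwalk_arcs (xs @ [hd xs])))\<^sup>s\<rparr>"
    using assms unfolding cycle_graph_def by blast
  define N where "N = int (length xs)"
  have "periodic N (\<lambda>t. xs ! nat (t mod N))"
    unfolding periodic_def
  proof (intro conjI allI)
    show N3: "3 \<le> N" using xs(1) by (simp add: N_def)
    fix t t'
    have "0 \<le> t mod N" "t mod N < N" "0 \<le> t' mod N" "t' mod N < N" using N3 by auto
    then have "nat (t mod N) < length xs" "nat (t' mod N) < length xs" using N_def by linarith+
    then have "xs ! nat (t mod N) = xs ! nat (t' mod N) \<longleftrightarrow> nat (t mod N) = nat (t' mod N)"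
      using nth_eq_iff_index_eq[OF xs(2)] by blast
    also have "\<dots> \<longleftrightarrow> t mod N = t' mod N" using N3 by (simp add: eq_nat_nat_iff)
    finally show "xs ! nat (t mod N) = xs ! nat (t' mod N) \<longleftrightarrow> t mod N = t' mod N" .
  qed
  then show thesis using that xs(3) circle_list[OF xs(1)] by (simp add: N_def)
qed

lemma cycle_graph_circle:
  assumes "periodic N c"
  shows "cycle_graph (circle c)"
proof -
  have N3: "3 \<le> N" and per: "\<And>t t'. c t = c t' \<longleftrightarrow> t mod N = t' mod N"
    using assms by (auto simp: periodic_def)
  define xs where "xs = map (\<lambda>i. c (int i)) [0..<nat N]"
  have len: "length xs = nat N" "int (length xs) = N" using N3 by (auto simp: xs_def)
  have "distinct xs"
    unfolding xs_def distinct_map using N3 by (auto intro!: inj_onI simp: per)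
  moreover have "3 \<le> length xs" using len N3 by linarith
  moreover have "xs ! nat (t mod N) = c t" for t
  proof -
    have "nat (t mod N) < nat N" using N3 by simp
    then have "xs ! nat (t mod N) = c (int (nat (t mod N)))" by (simp add: xs_def)
    also have "\<dots> = c t" using N3 by (simp add: per)
    finally show ?thesis .
  qed
  then have "circle (\<lambda>t. xs ! nat (t mod int (length xs))) = circle c" using len by simp
  ultimately show ?thesis unfolding cycle_graph_def using circle_list[of xs] by metis
qed

text \<open>Each step goes to one of the two neighbours of the current point, and injectivity
  excludes the one just left, so the direction of the first step persists. \<open>shift\<close>
  holds for periodic parametrisations and for \<open>id\<close>, which covers cycles and
  paths.\<close>

lemma straight_walk:
  fixes g :: "nat \<Rightarrow> 'b" and c :: "int \<Rightarrow> 'b"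
  assumes shift: "\<And>t t' d. c t = c t' \<Longrightarrow> c (t + d) = c (t' + d)"
    and inj: "inj_on g {..m}" and start: "g 0 \<in> range c"
    and step: "\<And>i. i < m \<Longrightarrow> \<exists>t. g i = c t \<and> g (Suc i) = c (t + 1) \<or> g i = c (t + 1) \<and> g (Suc i) = c t"
  shows "\<exists>a. (\<forall>i\<le>m. g i = c (a + int i)) \<or> (\<forall>i\<le>m. g i = c (a - int i))"
proof -
  obtain a where a: "g 0 = c a" using start by blast
  have next_step: "g (Suc i) = c (s + 1) \<or> g (Suc i) = c (s - 1)" if h: "i < m" "g i = c s" for i s
  proof -
    obtain t where "g i = c t \<and> g (Suc i) = c (t + 1) \<or> g i = c (t + 1) \<and> g (Suc i) = c t"
      using step[OF h(1)] by blast
    then show ?thesis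
    proof
      assume t: "g i = c t \<and> g (Suc i) = c (t + 1)"
      then have "c t = c s" using h(2) by simp
      from shift[OF this, of 1] t show ?thesis by simp
    next
      assume t: "g i = c (t + 1) \<and> g (Suc i) = c t"
      then have "c (t + 1) = c s" using h(2) by simp
      from shift[OF this, of "-1"] t show ?thesis by simp
    qed
  qed
  show ?thesis
  proof (cases "m = 0")
    case True then show ?thesis using a by (intro exI[of _ a]) auto
  next
    case False
    then obtain \<sigma> where \<sigma>: "\<sigma> = 1 \<or> \<sigma> = - 1" "g 1 = c (a + \<sigma>)"
      using next_step[OF _ a] by fastforce
    have "g i = c (a + \<sigma> * int i) \<and> (Suc i \<le> m \<longrightarrow> g (Suc i) = c (a + \<sigma> * int (Suc i)))" if "i \<le> m" for i
      using that
    proof (induction i)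
      case 0 then show ?case using a \<sigma> by simp
    next
      case (Suc i)
      have gi: "g i = c (a + \<sigma> * int i)" and gs: "g (Suc i) = c (a + \<sigma> * int (Suc i))" using Suc by auto
      have "g (Suc (Suc i)) = c (a + \<sigma> * int (Suc (Suc i)))" if m: "Suc (Suc i) \<le> m"
      proof -
        have "g (Suc (Suc i)) \<noteq> g i" using inj m by (auto dest: inj_onD)
        then have "g (Suc (Suc i)) \<noteq> c (a + \<sigma> * int i)" using gi by simp
        moreover have "g (Suc (Suc i)) = c (a + \<sigma> * int (Suc i) + 1) \<or> g (Suc (Suc i)) = c (a + \<sigma> * int (Suc i) - 1)"
          using next_step[OF _ gs] m by auto
        ultimately show ?thesis using \<sigma>(1) by (auto simp: algebra_simps)
      qed
      then show ?case using gs by simp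
    qed
    then show ?thesis using \<sigma>(1) by (intro exI[of _ a]) auto
  qed
qed

lemma wf_arc_path: "pair_wf_digraph (arc_path c a b)"
  by unfold_locales (auto simp: arc_path_def symcl_iff)

lemma wf_circle: "pair_wf_digraph (circle c)"
  by unfold_locales (auto simp: circle_def symcl_iff)

lemma subgraph_iff: "subgraph (with_proj Q) (with_proj H) \<longleftrightarrow>
    pverts Q \<subseteq> pverts H \<and> parcs Q \<subseteq> parcs H \<and> pair_wf_digraph H \<and> pair_wf_digraph Q"
  by (auto simp: subgraph_def wf_digraph_wp_iff compatible_def)

lemma periodicD:
  assumes "periodic N c"
  shows "3 \<le> N" and "c t = c t' \<longleftrightarrow> t mod N = t' mod N" and "c (t + k * N) = c t"
    and "c t = c t' \<Longrightarrow> c (t + d) = c (t' + d)"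
proof -
  show "3 \<le> N" and eq: "c t = c t' \<longleftrightarrow> t mod N = t' mod N" for t t' using assms by (auto simp: periodic_def)
  show "c (t + k * N) = c t" by (simp add: eq)
  show "c (t + d) = c (t' + d)" if "c t = c t'" using that unfolding eq by (rule mod_add_cong) simp
qed

lemma periodic_inj_on:
  assumes "periodic N c" "b < a + N"
  shows "inj_on c {a..b}"
proof (rule inj_onI)
  fix s t assume st: "s \<in> {a..b}" "t \<in> {a..b}" "c s = c t"
  then have "N dvd s - t" using periodicD(2)[OF assms(1)] by (simp add: mod_eq_dvd_iff)
  moreover have "\<bar>s - t\<bar> < N" using st assms(2) by auto
  ultimately have "s - t = 0" using dvd_imp_le_int[of "s - t" N] by fastforce
  then show "s = t" by simp
qed

lemma subpath_circle:
  assumes N: "periodic N c" and Q: "subpath Q (circle c)"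
  shows "\<exists>a b. a \<le> b \<and> b < a + N \<and> Q = arc_path c a b"
proof -
  obtain g m where g: "inj_on g {0..int m}" "Q = arc_path g 0 (int m)"
    using Q path_graphE unfolding subpath_def by metis
  have sub: "pverts Q \<subseteq> range c" "parcs Q \<subseteq> parcs (circle c)"
    using Q unfolding subpath_def subgraph_iff by (auto simp: circle_def)
  have "\<exists>a. (\<forall>i\<le>m. g (int i) = c (a + int i)) \<or> (\<forall>i\<le>m. g (int i) = c (a - int i))"
  proof (rule straight_walk)
    show "\<And>t t' d. c t = c t' \<Longrightarrow> c (t + d) = c (t' + d)" by (rule periodicD(4)[OF N])
    show "inj_on (\<lambda>i. g (int i)) {..m}" using g(1) by (auto intro!: inj_onI dest: inj_onD)
    show "g (int 0) \<in> range c" using sub(1) g(2) by (auto simp: arc_path_def)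
    fix i assume "i < m"
    then have "(g (int i), g (int i + 1)) \<in> parcs Q"
      unfolding g(2) arc_path_parcs by (intro exI[of _ "int i"]) auto
    then show "\<exists>t. g (int i) = c t \<and> g (int (Suc i)) = c (t + 1) \<or> g (int i) = c (t + 1) \<and> g (int (Suc i)) = c t"
      using sub(2) circle_parcs[of "g (int i)" "g (int i + 1)" c] by (auto simp: add.commute)
  qed
  then obtain a where a: "(\<forall>i\<le>m. g (int i) = c (a + int i)) \<or> (\<forall>i\<le>m. g (int i) = c (a - int i))" by blast
  \<comment> \<open>Otherwise the path would be back at its first vertex after \<open>N\<close>
    steps.\<close>
  have mN: "int m < N"
  proof (rule ccontr)
    assume h: "\<not> int m < N"
    have "nat N \<le> m" "0 < N" using h periodicD(1)[OF N] by auto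
    then have "g N = c (a + 1 * N) \<or> g N = c (a + (- 1) * N)" using a by (auto dest!: spec[of _ "nat N"])
    moreover have "g 0 = c a" using a by (auto dest!: spec[of _ 0])
    ultimately have "g N = g 0" using periodicD(3)[OF N, of a 1] periodicD(3)[OF N, of a "-1"] by auto
    then show False using g(1) h \<open>0 < N\<close> by (auto dest: inj_onD)
  qed
  from a show ?thesis
  proof
    assume up: "\<forall>i\<le>m. g (int i) = c (a + int i)"
    have "arc_path g 0 (int m) = arc_path c a (a + int m)"
    proof (rule arc_path_shift)
      fix t assume t: "0 \<le> t" "t \<le> int m"
      then show "g t = c (a + t)" using up[rule_format, of "nat t"] by simp
    qed
    then show ?thesis using g(2) mN by (intro exI[of _ a] exI[of _ "a + int m"]) auto
  next
    assume down: "\<forall>i\<le>m. g (int i) = c (a - int i)"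
    have "arc_path (\<lambda>t. g (int m - t)) 0 (int m) = arc_path c (a - int m) (a - int m + int m)"
    proof (rule arc_path_shift)
      fix t assume t: "0 \<le> t" "t \<le> int m"
      define i where "i = nat (int m - t)"
      have i: "int i = int m - t" "i \<le> m" using t by (auto simp: i_def)
      have "g (int i) = c (a - int i)" using down i(2) by blast
      then show "g (int m - t) = c (a - int m + t)" unfolding i(1) by (simp add: algebra_simps)
    qed
    then show ?thesis using g(2) mN arc_path_mirror[of g "int m"]
      by (intro exI[of _ "a - int m"] exI[of _ a]) auto
  qed
qed

lemma arcs_meet_iff:
  assumes N: "periodic N c" and ab: "a \<le> b" "a' \<le> b'"
  shows "c ` {a..b} \<inter> c ` {a'..b'} \<noteq> {} \<longleftrightarrow> (\<exists>k. a \<le> b' + k * N \<and> a' + k * N \<le> b)"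
proof
  assume "c ` {a..b} \<inter> c ` {a'..b'} \<noteq> {}"
  then obtain t t' where t: "a \<le> t" "t \<le> b" "a' \<le> t'" "t' \<le> b'" "c t = c t'" by fastforce
  then have "N dvd t - t'" using periodicD(2)[OF N] by (simp add: mod_eq_dvd_iff)
  then obtain k where "t - t' = N * k" by (auto elim: dvdE)
  then have "t = t' + k * N" by (simp add: algebra_simps)
  then have "a \<le> b' + k * N \<and> a' + k * N \<le> b" using t by linarith
  then show "\<exists>k. a \<le> b' + k * N \<and> a' + k * N \<le> b" by blast
next
  assume "\<exists>k. a \<le> b' + k * N \<and> a' + k * N \<le> b"
  then obtain k where k: "a \<le> b' + k * N" "a' + k * N \<le> b" by blast
  define t where "t = max a (a' + k * N)"
  have t: "a \<le> t" "t \<le> b" "a' \<le> t - k * N" "t - k * N \<le> b'" using k ab by (auto simp: t_def)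
  have "c t = c (t - k * N)" using periodicD(3)[OF N, of "t - k * N" k] by simp
  then show "c ` {a..b} \<inter> c ` {a'..b'} \<noteq> {}" using t by force
qed

text \<open>All but the last edge of \<open>C'\<close> form a straight walk on the circle. The last
  edge closes it only if \<open>N\<close> divides \<open>N'\<close> or \<open>N' - 2\<close>, and
  \<open>0 < N' - 2 < N\<close> leaves \<open>N' = N\<close>. So \<open>C'\<close> goes round
  exactly once and uses every edge.\<close>

lemma cycle_in_circle:
  assumes N: "periodic N c" and C': "cycle_graph C'"
    and sub: "pverts C' \<subseteq> range c" "parcs C' \<subseteq> parcs (circle c)"
  shows "(c q, c (q + 1)) \<in> parcs C'"
proof -
  obtain c' N' where N': "periodic N' c'" and eq: "C' = circle c'" using C' cycle_graphE by metis
  note P = periodicD[OF N] and P' = periodicD[OF N']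
  define m where "m = nat (N' - 1)"
  have m: "int m = N' - 1" using P'(1) by (simp add: m_def)
  have arc: "(c' t, c' (t + 1)) \<in> parcs C'" for t unfolding eq circle_parcs by blast
  have stp: "\<exists>t. c' s = c t \<and> c' (s + 1) = c (t + 1) \<or> c' s = c (t + 1) \<and> c' (s + 1) = c t" for s
    using sub(2) arc[of s] circle_parcs[of "c' s" "c' (s + 1)" c] by blast
  have "\<exists>a. (\<forall>i\<le>m. c' (int i) = c (a + int i)) \<or> (\<forall>i\<le>m. c' (int i) = c (a - int i))"
  proof (rule straight_walk)
    show "\<And>t t' d. c t = c t' \<Longrightarrow> c (t + d) = c (t' + d)" by (rule P(4))
    have "inj_on c' {0..int m}" using periodic_inj_on[OF N'] m by simp
    then show "inj_on (\<lambda>i. c' (int i)) {..m}" by (auto intro!: inj_onI dest: inj_onD)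
    show "c' (int 0) \<in> range c" using sub(1) unfolding eq by (auto simp: circle_def)
    show "\<exists>t. c' (int i) = c t \<and> c' (int (Suc i)) = c (t + 1) \<or> c' (int i) = c (t + 1) \<and> c' (int (Suc i)) = c t"
      if "i < m" for i
      using stp[of "int i"] by (simp add: add.commute)
  qed
  then obtain a \<sigma> where \<sigma>: "\<sigma> = 1 \<or> \<sigma> = - 1" and a: "\<And>i. i \<le> m \<Longrightarrow> c' (int i) = c (a + \<sigma> * int i)"
    by (metis mult_1 mult_minus1 uminus_add_conv_diff add.commute)
  have a': "c' t = c (a + \<sigma> * t)" if "0 \<le> t" "t < N'" for t
    using a[of "nat t"] that m by simp
  have N'N: "N' \<le> N"
  proof (rule ccontr)
    assume "\<not> N' \<le> N"
    then have "c' N = c (a + \<sigma> * N)" "c' 0 = c a" using a'[of N] a'[of 0] P(1) by auto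
    then have "c' N = c' 0" using P(3) by simp
    then have "N mod N' = 0" using P'(2) by simp
    then show False using \<open>\<not> N' \<le> N\<close> P(1) by simp
  qed
  obtain t where t: "c' (N' - 1) = c t \<and> c' (N' - 1 + 1) = c (t + 1) \<or> c' (N' - 1) = c (t + 1) \<and> c' (N' - 1 + 1) = c t"
    using stp by blast
  have c'0: "c' N' = c a" using a'[of 0] P'(1) P'(3)[of 0 1] by simp
  have c'1: "c' (N' - 1) = c (a + \<sigma> * (N' - 1))" using a'[of "N' - 1"] P'(1) by simp
  have "c (a + \<sigma> * (N' - 1) + 1) = c a \<or> c (a + \<sigma> * (N' - 1) - 1) = c a"
    using t c'0 c'1 P(4)[of "a + \<sigma> * (N' - 1)" t 1] P(4)[of "a + \<sigma> * (N' - 1)" "t + 1" "-1"] by auto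
  \<comment> \<open>The closing edge continues in the direction \<open>\<sigma>\<close> or turns
    back; the first gives \<open>N'\<close>, the second \<open>N' - 2\<close>.\<close>
  then have "N dvd \<sigma> * (N' - 1) + 1 \<or> N dvd \<sigma> * (N' - 1) - 1"
    using P(2) by (auto simp: mod_eq_dvd_iff algebra_simps)
  then have "N dvd N' \<or> N dvd N' - 2"
    using \<sigma> by (auto simp: algebra_simps dvd_diff_commute)
  moreover have "\<not> N dvd N' - 2" using P'(1) N'N by (intro zdvd_not_zless) auto
  ultimately have "N dvd N'" by blast
  then have NN: "N' = N" using N'N P'(1) by (intro zdvd_antisym_nonneg) (auto dest: zdvd_imp_le)
  have all: "c' t = c (a + \<sigma> * t)" if "0 \<le> t" "t \<le> N" for t
    using a'[of t] that NN c'0 P(3)[of a \<sigma>] by (cases "t = N") auto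
  from \<sigma> show ?thesis
  proof
    assume s1: "\<sigma> = 1"
    define t where "t = (q - a) mod N"
    have t: "0 \<le> t" "t < N" using P(1) by (auto simp: t_def)
    have q: "q = a + t + ((q - a) div N) * N" unfolding t_def using div_mult_mod_eq[of "q - a" N] by linarith
    have "c q = c (a + t)" using P(3)[of "a + t" "(q - a) div N"] q by simp
    moreover have "c (q + 1) = c (a + t + 1)" using calculation P(4) by blast
    ultimately show ?thesis using arc[of t] all[of t] all[of "t + 1"] t s1 by (simp add: add.assoc)
  next
    assume s1: "\<sigma> = - 1"
    define t where "t = (a - q - 1) mod N"
    have t: "0 \<le> t" "t < N" using P(1) by (auto simp: t_def)
    have q: "q + 1 + ((a - q - 1) div N) * N = a - t" unfolding t_def using div_mult_mod_eq[of "a - q - 1" N] by linarith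
    have c1: "c (q + 1) = c (a - t)" using P(3)[of "q + 1" "(a - q - 1) div N"] q by simp
    have c0: "c q = c (a - t - 1)" using P(4)[OF c1, of "-1"] by simp
    have "(c' (t + 1), c' t) \<in> parcs C'" unfolding eq circle_parcs by blast
    then show ?thesis using all[of t] all[of "t + 1"] t s1 c0 c1 by (simp add: algebra_simps)
  qed
qed

section \<open>Interval models and circular models of graphs\<close>

lemma interval_model_of_graph:
  assumes "interval_graph H"
  shows "\<exists>l u. interval_model (pverts H) (parcs H) l u"
proof -
  obtain P :: "nat pair_pre_digraph" and f where P: "path_graph P" and rep: "subpath_representation H P f"
    using assms unfolding interval_graph_def by blast
  obtain c m where c: "inj_on c {0..int m}" "P = arc_path c 0 (int m)" using path_graphE[OF P] .
  define p where "p = the_inv_into {0..int m} c"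
  have p: "p (c t) = t" if "0 \<le> t" "t \<le> int m" for t
    unfolding p_def using the_inv_into_f_f[OF c(1)] that by simp
  have "\<exists>l u. 0 \<le> l \<and> l \<le> u \<and> u \<le> int m \<and> pverts (f v) = c ` {l..u}" if v: "v \<in> pverts H" for v
  proof -
    have sp: "subpath (f v) P" using rep v by (simp add: subpath_representation_def)
    obtain g k where g: "inj_on g {0..int k}" "f v = arc_path g 0 (int k)"
      using sp path_graphE unfolding subpath_def by metis
    have sub: "pverts (f v) \<subseteq> pverts P" "parcs (f v) \<subseteq> parcs P"
      using sp unfolding subpath_def subgraph_iff by auto
    have gc: "\<exists>t. 0 \<le> t \<and> t \<le> int m \<and> g (int i) = c t" if "i \<le> k" for i
    proof -
      have "g (int i) \<in> pverts P" using sub(1) that g(2) by (auto simp: arc_path_def)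
      then show ?thesis unfolding c(2) by (auto simp: arc_path_def)
    qed
    have cp: "c (p (g (int i))) = g (int i)" "0 \<le> p (g (int i))" "p (g (int i)) \<le> int m" if "i \<le> k" for i
      using gc[OF that] p by auto
    \<comment> \<open>In the coordinate \<open>p\<close> the host path is a piece of the integers,
      so \<open>straight_walk\<close> is used with \<open>id\<close> as parametrisation.\<close>
    have "\<exists>a. (\<forall>i\<le>k. p (g (int i)) = id (a + int i)) \<or> (\<forall>i\<le>k. p (g (int i)) = id (a - int i))"
    proof (rule straight_walk)
      show "\<And>t t' d :: int. id t = id t' \<Longrightarrow> id (t + d) = id (t' + d)" by simp
      show "inj_on (\<lambda>i. p (g (int i))) {..k}"
      proof (rule inj_onI)
        fix i j assume ij: "i \<in> {..k}" "j \<in> {..k}" "p (g (int i)) = p (g (int j))"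
        have "c (p (g (int i))) = g (int i)" "c (p (g (int j))) = g (int j)" using ij(1,2) by (auto intro: cp(1))
        then have "g (int i) = g (int j)" using arg_cong[OF ij(3), of c] by metis
        then show "i = j" using g(1) ij by (auto dest: inj_onD)
      qed
      show "p (g (int 0)) \<in> range id" by simp
      fix i assume i: "i < k"
      have "(g (int i), g (int i + 1)) \<in> parcs (f v)"
        unfolding g(2) arc_path_parcs by (intro exI[of _ "int i"]) (use i in auto)
      then obtain t where t: "0 \<le> t" "t < int m"
        "g (int i) = c t \<and> g (int i + 1) = c (t + 1) \<or> g (int i) = c (t + 1) \<and> g (int i + 1) = c t"
        using subsetD[OF sub(2), of "(g (int i), g (int i + 1))"] unfolding c(2) arc_path_parcs by blast
      then have "p (g (int i)) = t \<and> p (g (int i + 1)) = t + 1 \<or> p (g (int i)) = t + 1 \<and> p (g (int i + 1)) = t"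
        using p[of t] p[of "t + 1"] by fastforce
      then show "\<exists>t. p (g (int i)) = id t \<and> p (g (int (Suc i))) = id (t + 1) \<or>
          p (g (int i)) = id (t + 1) \<and> p (g (int (Suc i))) = id t"
        by (intro exI[of _ t]) (simp add: add.commute)
    qed
    then obtain a where a: "(\<forall>i\<le>k. p (g (int i)) = a + int i) \<or> (\<forall>i\<le>k. p (g (int i)) = a - int i)"
      by auto
    have pv: "pverts (f v) = (\<lambda>i. c (p (g (int i)))) ` {..k}"
    proof -
      have "{0..int k} = int ` {..k}" by (simp add: image_int_atLeastAtMost flip: atLeast0AtMost)
      then have "pverts (f v) = g ` int ` {..k}" unfolding g(2) arc_path_def by simp
      also have "\<dots> = (\<lambda>i. c (p (g (int i)))) ` {..k}"
        unfolding image_image using cp(1) by (intro image_cong) auto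
      finally show ?thesis .
    qed
    have "\<exists>b. (\<lambda>i. p (g (int i))) ` {..k} = {b..b + int k}"
    proof (cases "\<forall>i\<le>k. p (g (int i)) = a + int i")
      case True
      then have "(\<lambda>i. p (g (int i))) ` {..k} = (\<lambda>i. a + int i) ` {..k}" by (intro image_cong) auto
      also have "\<dots> = {a..a + int k}"
      proof (intro equalityI subsetI)
        fix t assume "t \<in> {a..a + int k}"
        then show "t \<in> (\<lambda>i. a + int i) ` {..k}" by (intro image_eqI[of _ _ "nat (t - a)"]) auto
      qed auto
      finally show ?thesis by blast
    next
      case False
      then have "(\<lambda>i. p (g (int i))) ` {..k} = (\<lambda>i. a - int i) ` {..k}" using a by (intro image_cong) auto
      also have "\<dots> = {a - int k..a - int k + int k}"
      proof (intro equalityI subsetI)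
        fix t assume "t \<in> {a - int k..a - int k + int k}"
        then show "t \<in> (\<lambda>i. a - int i) ` {..k}" by (intro image_eqI[of _ _ "nat (a - t)"]) auto
      qed auto
      finally show ?thesis by blast
    qed
    then obtain b where b: "(\<lambda>i. p (g (int i))) ` {..k} = {b..b + int k}" by blast
    have "pverts (f v) = c ` {b..b + int k}" unfolding pv b[symmetric] image_image ..
    moreover have "{b..b + int k} \<subseteq> {0..int m}" unfolding b[symmetric] using cp(2,3) by auto
    ultimately show ?thesis by (intro exI[of _ b] exI[of _ "b + int k"]) auto
  qed
  then obtain l u where lu: "\<And>v. v \<in> pverts H \<Longrightarrow> 0 \<le> l v \<and> l v \<le> u v \<and> u v \<le> int m \<and> pverts (f v) = c ` {l v..u v}"
    by metis
  have "interval_model (pverts H) (parcs H) l u"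
    unfolding interval_model_def
  proof (intro conjI ballI impI)
    show "l x \<le> u x" if "x \<in> pverts H" for x using lu[OF that] by simp
    fix x y assume xy: "x \<in> pverts H" "y \<in> pverts H" "x \<noteq> y"
    have "pverts (f x) \<inter> pverts (f y) = c ` ({l x..u x} \<inter> {l y..u y})"
      using lu[OF xy(1)] lu[OF xy(2)] inj_on_image_Int[OF c(1), of "{l x..u x}" "{l y..u y}"] by auto
    then have "pverts (f x) \<inter> pverts (f y) \<noteq> {} \<longleftrightarrow> {l x..u x} \<inter> {l y..u y} \<noteq> {}" by simp
    also have "\<dots> \<longleftrightarrow> l x \<le> u y \<and> l y \<le> u x" using lu[OF xy(1)] lu[OF xy(2)] by auto
    finally show "(x, y) \<in> parcs H \<longleftrightarrow> l x \<le> u y \<and> l y \<le> u x"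
      using rep xy unfolding subpath_representation_def by blast
  qed
  then show ?thesis by blast
qed

lemma interval_graph_of_model:
  assumes fin: "finite (pverts H)" and m: "interval_model (pverts H) (parcs H) l u"
  shows "interval_graph H"
proof -
  obtain B1 B2 where B12: "\<And>x. x \<in> pverts H \<Longrightarrow> \<bar>l x\<bar> \<le> B1" "\<And>x. x \<in> pverts H \<Longrightarrow> \<bar>u x\<bar> \<le> B2"
    using finite_int_bound[OF fin, of l] finite_int_bound[OF fin, of u] by blast
  define B where "B = \<bar>B1\<bar> + \<bar>B2\<bar>"
  have B: "- B \<le> l x" "u x \<le> B" "l x \<le> u x" if "x \<in> pverts H" for x
    using B12[OF that] m that by (auto simp: B_def interval_model_def)
  \<comment> \<open>Host vertices are natural numbers, so all endpoints are shifted by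
    \<open>B\<close> into the range where \<open>nat\<close> is injective.\<close>
  define f where "f x = arc_path nat (l x + B) (u x + B)" for x
  have inj: "inj_on nat {a..b}" if "0 \<le> a" for a b using that by (auto intro!: inj_onI)
  have P: "path_graph (arc_path nat 0 (2 * B))"
    by (rule path_graph_arc_path) (auto simp: B_def intro: inj)
  have "subpath_representation H (arc_path nat 0 (2 * B)) f"
    unfolding subpath_representation_def
  proof (intro conjI ballI impI)
    fix x assume x: "x \<in> pverts H"
    have "path_graph (f x)" unfolding f_def
      by (rule path_graph_arc_path) (use B[OF x] in \<open>auto intro: inj\<close>)
    moreover have "parcs (f x) \<subseteq> parcs (arc_path nat 0 (2 * B))"
    proof
      fix e assume "e \<in> parcs (f x)"
      then obtain y z where e: "e = (y, z)" "(y, z) \<in> parcs (f x)" by (cases e) auto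
      then obtain t where "l x + B \<le> t" "t < u x + B" "y = nat t \<and> z = nat (t + 1) \<or> y = nat (t + 1) \<and> z = nat t"
        unfolding f_def arc_path_parcs by blast
      then show "e \<in> parcs (arc_path nat 0 (2 * B))" unfolding e(1) arc_path_parcs
        using B[OF x] by (intro exI[of _ t]) auto
    qed
    moreover have "pverts (f x) \<subseteq> pverts (arc_path nat 0 (2 * B))"
      using B[OF x] by (auto simp: f_def arc_path_def)
    ultimately show "subpath (f x) (arc_path nat 0 (2 * B))"
      unfolding subpath_def subgraph_iff by (auto simp: f_def wf_arc_path)
  next
    fix x y assume xy: "x \<in> pverts H" "y \<in> pverts H" "x \<noteq> y"
    let ?I = "{l x + B..u x + B}" and ?J = "{l y + B..u y + B}"
    have "pverts (f x) \<inter> pverts (f y) = nat ` (?I \<inter> ?J)"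
      using inj_on_image_Int[OF inj[of 0 "2 * B"], of ?I ?J] B[OF xy(1)] B[OF xy(2)]
      by (simp add: f_def arc_path_def)
    then have "pverts (f x) \<inter> pverts (f y) \<noteq> {} \<longleftrightarrow> ?I \<inter> ?J \<noteq> {}" by simp
    also have "\<dots> \<longleftrightarrow> l x \<le> u y \<and> l y \<le> u x" using B[OF xy(1)] B[OF xy(2)] by auto
    finally show "(x, y) \<in> parcs H \<longleftrightarrow> pverts (f x) \<inter> pverts (f y) \<noteq> {}"
      using m xy by (simp add: interval_model_def)
  qed
  then show ?thesis unfolding interval_graph_def using P by blast
qed

text \<open>For acyclicity: if the arcs of \<open>X\<close> covered every edge of the circle, their
  union would contain the circle itself.\<close>

lemma circular_model_of_graph:
  assumes "r_acyclic_circular_arc r G"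
  shows "\<exists>N a b. 3 \<le> N \<and> circular_model (pverts G) (parcs G) N a b \<and> acyclic_model r (pverts G) N a b"
proof -
  obtain C :: "nat pair_pre_digraph" and f where C: "cycle_graph C" and rep: "subpath_representation G C f"
    and acyc: "r_acyclic_representation r G f"
    using assms unfolding r_acyclic_circular_arc_def circular_arc_representation_def by blast
  obtain c N where N: "periodic N c" and Cc: "C = circle c" using cycle_graphE[OF C] .
  have "\<exists>a b. a \<le> b \<and> b < a + N \<and> f v = arc_path c a b" if "v \<in> pverts G" for v
    using subpath_circle[OF N] rep that unfolding Cc subpath_representation_def by blast
  then obtain a b where ab: "\<And>v. v \<in> pverts G \<Longrightarrow> a v \<le> b v \<and> b v < a v + N \<and> f v = arc_path c (a v) (b v)"
    by metis
  have "circular_model (pverts G) (parcs G) N a b"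
    unfolding circular_model_def
  proof (intro conjI ballI impI)
    show "a x \<le> b x" "b x < a x + N" if "x \<in> pverts G" for x using ab[OF that] by auto
    fix x y assume xy: "x \<in> pverts G" "y \<in> pverts G" "x \<noteq> y"
    have "(x, y) \<in> parcs G \<longleftrightarrow> c ` {a x..b x} \<inter> c ` {a y..b y} \<noteq> {}"
      using rep xy ab[OF xy(1)] ab[OF xy(2)] by (auto simp: subpath_representation_def arc_path_def)
    also have "\<dots> \<longleftrightarrow> (\<exists>k. a x \<le> b y + k * N \<and> a y + k * N \<le> b x)"
      by (rule arcs_meet_iff[OF N]) (use ab[OF xy(1)] ab[OF xy(2)] in auto)
    finally show "(x, y) \<in> parcs G \<longleftrightarrow> (\<exists>k. a x \<le> b y + k * N \<and> a y + k * N \<le> b x)" .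
  qed
  moreover have "acyclic_model r (pverts G) N a b"
    unfolding acyclic_model_def
  proof (intro allI impI, rule ccontr)
    fix X assume X: "X \<subseteq> pverts G" "card X \<le> r"
    assume cov: "\<nexists>q. \<forall>x\<in>X. \<forall>k. \<not> (a x + k * N \<le> q \<and> q < b x + k * N)"
    have ac: "acyclic_graph (union_graph f X)" using acyc X by (simp add: r_acyclic_representation_def)
    have edge: "\<exists>x\<in>X. (c q, c (q + 1)) \<in> parcs (f x) \<and> (c (q + 1), c q) \<in> parcs (f x) \<and> c q \<in> pverts (f x)" for q
    proof -
      obtain x k where x: "x \<in> X" "a x + k * N \<le> q" "q < b x + k * N" using cov by blast
      have fx: "f x = arc_path c (a x) (b x)" using ab X x by blast
      have eq: "c q = c (q - k * N)" "c (q + 1) = c (q - k * N + 1)"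
        using periodicD(3)[OF N, of "q - k * N" k] periodicD(3)[OF N, of "q - k * N + 1" k] by simp_all
      have t: "a x \<le> q - k * N" "q - k * N < b x" using x by linarith+
      show ?thesis
      proof (rule bexI[OF _ x(1)], intro conjI)
        show "(c q, c (q + 1)) \<in> parcs (f x)" "(c (q + 1), c q) \<in> parcs (f x)"
          unfolding fx arc_path_parcs eq using t by blast+
        show "c q \<in> pverts (f x)" unfolding fx eq using t by (simp add: arc_path_def)
      qed
    qed
    have "subgraph (with_proj C) (with_proj (union_graph f X))"
      unfolding subgraph_iff
    proof (intro conjI)
      show "pverts C \<subseteq> pverts (union_graph f X)"
        using edge unfolding Cc by (fastforce simp: circle_def union_graph_def)
      show "parcs C \<subseteq> parcs (union_graph f X)"
      proof
        fix e assume "e \<in> parcs C"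
        then obtain y z where e: "e = (y, z)" "(y, z) \<in> parcs (circle c)" unfolding Cc by (cases e) auto
        then obtain t where "y = c t \<and> z = c (t + 1) \<or> y = c (t + 1) \<and> z = c t" unfolding circle_parcs by blast
        then show "e \<in> parcs (union_graph f X)" using edge[of t] unfolding e(1) union_graph_def by auto
      qed
      show "pair_wf_digraph C" unfolding Cc by (rule wf_circle)
      have wf: "pair_wf_digraph (f x)" if "x \<in> X" for x
      proof -
        have "x \<in> pverts G" using X that by blast
        then show ?thesis using ab wf_arc_path by metis
      qed
      show "pair_wf_digraph (union_graph f X)"
      proof
        fix e assume "e \<in> parcs (union_graph f X)"
        then obtain x where x: "x \<in> X" "e \<in> parcs (f x)" by (auto simp: union_graph_def)
        interpret pair_wf_digraph "f x" by (rule wf[OF x(1)])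
        show "fst e \<in> pverts (union_graph f X)" "snd e \<in> pverts (union_graph f X)"
          using arc_fst_in_verts[OF x(2)] arc_snd_in_verts[OF x(2)] x(1) by (auto simp: union_graph_def)
      qed
    qed
    then show False using ac C unfolding acyclic_graph_def by blast
  qed
  ultimately show ?thesis using periodicD(1)[OF N] by blast
qed

text \<open>For acyclicity: by \<open>cycle_in_circle\<close> a cycle in the union of the arcs of
  \<open>X\<close> uses every edge of the circle, including the free one at
  \<open>q\<close>.\<close>

lemma circular_arc_of_model:
  assumes N: "3 \<le> N" and cm: "circular_model (pverts G) (parcs G) N a b"
    and am: "acyclic_model r (pverts G) N a b"
  shows "r_acyclic_circular_arc r G"
proof -
  define c where "c t = nat (t mod N)" for t
  have per: "periodic N c"
    unfolding periodic_def c_def using N by (auto simp: eq_nat_nat_iff)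
  define f where "f x = arc_path c (a x) (b x)" for x
  have ab: "a x \<le> b x" "b x < a x + N" if "x \<in> pverts G" for x
    using cm that by (auto simp: circular_model_def)
  have sub: "pverts (f x) \<subseteq> pverts (circle c)" "parcs (f x) \<subseteq> parcs (circle c)" for x
  proof -
    show "pverts (f x) \<subseteq> pverts (circle c)" by (auto simp: f_def arc_path_def circle_def)
    show "parcs (f x) \<subseteq> parcs (circle c)"
    proof
      fix e assume "e \<in> parcs (f x)"
      moreover obtain y z where "e = (y, z)" by (cases e)
      ultimately show "e \<in> parcs (circle c)" unfolding f_def using arc_path_parcs[of y z] circle_parcs[of y z] by blast
    qed
  qed
  have rep: "subpath_representation G (circle c) f"
    unfolding subpath_representation_def
  proof (intro conjI ballI impI)
    fix x assume x: "x \<in> pverts G"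
    have "path_graph (f x)" unfolding f_def
      using path_graph_arc_path periodic_inj_on[OF per] ab[OF x] by blast
    then show "subpath (f x) (circle c)"
      unfolding subpath_def subgraph_iff using sub[of x] wf_circle[of c] wf_arc_path[of c "a x" "b x"] by (simp add: f_def)
  next
    fix x y assume xy: "x \<in> pverts G" "y \<in> pverts G" "x \<noteq> y"
    have "(x, y) \<in> parcs G \<longleftrightarrow> (\<exists>k. a x \<le> b y + k * N \<and> a y + k * N \<le> b x)"
      using cm xy unfolding circular_model_def by blast
    also have "\<dots> \<longleftrightarrow> pverts (f x) \<inter> pverts (f y) \<noteq> {}"
      using arcs_meet_iff[OF per ab(1)[OF xy(1)] ab(1)[OF xy(2)]] by (simp add: f_def arc_path_def)
    finally show "(x, y) \<in> parcs G \<longleftrightarrow> pverts (f x) \<inter> pverts (f y) \<noteq> {}" .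
  qed
  have "r_acyclic_representation r G f"
    unfolding r_acyclic_representation_def acyclic_graph_def
  proof (intro allI impI notI)
    fix X assume X: "X \<subseteq> pverts G \<and> card X \<le> r"
    assume "\<exists>C. cycle_graph C \<and> subgraph (with_proj C) (with_proj (union_graph f X))"
    then obtain C where C: "cycle_graph C" and cs: "pverts C \<subseteq> pverts (union_graph f X)"
      "parcs C \<subseteq> parcs (union_graph f X)" unfolding subgraph_iff by blast
    obtain q where q: "\<forall>x\<in>X. \<forall>k. \<not> (a x + k * N \<le> q \<and> q < b x + k * N)"
      using am X unfolding acyclic_model_def by meson
    have "pverts (union_graph f X) \<subseteq> range c" "parcs (union_graph f X) \<subseteq> parcs (circle c)"
      using sub by (auto simp: union_graph_def circle_def)
    then have "(c q, c (q + 1)) \<in> parcs C"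
      using cycle_in_circle[OF per C] cs by (meson order_trans)
    then obtain x where x: "x \<in> X" "(c q, c (q + 1)) \<in> parcs (f x)" using cs(2) by (auto simp: union_graph_def)
    then obtain t where t: "a x \<le> t" "t < b x"
      "c q = c t \<and> c (q + 1) = c (t + 1) \<or> c q = c (t + 1) \<and> c (q + 1) = c t"
      unfolding f_def arc_path_parcs by blast
    have dvd: "N dvd s - s'" if "c s = c s'" for s s' using that periodicD(2)[OF per] by (simp add: mod_eq_dvd_iff)
    from t(3) show False
    proof
      assume "c q = c t \<and> c (q + 1) = c (t + 1)"
      then have "N dvd q - t" using dvd[of q t] by simp
      then obtain k where "q - t = N * k" by (elim dvdE)
      then have "a x + k * N \<le> q \<and> q < b x + k * N" using t(1,2) by (simp add: algebra_simps)
      then show False using q x(1) by blast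
    next
      assume h: "c q = c (t + 1) \<and> c (q + 1) = c t"
      \<comment> \<open>An edge of the arc matching the free edge in reverse would make
        \<open>N\<close> divide 2.\<close>
      have "N dvd (q + 1 - t) - (q - (t + 1))"
        by (rule dvd_diff[OF dvd[OF conjunct2[OF h]] dvd[OF conjunct1[OF h]]])
      then have "N dvd 2" by simp
      then show False using N zdvd_imp_le[of N 2] by simp
    qed
  qed
  then show ?thesis
    unfolding r_acyclic_circular_arc_def circular_arc_representation_def
    using rep cycle_graph_circle[OF per] by blast
qed

theorem theorem1:
  fixes G :: "'a pair_pre_digraph" and r :: nat
  assumes "pair_graph G"
    and "connected G"
    and "4 \<le> r"
  shows "r_locally_interval r G \<longleftrightarrow> r_acyclic_circular_arc r G"
proof
  interpret connected_simple_graph "pverts G" "parcs G"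
    by (rule pair_graph_connected_simple_graph[OF assms(1,2)])
  note ball = half_ball_eq[OF assms(1)]
  {
    assume loc: "r_locally_interval r G"
    have "\<exists>l u. interval_model (ball_verts v r) (ball_arcs v r) l u" if "v \<in> pverts G" for v
      using loc interval_model_of_graph that ball[OF that] unfolding r_locally_interval_def by metis
    then interpret locally_interval_graph "pverts G" "parcs G" r
      using assms(3) by unfold_locales auto
    show "r_acyclic_circular_arc r G"
      using acyclic_circular_model circular_arc_of_model by blast
  next
    assume "r_acyclic_circular_arc r G"
    then obtain N a b where m: "3 \<le> N" "circular_model (pverts G) (parcs G) N a b"
      "acyclic_model r (pverts G) N a b" using circular_model_of_graph by blast
    interpret arc_model "pverts G" "parcs G" r N a b
      using m assms(3) by unfold_locales auto
    show "r_locally_interval r G"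
      unfolding r_locally_interval_def
    proof
      fix v assume v: "v \<in> pverts G"
      obtain l u where "interval_model (ball_verts v r) (ball_arcs v r) l u"
        using ball_interval_model[OF v] by blast
      moreover have "finite (ball_verts v r)" using finite_V by (simp add: ball_verts_def)
      ultimately show "interval_graph (half_ball G v r)"
        using interval_graph_of_model[of "half_ball G v r" l u] ball[OF v] by simp
    qed
  }
qed

end
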